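(* Let $\Omega$ be the unit ball of $\mathbb{C}^{4}$ for the standard Hermitian norm, and for an integer $m\ge1$ and a real number $\mu>0$ let $$\widehat{\Omega}_{m}(\mu)=\{(z,Z)\in\Omega\times\mathbb{C}^{m}:\|Z\|^{2}<(1-\|z\|^{2})^{\mu}\}.$$ For $1\le m\le7$, let $\mu_m$ be the smallest positive root of the polynomial $$q_m(\mu)=(4+m\mu)\left[6+\tfrac14(19m-25)\mu+m(m-5)\mu^{2}+\tfrac1{16}(m^{3}-10m^{2}+15m+10)\mu^{3}\right].$$ If $m\ge8$, the domain $\widehat{\Omega}_{m}(\mu)$ is a Lu Qikeng domain for every $\mu\in\,]0,+\infty[$. If $1\le m\le7$, the domain $\widehat{\Omega}_{m}(\mu)$ is a Lu Qikeng domain if and only if $0<\mu\le\mu_m$.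
   Context: A domain $U\subset\mathbb{C}^n$ is called a Lu Qikeng domain if its Bergman kernel $K_U(z,w)$ has no zero on $U\times U$. $\|\cdot\|$ denotes the standard Hermitian norm. The polynomial $q_m$ is $q_m(\mu)=P_{\mu}^{m}(\frac12)$, where, with $(m+1)_j=(m+1)(m+2)\cdots(m+j)$, $$P_{\mu}^{m}(\eta)=(1-\mu)(2-\mu)(3-\mu)(4-\mu)+5(m+1)(1-\mu)(5-3\mu)(2-\mu)\mu\eta+5(m+1)_2(1-\mu)(7-5\mu)\mu^{2}\eta^{2}+10(m+1)_3(1-\mu)\mu^{3}\eta^{3}+(m+1)_4\mu^{4}\eta^{4}.$$ For $1\le m\le 7$ it has at least one positive root. *)

theory Defs
  imports "HOL-Analysis.Analysis"
begin

text \<open>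
  \<open>\<complex>\<^sup>n\<close> is rendered as \<open>complex ^ 'n\<close> with \<open>n = CARD('n)\<close>; the library norm on this type
  is the standard Hermitian norm, and \<open>lborel\<close> is Lebesgue measure on the underlying
  real space of dimension \<open>2n\<close>.
\<close>

text \<open>Only meaningful for open \<open>U\<close>: complex (Frechet) differentiability at every point.\<close>

definition holomorphic_several :: "(complex ^ 'n \<Rightarrow> complex) \<Rightarrow> (complex ^ 'n) set \<Rightarrow> bool" where
  "holomorphic_several f U \<longleftrightarrow>
     (\<forall>z\<in>U. \<exists>f'. (f has_derivative f') (at z) \<and> (\<forall>c v. f' (c *s v) = c * f' v))"

definition bergman_space :: "(complex ^ 'n) set \<Rightarrow> (complex ^ 'n \<Rightarrow> complex) set" where
  "bergman_space U =
     {f. holomorphic_several f U \<and> set_integrable lborel U (\<lambda>z. (cmod (f z))\<^sup>2)}"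

text \<open>
  \<open>k = K\<^sub>U(\<cdot>, w)\<close> is the element of the Bergman space with
  \<open>f w = \<langle>f, k\<rangle>\<close> for all \<open>f\<close>; it is determined on \<open>U\<close> only, so the description
  selects the value \<open>k z\<close> rather than the function \<open>k\<close>.
\<close>

definition bergman_kernel :: "(complex ^ 'n) set \<Rightarrow> complex ^ 'n \<Rightarrow> complex ^ 'n \<Rightarrow> complex" where
  "bergman_kernel U z w =
     (THE c. \<exists>k\<in>bergman_space U.
        (\<forall>f\<in>bergman_space U. f w = (LINT x:U|lborel. f x * cnj (k x))) \<and> c = k z)"

definition lu_qikeng_domain :: "(complex ^ 'n) set \<Rightarrow> bool" where
  "lu_qikeng_domain U \<longleftrightarrow>
     open U \<and> connected U \<and> U \<noteq> {} \<and> (\<forall>z\<in>U. \<forall>w\<in>U. bergman_kernel U z w \<noteq> 0)"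

text \<open>The identification \<open>\<complex>\<^sup>k \<times> \<complex>\<^sup>m = \<complex>\<^sup>k\<^sup>+\<^sup>m\<close>.\<close>

definition vec_join :: "'a ^ 'k \<Rightarrow> 'a ^ 'm \<Rightarrow> 'a ^ ('k::finite + 'm::finite)" where
  "vec_join z Z = (\<chi> i. case i of Inl j \<Rightarrow> z $ j | Inr j \<Rightarrow> Z $ j)"

definition hartogs_ball :: "real \<Rightarrow> (complex ^ (4 + 'm::finite)) set" where
  "hartogs_ball \<mu> =
     {vec_join z Z | z Z. z \<in> ball 0 1 \<and> (norm Z)\<^sup>2 < (1 - (norm z)\<^sup>2) powr \<mu>}"

definition q_poly :: "nat \<Rightarrow> real \<Rightarrow> real" where
  "q_poly m \<mu> = (4 + real m * \<mu>) *
     (6 + 1/4 * (19 * real m - 25) * \<mu> + real m * (real m - 5) * \<mu>^2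
        + 1/16 * (real m ^ 3 - 10 * real m ^ 2 + 15 * real m + 10) * \<mu>^3)"

definition smallest_positive_root :: "nat \<Rightarrow> real" where
  "smallest_positive_root m = (LEAST \<mu>. 0 < \<mu> \<and> q_poly m \<mu> = 0)"

definition P_poly :: "nat \<Rightarrow> real \<Rightarrow> real \<Rightarrow> real" where
  "P_poly m \<mu> \<eta> =
     (1 - \<mu>) * (2 - \<mu>) * (3 - \<mu>) * (4 - \<mu>)
     + 5 * pochhammer (real m + 1) 1 * (1 - \<mu>) * (5 - 3*\<mu>) * (2 - \<mu>) * \<mu> * \<eta>
     + 5 * pochhammer (real m + 1) 2 * (1 - \<mu>) * (7 - 5*\<mu>) * \<mu>^2 * \<eta>^2
     + 10 * pochhammer (real m + 1) 3 * (1 - \<mu>) * \<mu>^3 * \<eta>^3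
     + pochhammer (real m + 1) 4 * \<mu>^4 * \<eta>^4"

lemma q_poly_eq_P_poly: "q_poly m \<mu> = P_poly m \<mu> (1/2)"
  unfolding q_poly_def P_poly_def
  by (simp add: eval_nat_numeral pochhammer_Suc) (simp add: field_simps)

lemma q_poly_has_positive_root:
  assumes "1 \<le> m" "m \<le> 7"
  shows "\<exists>\<mu>>0. q_poly m \<mu> = 0"
proof -
  have "m = 1 \<or> m = 2 \<or> m = 3 \<or> m = 4 \<or> m = 5 \<or> m = 6 \<or> m = 7"
    using assms by linarith
  then have "q_poly m 2 \<le> 0 \<or> q_poly m 10 \<le> 0"
    by (elim disjE) (simp_all add: q_poly_def)
  then obtain b where b: "0 < b" "q_poly m b \<le> 0"
    by (metis zero_less_numeral)
  have "\<exists>x\<ge>0. x \<le> b \<and> q_poly m x = 0"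
    by (rule IVT2') (use b in \<open>auto simp: q_poly_def intro!: continuous_intros\<close>)
  then obtain x where "0 \<le> x" "q_poly m x = 0" by blast
  moreover have "q_poly m 0 \<noteq> 0" by (simp add: q_poly_def)
  ultimately show ?thesis by (metis order_le_less)
qed

lemma smallest_positive_root:
  assumes "1 \<le> m" "m \<le> 7"
  shows "0 < smallest_positive_root m" "q_poly m (smallest_positive_root m) = 0"
    and "\<And>\<mu>. 0 < \<mu> \<Longrightarrow> q_poly m \<mu> = 0 \<Longrightarrow> smallest_positive_root m \<le> \<mu>"
proof -
  obtain b where b: "b > 0" "q_poly m b = 0"
    using q_poly_has_positive_root[OF assms] by blast
  let ?R = "{x \<in> {0..b}. q_poly m x = 0}"
  have "continuous_on {0..b} (q_poly m)"
    unfolding q_poly_def by (intro continuous_intros)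
  then have "closed ?R"
    by (intro continuous_closed_preimage_constant) auto
  moreover have "bounded ?R"
    by (rule bounded_subset[OF bounded_closed_interval[of 0 b]]) auto
  ultimately have "compact ?R" by (simp add: compact_eq_bounded_closed)
  moreover have "?R \<noteq> {}" using b by auto
  ultimately obtain r where r: "r \<in> ?R" "\<forall>x\<in>?R. r \<le> x"
    using compact_attains_inf by blast
  have "q_poly m 0 \<noteq> 0" by (simp add: q_poly_def)
  then have "0 < r" using r(1) by (cases "r = 0") auto
  moreover have least: "r \<le> x" if "0 < x" "q_poly m x = 0" for x
    using r that by (cases "x \<le> b") auto
  ultimately have "smallest_positive_root m = r"
    unfolding smallest_positive_root_def by (intro Least_equality) (use r in auto)
  then show "0 < smallest_positive_root m" "q_poly m (smallest_positive_root m) = 0"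
    and "\<And>\<mu>. 0 < \<mu> \<Longrightarrow> q_poly m \<mu> = 0 \<Longrightarrow> smallest_positive_root m \<le> \<mu>"
    using \<open>0 < r\<close> r(1) least by auto
qed

end

theory Submission
  imports Defs "HOL-Complex_Analysis.Complex_Analysis" "HOL-Computational_Algebra.Fundamental_Theorem_Algebra"
begin

text \<open>
Write \<open>m\<close> for the dimension of the fibre, \<open>x = \<langle>z, w\<rangle>\<close>, \<open>y = \<langle>Z, W\<rangle>\<close> and \<open>s\<^sub>k = \<mu> (m + k)\<close>. The
Bergman kernel of the domain is computed in closed form, and its zeros are those of a quartic polynomial.

\<^emph>\<open>The kernel.\<close> Expanding a Bergman function in homogeneous parts along the fibres reduces the
reproducing property to two facts. On a ball of radius \<open>R\<close>, integration against
\<open>\<langle>W, Z\<rangle>\<^sup>k\<close> extracts the homogeneous part of degree \<open>k\<close> at \<open>W\<close> (\<open>ball_reproducing\<close>); with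
\<open>R\<^sup>2 = (1 - \<parallel>z\<parallel>\<^sup>2) powr \<mu>\<close> this leaves a weighted Bergman space on the base with weight
\<open>(1 - \<parallel>z\<parallel>\<^sup>2) powr s\<^sub>k\<close>, whose kernel is a power of \<open>1 - x\<close> (\<open>weighted_bergman_reproducing\<close>).
Summing over \<open>k\<close> gives the kernel as the series with terms \<open>kernel_term\<close>. Both facts come from the
Gaussian weight: there the reproducing formula (\<open>fock_reproducing\<close>) is just the translation
invariance of Lebesgue measure and the mean value property on circles, and homogeneity carries it to
any other radial weight (\<open>radial_integral_homogeneous\<close>). The only symmetry used is the circle action, and the
only function theory is that of one variable along complex lines.

\<^emph>\<open>The zeros.\<close> For \<open>t = y (1 - x) powr (-\<mu>)\<close> the series is, up to a factor without zeros,
\<open>P (1 / (1 - t))\<close> for the quartic \<open>P = P\<^sub>\<mu>\<^sup>m\<close>, because the coefficients are a quartic polynomial in \<open>k\<close>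
times \<open>(m + k)! / k!\<close>. On the domain \<open>t\<close> ranges over exactly the unit disc, and \<open>t \<mapsto> 1 / (1 - t)\<close> maps
it onto the half plane \<open>Re \<eta> > 1/2\<close>. Hence the domain is Lu Qikeng iff \<open>P\<close> has no zero there
(\<open>lu_qikeng_hartogs_ball_iff\<close>).

\<^emph>\<open>The quartic.\<close> In the variable \<open>\<xi> = \<eta> - 1/2\<close> the constant coefficient of \<open>P\<close> is \<open>q\<^sub>m(\<mu>)\<close>. The
Routh-Hurwitz conditions exclude zeros with \<open>Re \<xi> > 0\<close> (\<open>quartic_no_root_right_half_plane\<close>). The
two Hurwitz minors stay positive for all \<open>\<mu>\<close> when \<open>m \<ge> 8\<close>, and up to \<open>\<mu>\<^sub>m\<close> when \<open>m \<le> 7\<close>, so stability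
is lost exactly when \<open>q\<^sub>m\<close> changes sign. Beyond \<open>\<mu>\<^sub>m\<close> the constant or, for \<open>m = 1, 2\<close> and large \<open>\<mu>\<close>,
the linear coefficient is negative, which forces a zero in the half plane
(\<open>quartic_stable_coeffs_nonneg\<close>).
\<close>

section \<open>Invariance of Lebesgue measure\<close>

lemma nn_integral_lborel_translate:
  fixes f :: "'a::euclidean_space \<Rightarrow> ennreal"
  assumes [measurable]: "f \<in> borel_measurable borel"
  shows "(\<integral>\<^sup>+x. f (c + x) \<partial>lborel) = (\<integral>\<^sup>+x. f x \<partial>lborel)"
proof -
  have "(\<integral>\<^sup>+x. f x \<partial>lborel) = (\<integral>\<^sup>+x. f x \<partial>distr lborel borel ((+) c))"
    by (simp add: lborel_distr_plus)
  also have "\<dots> = (\<integral>\<^sup>+x. f (c + x) \<partial>lborel)"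
    by (subst nn_integral_distr) auto
  finally show ?thesis ..
qed

lemma nn_integral_lborel_reflect:
  fixes f :: "'a::euclidean_space \<Rightarrow> ennreal"
  assumes [measurable]: "f \<in> borel_measurable borel"
  shows "(\<integral>\<^sup>+x. f (c - x) \<partial>lborel) = (\<integral>\<^sup>+x. f x \<partial>lborel)"
proof -
  have "lborel = distr lborel borel (\<lambda>x::'a. c - x)"
    using lborel_affine[of "-1" c] by (simp add: density_1)
  then have "(\<integral>\<^sup>+x. f x \<partial>lborel) = (\<integral>\<^sup>+x. f x \<partial>distr lborel borel (\<lambda>x::'a. c - x))"
    by simp
  also have "\<dots> = (\<integral>\<^sup>+x. f (c - x) \<partial>lborel)"
    by (subst nn_integral_distr) auto
  finally show ?thesis ..
qed

text \<open>
Uniqueness of Haar measure by Fubini: for a translation invariant \<open>M\<close>, the double integral of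
\<open>1\<^sub>A(x) 1\<^sub>B(x + y)\<close> computed in both orders gives \<open>M(A) \<lambda>(B) = M(B) \<lambda>(A)\<close>. With \<open>B\<close> the unit ball, which an
isometry preserves, the constant of proportionality is 1. This covers rotations of \<open>\<complex>\<^sup>n\<close> and the
identification \<open>\<complex>\<^sup>k \<times> \<complex>\<^sup>m = \<complex>\<^sup>k\<^sup>+\<^sup>m\<close> at once.
\<close>

lemma lborel_distr_isometry:
  fixes T :: "'a::euclidean_space \<Rightarrow> 'b::euclidean_space"
  assumes lin: "linear T" and iso: "\<And>x. norm (T x) = norm x" and surj: "surj T"
    and dim: "DIM('a) = DIM('b)"
  shows "distr lborel borel T = lborel"
proof -
  define M where "M = distr lborel borel T"
  have [measurable]: "T \<in> borel_measurable borel"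
    by (intro borel_measurable_continuous_onI linear_continuous_on linear_conv_bounded_linear[THEN iffD1] lin)
  have sets_M [measurable_cong]: "sets M = sets borel" by (simp add: M_def)
  have space_M: "space M = UNIV" by (simp add: M_def)
  have ball: "emeasure M (ball 0 r) = emeasure lborel (ball (0::'b) r)" if "r > 0" for r
  proof -
    have "emeasure M (ball 0 r) = emeasure lborel (T -` ball 0 r)"
      by (simp add: M_def emeasure_distr)
    also have "T -` ball 0 r = ball 0 r" by (auto simp: iso)
    also have "emeasure lborel (ball (0::'a) r) = emeasure lborel (ball (0::'b) r)"
      using that by (simp add: emeasure_ball dim)
    finally show ?thesis .
  qed
  interpret M: sigma_finite_measure M
  proof (unfold_locales, intro exI conjI ballI)
    show "countable (range (\<lambda>n. ball (0::'b) (real (Suc n))))" by simp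
    show "range (\<lambda>n. ball (0::'b) (real (Suc n))) \<subseteq> sets M" by (auto simp: sets_M)
    show "\<Union> (range (\<lambda>n. ball (0::'b) (real (Suc n)))) = space M"
    proof -
      have "\<exists>n. norm x < real (Suc n)" for x :: 'b
        by (meson less_SucI of_nat_less_iff order_less_trans reals_Archimedean2 lessI)
      then show ?thesis by (auto simp: space_M)
    qed
    fix a assume "a \<in> range (\<lambda>n. ball (0::'b) (real (Suc n)))"
    then show "emeasure M a \<noteq> \<infinity>"
      using ball by (auto simp: emeasure_ball)
  qed
  interpret pair_sigma_finite M lborel ..
  have transl: "(\<integral>\<^sup>+x. f (x + c) \<partial>M) = (\<integral>\<^sup>+x. f x \<partial>M)"
    if [measurable]: "f \<in> borel_measurable borel" for f c
  proof -
    obtain d where d: "T d = c" using surj by (metis surj_def)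
    have "(\<integral>\<^sup>+x. f (x + c) \<partial>M) = (\<integral>\<^sup>+x. f (T x + c) \<partial>lborel)"
      unfolding M_def by (subst nn_integral_distr) auto
    also have "\<dots> = (\<integral>\<^sup>+x. f (T (d + x)) \<partial>lborel)"
      by (simp add: linear_add[OF lin] d add.commute)
    also have "\<dots> = (\<integral>\<^sup>+x. f (T x) \<partial>lborel)"
      using nn_integral_lborel_translate[of "\<lambda>x. f (T x)"] by simp
    also have "\<dots> = (\<integral>\<^sup>+x. f x \<partial>M)"
      unfolding M_def by (subst nn_integral_distr) auto
    finally show ?thesis .
  qed
  have key: "emeasure M A * emeasure lborel B = emeasure M B * emeasure lborel A"
    if [measurable]: "A \<in> sets borel" "B \<in> sets borel" for A B :: "'b set"
  proof -
    have "emeasure M A * emeasure lborel B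
        = (\<integral>\<^sup>+x. indicator A x * (\<integral>\<^sup>+y. indicator B (x + y) \<partial>lborel) \<partial>M)"
      by (subst nn_integral_lborel_translate) (auto simp: nn_integral_multc sets_M)
    also have "\<dots> = (\<integral>\<^sup>+x. (\<integral>\<^sup>+y. indicator A x * indicator B (x + y) \<partial>lborel) \<partial>M)"
      by (subst nn_integral_cmult) auto
    also have "\<dots> = (\<integral>\<^sup>+y. (\<integral>\<^sup>+x. indicator A x * indicator B (x + y) \<partial>M) \<partial>lborel)"
      by (rule Fubini'[symmetric]) measurable
    also have "\<dots> = (\<integral>\<^sup>+y. (\<integral>\<^sup>+x. indicator A (x - y) * indicator B x \<partial>M) \<partial>lborel)"
    proof (rule nn_integral_cong)
      fix y
      show "(\<integral>\<^sup>+x. indicator A x * indicator B (x + y) \<partial>M) = (\<integral>\<^sup>+x. indicator A (x - y) * indicator B x \<partial>M)"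
        using transl[of "\<lambda>x. indicator A (x - y) * indicator B x" y] by simp
    qed
    also have "\<dots> = (\<integral>\<^sup>+x. (\<integral>\<^sup>+y. indicator A (x - y) * indicator B x \<partial>lborel) \<partial>M)"
      by (rule Fubini') measurable
    also have "\<dots> = (\<integral>\<^sup>+x. (\<integral>\<^sup>+y. indicator A (x - y) \<partial>lborel) * indicator B x \<partial>M)"
      by (subst nn_integral_multc) auto
    also have "\<dots> = (\<integral>\<^sup>+x. emeasure lborel A * indicator B x \<partial>M)"
      by (subst nn_integral_lborel_reflect) auto
    also have "\<dots> = emeasure lborel A * emeasure M B"
      by (subst nn_integral_cmult) (auto simp: sets_M)
    finally show ?thesis by (simp add: mult.commute)
  qed
  have "M = lborel"
  proof (rule measure_eqI)
    fix A assume "A \<in> sets M"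
    then have "A \<in> sets borel" by (simp add: sets_M)
    from key[OF this, of "ball 0 1"]
    have "emeasure lborel (ball (0::'b) 1) * emeasure M A = emeasure lborel (ball (0::'b) 1) * emeasure lborel A"
      by (simp add: ball mult.commute)
    moreover have "emeasure lborel (ball (0::'b) 1) \<noteq> 0" "emeasure lborel (ball (0::'b) 1) \<noteq> \<infinity>"
      by (simp_all add: emeasure_ball less_imp_neq[OF unit_ball_vol_pos, symmetric])
    ultimately show "emeasure M A = emeasure lborel A"
      by (simp add: ennreal_mult_cancel_left)
  qed (simp add: sets_M)
  then show ?thesis by (simp add: M_def)
qed

lemma integral_lborel_translate:
  fixes f :: "'a::euclidean_space \<Rightarrow> 'b::{banach, second_countable_topology}"
  assumes [measurable]: "f \<in> borel_measurable borel"
  shows "(\<integral>x. f (c + x) \<partial>lborel) = (\<integral>x. f x \<partial>lborel)"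
    and "integrable lborel (\<lambda>x. f (c + x)) \<longleftrightarrow> integrable lborel f"
proof -
  have "(\<integral>x. f x \<partial>lborel) = (\<integral>x. f x \<partial>distr lborel borel ((+) c))"
    by (simp add: lborel_distr_plus)
  also have "\<dots> = (\<integral>x. f (c + x) \<partial>lborel)"
    by (subst integral_distr) auto
  finally show "(\<integral>x. f (c + x) \<partial>lborel) = (\<integral>x. f x \<partial>lborel)" ..
  have "integrable lborel f \<longleftrightarrow> integrable (distr lborel borel ((+) c)) f"
    by (simp add: lborel_distr_plus)
  also have "\<dots> \<longleftrightarrow> integrable lborel (\<lambda>x. f (c + x))"
    by (subst integrable_distr_eq) auto
  finally show "integrable lborel (\<lambda>x. f (c + x)) \<longleftrightarrow> integrable lborel f" ..
qed

lemma integral_lborel_scale: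
  fixes f :: "'a::euclidean_space \<Rightarrow> 'b::{banach, second_countable_topology}"
  assumes [measurable]: "f \<in> borel_measurable borel" and c: "c > 0"
  shows "(\<integral>x. f x \<partial>lborel) = c ^ DIM('a) *\<^sub>R (\<integral>x. f (c *\<^sub>R x) \<partial>lborel)"
    and "integrable lborel (\<lambda>x. f (c *\<^sub>R x)) \<longleftrightarrow> integrable lborel f"
proof -
  have eq: "lborel = density (distr lborel borel (\<lambda>x::'a. c *\<^sub>R x)) (\<lambda>_. ennreal (c ^ DIM('a)))"
    using lborel_affine[of c "0::'a"] c by simp
  have "(\<integral>x. f x \<partial>lborel) = (\<integral>x. f x \<partial>density (distr lborel borel (\<lambda>x::'a. c *\<^sub>R x)) (\<lambda>_. ennreal (c ^ DIM('a))))"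
    using eq by simp
  also have "\<dots> = c ^ DIM('a) *\<^sub>R (\<integral>x. f (c *\<^sub>R x) \<partial>lborel)"
    using c by (subst integral_density) (auto simp: integral_distr)
  finally show "(\<integral>x. f x \<partial>lborel) = c ^ DIM('a) *\<^sub>R (\<integral>x. f (c *\<^sub>R x) \<partial>lborel)" .
  have "integrable lborel f \<longleftrightarrow> integrable (density (distr lborel borel (\<lambda>x::'a. c *\<^sub>R x)) (\<lambda>_. ennreal (c ^ DIM('a)))) f"
    using eq by simp
  also have "\<dots> \<longleftrightarrow> integrable (distr lborel borel (\<lambda>x::'a. c *\<^sub>R x)) f"
  proof (subst integrable_density)
    have "integrable M (\<lambda>x. c ^ DIM('a) *\<^sub>R f x) \<longleftrightarrow> integrable M f" for M :: "'a measure"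
    proof
      assume "integrable M (\<lambda>x. c ^ DIM('a) *\<^sub>R f x)"
      then have "integrable M (\<lambda>x. inverse (c ^ DIM('a)) *\<^sub>R (c ^ DIM('a) *\<^sub>R f x))"
        by (rule integrable_scaleR_right)
      then show "integrable M f" using c by simp
    qed (rule integrable_scaleR_right)
    then show "integrable (distr lborel borel ((*\<^sub>R) c)) (\<lambda>x. c ^ DIM('a) *\<^sub>R f x)
        \<longleftrightarrow> integrable (distr lborel borel ((*\<^sub>R) c)) f" .
  qed (use c in auto)
  also have "\<dots> \<longleftrightarrow> integrable lborel (\<lambda>x. f (c *\<^sub>R x))"
    by (subst integrable_distr_eq) auto
  finally show "integrable lborel (\<lambda>x. f (c *\<^sub>R x)) \<longleftrightarrow> integrable lborel f" ..
qed

section \<open>The Hermitian product and circle averages\<close>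

lemma norm_cmult_vec [simp]: "norm (c *s z) = cmod c * norm z" for z :: "complex ^ 'n"
proof -
  have "norm (c *s z) = L2_set (\<lambda>i. cmod c * norm (z $ i)) UNIV"
    by (simp add: norm_vec_def norm_mult)
  also have "\<dots> = cmod c * norm z"
    by (simp add: norm_vec_def L2_set_right_distrib)
  finally show ?thesis .
qed

lemma bounded_linear_cmult_vec: "bounded_linear (\<lambda>z :: complex ^ 'n. c *s z)"
  by (rule bounded_linear_intro[where K="cmod c"])
     (simp_all add: vec_eq_iff algebra_simps)

lemma bounded_linear_cmult_vec_left: "bounded_linear (\<lambda>c. c *s (z :: complex ^ 'n))"
  by (rule bounded_linear_intro[where K="norm z"])
     (simp_all add: vec_eq_iff algebra_simps)

lemma continuous_on_cmult_vec [continuous_intros]: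
  assumes "continuous_on S f" "continuous_on S g"
  shows "continuous_on S (\<lambda>x. f x *s (g x :: complex ^ 'n))"
  unfolding vector_scalar_mult_def
  by (intro continuous_on_vec_lambda continuous_on_mult continuous_on_component assms)

lemma scaleR_eq_cmult_vec: "r *\<^sub>R z = complex_of_real r *s (z :: complex ^ 'n)"
  by (simp add: vec_eq_iff) (simp add: scaleR_conv_of_real)

definition herm :: "complex ^ 'n \<Rightarrow> complex ^ 'n \<Rightarrow> complex" where
  "herm z w = (\<Sum>i\<in>UNIV. z $ i * cnj (w $ i))"

lemma herm_simps [simp]:
  "herm (z + z') w = herm z w + herm z' w" "herm z (w + w') = herm z w + herm z w'"
  "herm (c *s z) w = c * herm z w" "herm z (c *s w) = cnj c * herm z w"
  "herm 0 w = 0" "herm z 0 = 0"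
  by (simp_all add: herm_def distrib_left distrib_right sum.distrib sum_distrib_left mult_ac)

lemma cnj_herm: "cnj (herm z w) = herm w z"
  by (simp add: herm_def mult.commute)

lemma herm_self: "herm z z = of_real ((norm z)\<^sup>2)"
proof -
  have "herm z z = (\<Sum>i\<in>UNIV. of_real ((norm (z $ i))\<^sup>2))"
    unfolding herm_def by (intro sum.cong refl) (simp add: complex_norm_square[symmetric] del: of_real_power)
  also have "\<dots> = of_real ((norm z)\<^sup>2)"
    by (simp add: norm_vec_def L2_set_def sum_nonneg)
  finally show ?thesis .
qed

lemma norm_herm_le: "cmod (herm z w) \<le> norm z * norm w"
proof -
  have "cmod (herm z w) \<le> (\<Sum>i\<in>UNIV. \<bar>norm (z $ i)\<bar> * \<bar>norm (w $ i)\<bar>)"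
    unfolding herm_def by (rule order_trans[OF norm_sum]) (simp add: norm_mult)
  also have "\<dots> \<le> norm z * norm w"
    unfolding norm_vec_def by (rule L2_set_mult_ineq)
  finally show ?thesis .
qed

lemma norm_add_sq_herm:
  "of_real ((norm (z + w))\<^sup>2) = of_real ((norm z)\<^sup>2) + herm z w + herm w z + of_real ((norm w)\<^sup>2)"
  unfolding herm_self[symmetric] by simp

lemma bounded_linear_herm: "bounded_linear (\<lambda>z. herm z w)"
  by (rule bounded_linear_intro[where K="norm w"])
     (simp_all add: scaleR_eq_cmult_vec norm_herm_le scaleR_conv_of_real)

lemma continuous_on_herm [continuous_intros]:
  assumes "continuous_on S f" "continuous_on S g"
  shows "continuous_on S (\<lambda>x. herm (f x) (g x))"
  unfolding herm_def
  by (intro continuous_on_sum continuous_on_mult continuous_on_cnj continuous_on_component assms)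

lemma borel_measurable_herm [measurable]:
  "(\<lambda>x. herm x w) \<in> borel_measurable borel" "(\<lambda>x. herm w x) \<in> borel_measurable borel"
  by (intro borel_measurable_continuous_onI continuous_intros)+

lemma lborel_distr_unimodular:
  fixes c :: complex
  assumes "cmod c = 1"
  shows "distr lborel borel (\<lambda>z :: complex ^ 'n. c *s z) = lborel"
proof (rule lborel_distr_isometry)
  show "linear (\<lambda>z :: complex ^ 'n. c *s z)"
    using bounded_linear_cmult_vec by (rule bounded_linear.linear)
  show "surj (\<lambda>z :: complex ^ 'n. c *s z)"
  proof (rule surjI)
    show "c *s (inverse c *s z) = z" for z :: "complex ^ 'n"
    proof -
      have "c \<noteq> 0" using assms by auto
      then show ?thesis by (simp add: vec_eq_iff)
    qed
  qed
qed (simp_all add: assms)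

lemma integral_lborel_unimodular:
  fixes f :: "complex ^ 'n \<Rightarrow> 'b::{banach, second_countable_topology}"
  assumes [measurable]: "f \<in> borel_measurable borel" and c: "cmod c = 1"
  shows "(\<integral>x. f (c *s x) \<partial>lborel) = (\<integral>x. f x \<partial>lborel)"
proof -
  have [measurable]: "(\<lambda>z :: complex ^ 'n. c *s z) \<in> borel_measurable borel"
    by (intro borel_measurable_continuous_onI continuous_intros)
  have "(\<integral>x. f x \<partial>lborel) = (\<integral>x. f x \<partial>distr lborel borel (\<lambda>z :: complex ^ 'n. c *s z))"
    by (simp add: lborel_distr_unimodular c)
  also have "\<dots> = (\<integral>x. f (c *s x) \<partial>lborel)"
    by (subst integral_distr) auto
  finally show ?thesis ..
qed

text \<open>
Rotation invariance plus Fubini. This is what turns integrals of holomorphic functions over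
circular sets into Taylor coefficients along complex lines through the origin.
\<close>

lemma integral_circle_average:
  fixes h :: "complex ^ 'n \<Rightarrow> complex"
  assumes int: "integrable lborel h"
  shows "(\<integral>z. (\<integral>\<theta>\<in>{0..2*pi}. h (cis \<theta> *s z) \<partial>lborel) \<partial>lborel) = 2 * pi * (\<integral>z. h z \<partial>lborel)"
proof -
  have [measurable]: "h \<in> borel_measurable borel" using int by auto
  have [measurable]: "(\<lambda>x :: real \<times> (complex ^ 'n). cis (fst x) *s snd x) \<in> borel_measurable (borel \<Otimes>\<^sub>M borel)"
    unfolding borel_prod by (intro borel_measurable_continuous_onI continuous_intros)
  let ?f = "\<lambda>\<theta> z. indicator {0..2*pi} \<theta> *\<^sub>R h (cis \<theta> *s z)"
  have meas: "(\<lambda>(\<theta>, z). ?f \<theta> z) \<in> borel_measurable (lborel \<Otimes>\<^sub>M lborel)"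
    unfolding case_prod_beta by measurable
  have "integrable (lborel \<Otimes>\<^sub>M lborel) (\<lambda>(\<theta>, z). ?f \<theta> z)"
  proof (rule lborel_pair.Fubini_integrable[OF meas])
    have "(\<integral>z. norm (?f \<theta> z) \<partial>lborel) = indicator {0..2*pi} \<theta> * (\<integral>z. norm (h z) \<partial>lborel)" for \<theta>
      using integral_lborel_unimodular[of "\<lambda>z. norm (h z)" "cis \<theta>"] by simp
    then show "integrable lborel (\<lambda>\<theta>. \<integral>z. norm (case (\<theta>, z) of (\<theta>, z) \<Rightarrow> ?f \<theta> z) \<partial>lborel)"
      by (simp only: prod.case) (simp add: integrable_mult_left)
    have "integrable lborel (\<lambda>z. h (cis \<theta> *s z))" for \<theta>
    proof -
      have "integrable (distr lborel borel (\<lambda>z :: complex ^ 'n. cis \<theta> *s z)) h"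
        by (simp add: lborel_distr_unimodular int)
      moreover have "(\<lambda>z :: complex ^ 'n. cis \<theta> *s z) \<in> borel_measurable borel"
        by (intro borel_measurable_continuous_onI continuous_intros)
      ultimately show ?thesis
        by (subst (asm) integrable_distr_eq) auto
    qed
    then show "AE \<theta> in lborel. integrable lborel (\<lambda>z. case (\<theta>, z) of (\<theta>, z) \<Rightarrow> ?f \<theta> z)"
      by simp
  qed
  from lborel_pair.Fubini_integral[OF this]
  have "(\<integral>z. (\<integral>\<theta>\<in>{0..2*pi}. h (cis \<theta> *s z) \<partial>lborel) \<partial>lborel) = (\<integral>\<theta>. (\<integral>z. ?f \<theta> z \<partial>lborel) \<partial>lborel)"
    by (simp add: set_lebesgue_integral_def)
  also have "\<dots> = (\<integral>\<theta>. indicator {0..2*pi} \<theta> *\<^sub>R (\<integral>z. h z \<partial>lborel) \<partial>lborel)"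
    using integral_lborel_unimodular[of h "cis _"] by simp
  also have "\<dots> = 2 * pi * (\<integral>z. h z \<partial>lborel)"
    by (simp add: scaleR_conv_of_real)
  finally show ?thesis .
qed

section \<open>Holomorphy along complex lines and homogeneous parts\<close>

text \<open>
By Osgood's lemma this is ordinary holomorphy on open sets; in this weaker-looking form it can be handled with
one-variable theory only.
\<close>

definition slice_holomorphic :: "(complex ^ 'n \<Rightarrow> complex) \<Rightarrow> (complex ^ 'n) set \<Rightarrow> bool" where
  "slice_holomorphic f S \<longleftrightarrow> continuous_on S f \<and>
     (\<forall>a b. (\<lambda>c. f (a + c *s b)) holomorphic_on {c. a + c *s b \<in> S})"

definition taylor_coeff :: "nat \<Rightarrow> (complex \<Rightarrow> complex) \<Rightarrow> complex" where
  "taylor_coeff k h = (deriv ^^ k) h 0 / fact k"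

lemma open_line_preimage:
  "open S \<Longrightarrow> open {c. a + c *s (b :: complex ^ 'n) \<in> S}"
  by (rule open_vimage[unfolded vimage_def]) (auto intro!: continuous_intros)

lemma slice_holomorphicD:
  assumes "slice_holomorphic f S" "\<And>c. c \<in> T \<Longrightarrow> a + c *s b \<in> S"
  shows "(\<lambda>c. f (a + c *s b)) holomorphic_on T"
  using assms unfolding slice_holomorphic_def by (blast intro: holomorphic_on_subset)

lemma continuous_on_contour_integral_circlepath:
  fixes f :: "'a::topological_space \<Rightarrow> complex \<Rightarrow> complex"
  assumes cont: "continuous_on (U \<times> sphere 0 r) (\<lambda>(c, u). f c u)" and r: "r > 0"
  shows "continuous_on U (\<lambda>c. contour_integral (circlepath 0 r) (f c))"
proof -
  have "continuous_on U (\<lambda>c. integral (cbox 0 (2*pi)) (\<lambda>t. f c (0 + r * cis t) * r * \<i> * cis t))"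
  proof (rule integral_continuous_on_param)
    have "continuous_on (U \<times> cbox 0 (2*pi)) (\<lambda>x. (\<lambda>(c, u). f c u) (fst x, 0 + r * cis (snd x)))"
      by (rule continuous_on_compose2[OF cont])
         (use r in \<open>auto intro!: continuous_intros simp: norm_mult\<close>)
    then show "continuous_on (U \<times> cbox 0 (2*pi)) (\<lambda>(c, t). f c (0 + r * cis t) * r * \<i> * cis t)"
      by (auto simp: case_prod_beta intro!: continuous_intros)
  qed
  then show ?thesis
    by (simp add: circlepath_def contour_integral_part_circlepath_eq)
qed

text \<open>
By Morera's theorem: interchanging the two contour integrals reduces the triangle condition to
Cauchy's theorem for each value of the parameter.
\<close>

lemma holomorphic_contour_integral_circlepath:
  assumes cont: "continuous_on (U \<times> sphere 0 r) (\<lambda>(c, u). f c u)" and r: "r > 0" and U: "open U"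
    and hol: "\<And>u. u \<in> sphere 0 r \<Longrightarrow> (\<lambda>c. f c u) holomorphic_on U"
  shows "(\<lambda>c. contour_integral (circlepath 0 r) (f c)) holomorphic_on U"
proof -
  let ?F = "\<lambda>c. contour_integral (circlepath 0 r) (f c)"
  have "?F analytic_on U"
  proof (rule Morera_triangle[OF continuous_on_contour_integral_circlepath[OF cont r] U], intro impI)
    fix a b c assume abc: "convex hull {a, b, c} \<subseteq> U"
    define L where "L x y u = contour_integral (linepath x y) (\<lambda>w. f w u)" for x y u
    have seg: "closed_segment x y \<subseteq> U" if "{x, y} \<subseteq> {a, b, c}" for x y
      using abc hull_mono[OF that, of convex] by (auto simp: segment_convex_hull)
    have swap: "contour_integral (linepath x y) ?F = contour_integral (circlepath 0 r) (L x y)"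
      and int: "L x y contour_integrable_on circlepath 0 r"
      if "{x, y} \<subseteq> {a, b, c}" for x y
    proof -
      have sub: "continuous_on (closed_segment x y \<times> sphere 0 r) (\<lambda>(c, u). f c u)"
        by (rule continuous_on_subset[OF cont]) (use seg[OF that] in auto)
      show "contour_integral (linepath x y) ?F = contour_integral (circlepath 0 r) (L x y)"
        unfolding L_def
        by (rule contour_integral_swap)
           (use sub r in \<open>auto simp: vector_derivative_circlepath vector_derivative_linepath_at
              intro!: continuous_intros\<close>)
      have "continuous_on (sphere 0 r) (\<lambda>u. integral (cbox 0 1) (\<lambda>t. f (linepath x y t) u))"
      proof (rule integral_continuous_on_param)
        have "continuous_on (sphere 0 r \<times> cbox 0 1) (\<lambda>z. (\<lambda>(c, u). f c u) (linepath x y (snd z), fst z))"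
        proof (rule continuous_on_compose2[OF sub])
          show "continuous_on (sphere 0 r \<times> cbox 0 1) (\<lambda>z. (linepath x y (snd z), fst z))"
            unfolding linepath_def by (intro continuous_intros)
        qed (auto simp: linepath_in_path)
        then show "continuous_on (sphere 0 r \<times> cbox 0 1) (\<lambda>(u, t). f (linepath x y t) u)"
          by (simp add: case_prod_beta)
      qed
      then have "continuous_on (sphere 0 r) (L x y)"
        by (simp add: L_def[abs_def] contour_integral_integral continuous_intros)
      then show "L x y contour_integrable_on circlepath 0 r"
        using r by (intro contour_integrable_continuous_circlepath) auto
    qed
    have zero: "L a b u + L b c u + L c a u = 0" if "u \<in> sphere 0 r" for u
    proof -
      have "(\<lambda>w. f w u) holomorphic_on convex hull {a, b, c}"
        using hol[OF that] abc by (rule holomorphic_on_subset)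
      from Cauchy_theorem_triangle[OF this]
      show ?thesis unfolding L_def
        using contour_integral_unique has_chain_integral_chain_integral3 by fastforce
    qed
    have "contour_integral (linepath a b) ?F + contour_integral (linepath b c) ?F + contour_integral (linepath c a) ?F
       = contour_integral (circlepath 0 r) (\<lambda>u. L a b u + L b c u + L c a u)"
      by (simp add: swap contour_integral_add int contour_integrable_add)
    also have "\<dots> = contour_integral (circlepath 0 r) (\<lambda>u. 0)"
      by (rule contour_integral_cong) (use zero r in auto)
    finally show "contour_integral (linepath a b) ?F + contour_integral (linepath b c) ?F + contour_integral (linepath c a) ?F = 0"
      by simp
  qed
  then show ?thesis by (rule analytic_imp_holomorphic)
qed

lemma taylor_coeff_circlepath:
  assumes "h holomorphic_on cball 0 r" "r > 0"
  shows "taylor_coeff k h = contour_integral (circlepath 0 r) (\<lambda>u. h u / u ^ Suc k) / (2 * pi * \<i>)"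
proof -
  have "((\<lambda>u. h u / (u - 0) ^ Suc k) has_contour_integral 2 * pi * \<i> / fact k * (deriv ^^ k) h 0) (circlepath 0 r)"
    by (rule Cauchy_has_contour_integral_higher_derivative_circlepath)
       (use assms in \<open>auto intro: holomorphic_on_imp_continuous_on holomorphic_on_subset\<close>)
  then show ?thesis
    by (simp add: taylor_coeff_def contour_integral_unique)
qed

lemma taylor_coeff_average:
  assumes "h holomorphic_on cball 0 1"
  shows "(\<integral>\<theta>\<in>{0..2*pi}. h (cis \<theta>) * cis (- (real k * \<theta>)) \<partial>lborel) = 2 * pi * taylor_coeff k h"
proof -
  have "((\<lambda>u. h u / (u - 0) ^ Suc k) has_contour_integral 2 * pi * \<i> / fact k * (deriv ^^ k) h 0)
          (part_circlepath 0 1 0 (2*pi))"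
    unfolding circlepath_def[symmetric]
    by (rule Cauchy_has_contour_integral_higher_derivative_circlepath)
       (use assms in \<open>auto intro: holomorphic_on_imp_continuous_on holomorphic_on_subset\<close>)
  then have "((\<lambda>t. h (cis t) / cis t ^ Suc k * \<i> * cis t) has_integral 2 * pi * \<i> / fact k * (deriv ^^ k) h 0) {0..2*pi}"
    by (subst (asm) has_contour_integral_part_circlepath_iff) auto
  then have "((\<lambda>t. (- \<i>) * (h (cis t) / cis t ^ Suc k * \<i> * cis t)) has_integral
       (- \<i>) * (2 * pi * \<i> / fact k * (deriv ^^ k) h 0)) {0..2*pi}"
    by (rule has_integral_mult_right)
  also have "(\<lambda>t. (- \<i>) * (h (cis t) / cis t ^ Suc k * \<i> * cis t)) = (\<lambda>t. h (cis t) * cis (- (real k * t)))"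
  proof
    fix t
    have "cis t ^ k * cis (- (real k * t)) = 1"
      by (simp add: Complex.DeMoivre cis_mult)
    then have "cis (- (real k * t)) = 1 / cis t ^ k"
      by (simp add: field_simps)
    then show "(- \<i>) * (h (cis t) / cis t ^ Suc k * \<i> * cis t) = h (cis t) * cis (- (real k * t))"
      by (simp add: field_simps)
  qed
  finally have hi: "((\<lambda>t. h (cis t) * cis (- (real k * t))) has_integral 2 * pi * taylor_coeff k h) {0..2*pi}"
    by (simp add: taylor_coeff_def mult_ac)
  have "continuous_on {0..2*pi} (\<lambda>t. h (cis t) * cis (- (real k * t)))"
    by (intro continuous_intros continuous_on_compose2[OF holomorphic_on_imp_continuous_on[OF assms]]) auto
  then have "set_integrable lborel {0..2*pi} (\<lambda>t. h (cis t) * cis (- (real k * t)))"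
    by (intro borel_integrable_atLeastAtMost') 
  then show ?thesis
    using hi by (simp add: set_borel_integral_eq_integral integral_unique)
qed

text \<open>
Taylor coefficients in \<open>u\<close> depend holomorphically on \<open>z\<close>: near each \<open>z\<close> the Cauchy formula over a fixed small
circle represents them as a contour integral with parameter. Applied to \<open>g (u z)\<close> it shows that homogeneous
parts are entire, and applied to \<open>F (z, u W)\<close> that fibrewise homogeneous parts are holomorphic in the base.
\<close>

lemma taylor_coeff_slice_holomorphic:
  fixes H :: "complex ^ 'n \<Rightarrow> complex \<Rightarrow> complex"
  assumes O: "open O'" and cont: "continuous_on O' (\<lambda>(z, u). H z u)"
    and hol1: "\<And>u a b. (\<lambda>c. H (a + c *s b) u) holomorphic_on {c. (a + c *s b, u) \<in> O'}"
    and hol2: "\<And>z. H z holomorphic_on {u. (z, u) \<in> O'}"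
  shows "slice_holomorphic (\<lambda>z. taylor_coeff k (H z)) {z. (z, 0) \<in> O'}"
proof -
  have loc: "\<exists>B r. open B \<and> z \<in> B \<and> r > 0 \<and> B \<times> cball 0 r \<subseteq> O'" if z: "(z, 0) \<in> O'" for z
  proof -
    obtain A B where AB: "open A" "open B" "(z, 0) \<in> A \<times> B" "A \<times> B \<subseteq> O'"
      using open_prod_elim[OF O z] .
    then obtain r where "r > 0" "cball 0 r \<subseteq> B" by (metis SigmaE2 open_contains_cball)
    then show ?thesis using AB by blast
  qed
  have eq: "taylor_coeff k (H z) = contour_integral (circlepath 0 r) (\<lambda>u. H z u / u ^ Suc k) / (2 * pi * \<i>)"
    if "r > 0" "B \<times> cball 0 r \<subseteq> O'" "z \<in> B" for B r z
    by (rule taylor_coeff_circlepath) (use that in \<open>auto intro: holomorphic_on_subset[OF hol2]\<close>)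
  have cc: "continuous_on (B \<times> sphere 0 r) (\<lambda>(z, u). H z u / u ^ Suc k)"
    if "r > 0" "B \<times> cball 0 r \<subseteq> O'" for B r
  proof -
    have "continuous_on (B \<times> sphere 0 r) (\<lambda>(z, u). H z u)"
      by (rule continuous_on_subset[OF cont]) (use that in auto)
    then show ?thesis
      using that unfolding case_prod_beta by (intro continuous_intros) auto
  qed
  show ?thesis unfolding slice_holomorphic_def
  proof (intro conjI allI)
    have op: "open {z. (z, 0::complex) \<in> O'}"
      by (rule open_vimage[OF O, unfolded vimage_def]) (auto intro!: continuous_intros)
    show "continuous_on {z. (z, 0) \<in> O'} (\<lambda>z. taylor_coeff k (H z))"
    proof (subst continuous_on_eq_continuous_at[OF op], intro ballI)
      fix z assume "z \<in> {z. (z, 0::complex) \<in> O'}"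
      then obtain B r where Br: "open B" "z \<in> B" "r > 0" "B \<times> cball 0 r \<subseteq> O'"
        using loc[of z] by blast
      have "continuous_on B (\<lambda>z. contour_integral (circlepath 0 r) (\<lambda>u. H z u / u ^ Suc k) / (2 * pi * \<i>))"
        by (intro continuous_intros continuous_on_contour_integral_circlepath cc) (use Br in auto)
      then have "continuous_on B (\<lambda>z. taylor_coeff k (H z))"
        by (rule continuous_on_eq) (use eq[OF Br(3,4)] in auto)
      then show "isCont (\<lambda>z. taylor_coeff k (H z)) z"
        using Br(1,2) continuous_on_eq_continuous_at by blast
    qed
    fix a b :: "complex ^ 'n"
    show "(\<lambda>c. taylor_coeff k (H (a + c *s b))) holomorphic_on {c. a + c *s b \<in> {z. (z, 0) \<in> O'}}"
    proof (unfold holomorphic_on_def, intro ballI)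
      fix c0 assume "c0 \<in> {c. a + c *s b \<in> {z. (z, 0::complex) \<in> O'}}"
      then obtain B r where Br: "open B" "a + c0 *s b \<in> B" "r > 0" "B \<times> cball 0 r \<subseteq> O'"
        using loc[of "a + c0 *s b"] by blast
      define U where "U = {c. a + c *s b \<in> B}"
      have U: "open U" "c0 \<in> U"
        using open_line_preimage[OF Br(1)] Br(2) by (auto simp: U_def)
      have "(\<lambda>c. contour_integral (circlepath 0 r) (\<lambda>u. H (a + c *s b) u / u ^ Suc k)) holomorphic_on U"
      proof (rule holomorphic_contour_integral_circlepath)
        show "continuous_on (U \<times> sphere 0 r) (\<lambda>(c, u). H (a + c *s b) u / u ^ Suc k)"
          unfolding case_prod_beta
          by (rule continuous_on_compose2[OF cc[OF Br(3,4), unfolded case_prod_beta],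
                of "U \<times> sphere 0 r" "\<lambda>x. (a + fst x *s b, snd x)", simplified fst_conv snd_conv])
             (auto simp: U_def intro!: continuous_intros)
        show "(\<lambda>c. H (a + c *s b) u / u ^ Suc k) holomorphic_on U" if "u \<in> sphere 0 r" for u
          by (intro holomorphic_intros holomorphic_on_subset[OF hol1]) (use Br that in \<open>auto simp: U_def\<close>)
      qed (use Br U in auto)
      then have "(\<lambda>c. contour_integral (circlepath 0 r) (\<lambda>u. H (a + c *s b) u / u ^ Suc k) / (2 * pi * \<i>)) holomorphic_on U"
        by (intro holomorphic_intros) auto
      then have "(\<lambda>c. taylor_coeff k (H (a + c *s b))) holomorphic_on U"
        by (rule holomorphic_transform) (use eq[OF Br(3,4)] in \<open>auto simp: U_def\<close>)
      then have "(\<lambda>c. taylor_coeff k (H (a + c *s b))) field_differentiable at c0"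
        using U holomorphic_on_imp_differentiable_at by blast
      then show "(\<lambda>c. taylor_coeff k (H (a + c *s b))) field_differentiable at c0 within {c. a + c *s b \<in> {z. (z, 0) \<in> O'}}"
        by (rule field_differentiable_at_within)
    qed
  qed
qed

text \<open>
The derivatives are taken at the origin of the line, so homogeneous parts are meaningful on the whole space
even if \<open>g\<close> is holomorphic on a ball only.
\<close>

definition homogeneous_part :: "nat \<Rightarrow> (complex ^ 'n \<Rightarrow> complex) \<Rightarrow> complex ^ 'n \<Rightarrow> complex" where
  "homogeneous_part k g w = taylor_coeff k (\<lambda>c. g (c *s w))"

lemma slice_holomorphic_radial:
  assumes "slice_holomorphic g S"
  shows "(\<lambda>c. g (c *s w)) holomorphic_on {c. c *s w \<in> S}"
  using slice_holomorphicD[OF assms, of "{c. c *s w \<in> S}" 0 w] by simp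

lemma homogeneous_part_scale:
  assumes g: "slice_holomorphic g S" and S: "open S" "0 \<in> S"
  shows "homogeneous_part k g (u *s w) = u ^ k * homogeneous_part k g w"
proof -
  have "(deriv ^^ k) (\<lambda>c. (\<lambda>c. g (c *s w)) (u * c)) 0 = u ^ k * (deriv ^^ k) (\<lambda>c. g (c *s w)) (u * 0)"
  proof (rule higher_deriv_compose_linear[OF slice_holomorphic_radial[OF g],
        where S = "{c. c *s (u *s w) \<in> S}"])
    show "open {c. c *s w \<in> S}" using open_line_preimage[of S 0 w] S by simp
    show "open {c. c *s (u *s w) \<in> S}" using open_line_preimage[of S 0 "u *s w"] S by simp
    show "u * c \<in> {c. c *s w \<in> S}" if "c \<in> {c. c *s (u *s w) \<in> S}" for c
      using that by (simp add: mult.commute)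
  qed (use S in auto)
  then show ?thesis
    by (simp add: homogeneous_part_def taylor_coeff_def mult.commute)
qed

lemma slice_holomorphic_homogeneous_part:
  assumes g: "slice_holomorphic g S" and S: "open S" "0 \<in> S"
  shows "slice_holomorphic (homogeneous_part k g) UNIV"
proof -
  let ?O = "{(z, u). u *s z \<in> S}"
  have "open ?O"
    unfolding case_prod_beta
    by (rule open_vimage[OF S(1), unfolded vimage_def]) (auto intro!: continuous_intros)
  moreover have "continuous_on ?O (\<lambda>(z, u). g (u *s z))"
    using g unfolding slice_holomorphic_def case_prod_beta
    by (auto intro!: continuous_on_compose2[of S g] continuous_intros)
  moreover have "(\<lambda>c. g (u *s (a + c *s b))) holomorphic_on {c. (a + c *s b, u) \<in> ?O}" for u a b
  proof -
    have "(\<lambda>c. g (u *s a + c *s (u *s b))) holomorphic_on {c. (a + c *s b, u) \<in> ?O}"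
      by (rule slice_holomorphicD[OF g]) (auto simp: algebra_simps)
    then show ?thesis by (simp add: algebra_simps)
  qed
  moreover have "(\<lambda>u. g (u *s z)) holomorphic_on {u. (z, u) \<in> ?O}" for z
    using slice_holomorphic_radial[OF g] by simp
  ultimately have "slice_holomorphic (\<lambda>z. taylor_coeff k (\<lambda>u. g (u *s z))) {z. (z, 0) \<in> ?O}"
    by (rule taylor_coeff_slice_holomorphic)
  then show ?thesis using S by (simp add: homogeneous_part_def[abs_def])
qed

lemma homogeneous_part_sums:
  assumes g: "slice_holomorphic g (ball 0 R)" and w: "norm w < R"
  shows "(\<lambda>k. homogeneous_part k g w) sums g w"
proof -
  have "\<exists>r>1. r * norm w < R"
  proof (cases "w = 0")
    case True then show ?thesis using w by (intro exI[of _ 2]) auto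
  next
    case False
    then have "1 < R / norm w" using w by (simp add: field_simps)
    then obtain r where "1 < r" "r < R / norm w" using dense by blast
    then show ?thesis using False by (intro exI[of _ r]) (auto simp: field_simps)
  qed
  then obtain r where r: "r > 1" "r * norm w < R" by blast
  have "(\<lambda>c. g (c *s w)) holomorphic_on ball 0 r"
  proof (rule holomorphic_on_subset[OF slice_holomorphic_radial[OF g]], safe)
    fix c :: complex assume "c \<in> ball 0 r"
    then have "cmod c * norm w \<le> r * norm w" by (intro mult_right_mono) auto
    then show "c *s w \<in> ball 0 R" using r by simp
  qed
  from holomorphic_power_series[OF this, of 1] r
  show ?thesis by (simp add: homogeneous_part_def taylor_coeff_def)
qed

lemma homogeneous_part_average:
  assumes g: "slice_holomorphic g (ball 0 R)" and w: "norm w < R"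
  shows "(\<integral>\<theta>\<in>{0..2*pi}. g (cis \<theta> *s w) * cis (- (real k * \<theta>)) \<partial>lborel) = 2 * pi * homogeneous_part k g w"
  unfolding homogeneous_part_def
proof (rule taylor_coeff_average)
  have "c *s w \<in> ball 0 R" if "c \<in> cball 0 1" for c
  proof -
    have "cmod c * norm w \<le> 1 * norm w" using that by (intro mult_right_mono) auto
    then show ?thesis using w by simp
  qed
  then show "(\<lambda>c. g (c *s w)) holomorphic_on cball 0 1"
    by (intro holomorphic_on_subset[OF slice_holomorphic_radial[OF g]]) auto
qed

section \<open>Radial weights\<close>

lemma nonneg_has_integral_lborel:
  fixes f :: "real \<Rightarrow> real"
  assumes "(f has_integral I) S" "\<And>x. x \<in> S \<Longrightarrow> 0 \<le> f x"
    and [measurable]: "f \<in> borel_measurable borel" "S \<in> sets borel"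
  shows "set_integrable lborel S f" "(LINT x:S|lborel. f x) = I"
proof -
  have "f absolutely_integrable_on S"
    using assms(1,2) by (intro nonnegative_absolutely_integrable_1) auto
  then show *: "set_integrable lborel S f"
    unfolding set_integrable_def by (subst (asm) integrable_completion) auto
  show "(LINT x:S|lborel. f x) = I"
    using set_borel_integral_eq_integral(2)[OF *] assms(1) by (simp add: integral_unique)
qed

lemma ball_integral_homogeneous:
  fixes h :: "complex ^ 'n \<Rightarrow> 'b::{banach, second_countable_topology}"
  assumes [measurable]: "h \<in> borel_measurable borel"
    and hom: "\<And>r z. r > 0 \<Longrightarrow> h (r *\<^sub>R z) = r ^ (2 * k) *\<^sub>R h z"
    and int: "set_integrable lborel (ball 0 1) h" and r: "r > 0"
  shows "set_integrable lborel (ball 0 r) h"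
    and "(LINT z:ball 0 r|lborel. h z) = r ^ (2 * (CARD('n) + k)) *\<^sub>R (LINT z:ball 0 1|lborel. h z)"
proof -
  let ?f = "\<lambda>z. indicator (ball 0 r) z *\<^sub>R h z"
  have ind: "indicator (ball (0 :: complex ^ 'n) r) (r *\<^sub>R z) = (indicator (ball 0 1) z :: real)" for z
    using r by (auto simp: indicator_def)
  have f: "?f (r *\<^sub>R z) = r ^ (2 * k) *\<^sub>R (indicator (ball 0 1) z *\<^sub>R h z)" for z
    unfolding ind using hom[OF r] by simp
  have fm: "?f \<in> borel_measurable borel"
    by (intro borel_measurable_scaleR borel_measurable_indicator assms(1)) auto
  have "integrable lborel (\<lambda>z. ?f (r *\<^sub>R z))"
    unfolding f using int by (intro integrable_scaleR_right) (simp add: set_integrable_def)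
  then show "set_integrable lborel (ball 0 r) h"
    unfolding set_integrable_def by (rule iffD1[OF integral_lborel_scale(2)[OF fm r]])
  have "(LINT z:ball 0 r|lborel. h z) = r ^ DIM(complex ^ 'n) *\<^sub>R (\<integral>z. ?f (r *\<^sub>R z) \<partial>lborel)"
    unfolding set_lebesgue_integral_def by (rule integral_lborel_scale(1)[OF fm r])
  also have "(\<integral>z. ?f (r *\<^sub>R z) \<partial>lborel) = r ^ (2 * k) *\<^sub>R (LINT z:ball 0 1|lborel. h z)"
    unfolding f set_lebesgue_integral_def by (rule integral_scaleR_right)
  finally show "(LINT z:ball 0 r|lborel. h z) = r ^ (2 * (CARD('n) + k)) *\<^sub>R (LINT z:ball 0 1|lborel. h z)"
    by (simp add: power_add[symmetric] algebra_simps)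
qed

text \<open>
Layer cake: the weight at \<open>z\<close> is the integral of \<open>\<psi>\<close> over \<open>p > \<parallel>z\<parallel>\<^sup>2\<close>, so Fubini leaves integrals of
\<open>h\<close> over balls of radius \<open>sqrt p\<close>, which homogeneity reduces to the unit ball. All radial weights
therefore give multiples of one and the same integral, which permits passing from one to another.
\<close>

lemma radial_integral_homogeneous:
  fixes h :: "complex ^ 'n \<Rightarrow> complex"
  assumes h [measurable]: "h \<in> borel_measurable borel"
    and hom: "\<And>r z. r > 0 \<Longrightarrow> h (r *\<^sub>R z) = r ^ (2 * k) *\<^sub>R h z"
    and int: "set_integrable lborel (ball 0 1) h"
    and psi [measurable]: "\<psi> \<in> borel_measurable borel" and nonneg: "\<And>p. p > 0 \<Longrightarrow> \<psi> p \<ge> 0"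
    and psi_int: "set_integrable lborel {0<..} (\<lambda>p. \<psi> p * p ^ (CARD('n) + k))"
  shows "integrable lborel (\<lambda>z. (LINT p:{(norm z)\<^sup>2<..}|lborel. \<psi> p) *\<^sub>R h z)"
    and "(\<integral>z. (LINT p:{(norm z)\<^sup>2<..}|lborel. \<psi> p) *\<^sub>R h z \<partial>lborel)
       = (LINT p:{0<..}|lborel. \<psi> p * p ^ (CARD('n) + k)) *\<^sub>R (LINT z:ball 0 1|lborel. h z)"
proof -
  let ?W = "\<lambda>z :: complex ^ 'n. LINT p:{(norm z)\<^sup>2<..}|lborel. \<psi> p"
  let ?F = "\<lambda>p z. (indicator {(norm z)\<^sup>2<..} p * \<psi> p) *\<^sub>R h z"
  let ?I = "LINT z:ball 0 1|lborel. h z"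
  have ind: "indicator {(norm z)\<^sup>2<..} p = (if p > 0 then indicator (ball 0 (sqrt p)) z else (0::real))"
    for p and z :: "complex ^ 'n"
  proof (cases "p > 0")
    case True
    then have "(norm z)\<^sup>2 < p \<longleftrightarrow> norm z < sqrt p"
      by (metis norm_ge_zero real_less_rsqrt real_sqrt_less_iff real_sqrt_abs abs_norm_cancel)
    then show ?thesis using True by (simp add: indicator_def)
  next
    case False
    then have "\<not> (norm z)\<^sup>2 < p" using zero_le_power2[of "norm z"] by linarith
    then show ?thesis using False by (simp add: indicator_def)
  qed
  have sq: "sqrt p ^ (2 * N) = p ^ N" if "p > 0" for p N
    using that by (simp add: power_mult)
  have set: "set_integrable lborel (ball 0 (sqrt p)) h"
      "(LINT z:ball 0 (sqrt p)|lborel. h z) = p ^ (CARD('n) + k) *\<^sub>R ?I" if "p > 0" for p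
    using ball_integral_homogeneous[OF h hom int, of "sqrt p", unfolded sq[OF that]] that by simp_all
  have hom': "norm (h (r *\<^sub>R z)) = r ^ (2 * k) *\<^sub>R norm (h z)" if "r > 0" for r z
    using hom[OF that, of z] that by simp
  have set': "(LINT z:ball 0 (sqrt p)|lborel. norm (h z)) = p ^ (CARD('n) + k) *\<^sub>R (LINT z:ball 0 1|lborel. norm (h z))" if "p > 0" for p
    using ball_integral_homogeneous(2)[OF _ hom', of "sqrt p", unfolded sq[OF that]] that set_integrable_norm[OF int]
    by simp
  have F: "?F p z = (indicator {0<..} p * \<psi> p) *\<^sub>R (indicator (ball 0 (sqrt p)) z *\<^sub>R h z)" for p z
    by (simp add: ind)
  have intF: "(\<integral>z. ?F p z \<partial>lborel) = (indicator {0<..} p * \<psi> p * p ^ (CARD('n) + k)) *\<^sub>R ?I" for p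
  proof -
    have "(\<integral>z. ?F p z \<partial>lborel) = (indicator {0<..} p * \<psi> p) *\<^sub>R (LINT z:ball 0 (sqrt p)|lborel. h z)"
      unfolding F set_lebesgue_integral_def by (rule integral_scaleR_right)
    then show ?thesis using set(2)[of p] by (cases "p > 0") simp_all
  qed
  have nF: "norm (?F p z) = (indicator {0<..} p * \<psi> p) * (indicator (ball 0 (sqrt p)) z * norm (h z))" for p z
    unfolding F using nonneg[of p] by (cases "p > 0") (auto simp: indicator_def)
  have intnF: "(\<integral>z. norm (?F p z) \<partial>lborel)
      = (indicator {0<..} p * \<psi> p * p ^ (CARD('n) + k)) * (LINT z:ball 0 1|lborel. norm (h z))" for p
    unfolding nF using set'[of p] by (cases "p > 0") (simp_all add: set_lebesgue_integral_def)
  have meas: "(\<lambda>(p, z). ?F p z) \<in> borel_measurable (lborel \<Otimes>\<^sub>M lborel)"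
    unfolding case_prod_beta indicator_def mem_Collect_eq greaterThan_iff by measurable
  have int: "integrable (lborel \<Otimes>\<^sub>M lborel) (\<lambda>(p, z). ?F p z)"
  proof (rule lborel_pair.Fubini_integrable[OF meas])
    show "integrable lborel (\<lambda>p. \<integral>z. norm (case (p, z) of (p, z) \<Rightarrow> ?F p z) \<partial>lborel)"
      unfolding prod.case intnF
      by (intro integrable_mult_left) (use psi_int in \<open>simp add: set_integrable_def mult_ac\<close>)
    have "integrable lborel (\<lambda>z. ?F p z)" for p
      unfolding F using set(1)[of p]
      by (cases "p > 0") (auto simp: set_integrable_def simp del: scaleR_scaleR intro!: integrable_scaleR_right)
    then show "AE p in lborel. integrable lborel (\<lambda>z. case (p, z) of (p, z) \<Rightarrow> ?F p z)"
      by simp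
  qed
  have inner: "(\<integral>p. ?F p z \<partial>lborel) = ?W z *\<^sub>R h z" if "h z \<noteq> 0 \<longrightarrow> integrable lborel (\<lambda>p. ?F p z)" for z
  proof (cases "h z = 0")
    case False
    then have "integrable lborel (\<lambda>p. (?F p z) / h z)"
      using that by (intro integrable_divide) auto
    moreover have "(\<lambda>p. ?F p z / h z) = (\<lambda>p. complex_of_real (indicator {(norm z)\<^sup>2<..} p * \<psi> p))"
      using False by (intro ext) (simp only: scaleR_conv_of_real nonzero_mult_div_cancel_right not_False_eq_True)
    ultimately have "integrable lborel (\<lambda>p. complex_of_real (indicator {(norm z)\<^sup>2<..} p * \<psi> p))"
      by (simp only:)
    then have "integrable lborel (\<lambda>p. indicator {(norm z)\<^sup>2<..} p * \<psi> p)"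
      by (simp only: complex_of_real_integrable_eq)
    then show ?thesis
      unfolding set_lebesgue_integral_def by (subst integral_scaleR_left) auto
  qed simp
  have AE: "AE z in lborel. (\<integral>p. ?F p z \<partial>lborel) = ?W z *\<^sub>R h z"
    using lborel_pair.AE_integrable_snd[OF int] by eventually_elim (use inner in auto)
  have [measurable]: "(\<lambda>z :: complex ^ 'n. LINT p:{(norm z)\<^sup>2<..}|lborel. \<psi> p) \<in> borel_measurable lborel"
    unfolding set_lebesgue_integral_def indicator_def greaterThan_iff by measurable
  show "integrable lborel (\<lambda>z. ?W z *\<^sub>R h z)"
  proof (rule integrable_cong_AE_imp[OF lborel_pair.integrable_snd[OF int]])
    show "AE z in lborel. (\<integral>p. ?F p z \<partial>lborel) = ?W z *\<^sub>R h z"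
      by (rule AE)
  qed measurable
  have "(\<integral>z. ?W z *\<^sub>R h z \<partial>lborel) = (\<integral>z. (\<integral>p. ?F p z \<partial>lborel) \<partial>lborel)"
  proof (rule integral_cong_AE)
    show "AE z in lborel. ?W z *\<^sub>R h z = (\<integral>p. ?F p z \<partial>lborel)"
      using AE by (rule eventually_mono) simp
    show "(\<lambda>z. \<integral>p. ?F p z \<partial>lborel) \<in> borel_measurable lborel"
      by (rule borel_measurable_integrable[OF lborel_pair.integrable_snd[OF int]])
  qed measurable
  also have "\<dots> = (\<integral>p. (\<integral>z. ?F p z \<partial>lborel) \<partial>lborel)"
    by (rule lborel_pair.Fubini_integral[OF int])
  also have "\<dots> = (LINT p:{0<..}|lborel. \<psi> p * p ^ (CARD('n) + k)) *\<^sub>R ?I"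
  proof -
    have "integrable lborel (\<lambda>p. indicator {0<..} p * \<psi> p * p ^ (CARD('n) + k))"
      using psi_int by (simp add: set_integrable_def mult_ac)
    then show ?thesis unfolding intF by (simp add: set_lebesgue_integral_def mult_ac)
  qed
  finally show "(\<integral>z. ?W z *\<^sub>R h z \<partial>lborel)
       = (LINT p:{0<..}|lborel. \<psi> p * p ^ (CARD('n) + k)) *\<^sub>R ?I" .
qed

lemma set_integrable_ball_bounded:
  fixes h :: "complex ^ 'n \<Rightarrow> complex"
  assumes "continuous_on UNIV h"
  shows "set_integrable lborel (ball 0 r) h"
proof (rule set_integrable_subset)
  show "set_integrable lborel (cball 0 r) h"
    unfolding set_integrable_def
    by (rule borel_integrable_compact) (auto intro: continuous_on_subset[OF assms])
qed auto

lemma exp_tail: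
  "(LINT p:{t<..}|lborel. exp (-p)) = exp (- t :: real)"
proof -
  have "(LINT p:{t..}|lborel. exp (-p)) = exp (-t)"
    using has_integral_exp_minus_to_infinity[of 1 t] by (intro nonneg_has_integral_lborel) auto
  also have "(LINT p:{t..}|lborel. exp (-p)) = (LINT p:{t<..}|lborel. exp (-p))"
    unfolding set_lebesgue_integral_def
    by (intro integral_cong_AE) (auto intro!: AE_I[where N="{t}"] simp: indicator_def split: if_splits)
  finally show ?thesis .
qed

lemma exp_moment:
  shows "set_integrable lborel {0<..} (\<lambda>p :: real. exp (-p) * p ^ N)"
    and "(LINT p:{0<..}|lborel. exp (-p) * p ^ N) = (fact N :: real)"
proof -
  have "((\<lambda>t. t powr (real (N + 1) - 1) / exp t) has_integral Gamma (real (N + 1))) {0..}"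
    by (rule Gamma_integral_real) auto
  moreover have "Gamma (real (N + 1)) = fact N"
    using Gamma_fact[of N, where 'a = real] by (simp add: add.commute)
  moreover have "{0..} - {0<..} = {0::real}" "{0<..} - {0..} = ({} :: real set)"
    by auto
  then have "negligible {x \<in> {0..} - {0<..}. t x \<noteq> 0}" "negligible {x \<in> {0<..} - {0..}. t x \<noteq> 0}" for t :: "real \<Rightarrow> real"
    by (auto intro: negligible_subset[of "{0::real}"])
  then have "((\<lambda>t. t powr (real (N + 1) - 1) / exp t) has_integral i) {0..} \<longleftrightarrow>
      ((\<lambda>t. t powr (real (N + 1) - 1) / exp t) has_integral i) {0<..}" for i :: real
    by (rule has_integral_spike_set_eq)
  ultimately have "((\<lambda>t. t powr (real (N + 1) - 1) / exp t) has_integral fact N) {0<..}"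
    by simp
  then have "((\<lambda>t. exp (-t) * t ^ N) has_integral (fact N :: real)) {0<..}"
    by (rule has_integral_eq[rotated]) (simp add: powr_realpow exp_minus field_simps)
  then show "set_integrable lborel {0<..} (\<lambda>p :: real. exp (-p) * p ^ N)"
    "(LINT p:{0<..}|lborel. exp (-p) * p ^ N) = (fact N :: real)"
    by (auto intro!: nonneg_has_integral_lborel)
qed

lemma gaussian_integral_homogeneous:
  fixes h :: "complex ^ 'n \<Rightarrow> complex"
  assumes h: "continuous_on UNIV h"
    and hom: "\<And>r z. r > 0 \<Longrightarrow> h (r *\<^sub>R z) = r ^ (2 * k) *\<^sub>R h z"
  shows "integrable lborel (\<lambda>z. exp (- (norm z)\<^sup>2) *\<^sub>R h z)"
    and "(\<integral>z. exp (- (norm z)\<^sup>2) *\<^sub>R h z \<partial>lborel) = fact (CARD('n) + k) *\<^sub>R (LINT z:ball 0 1|lborel. h z)"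
  using radial_integral_homogeneous[OF borel_measurable_continuous_onI[OF h] hom set_integrable_ball_bounded[OF h],
     of "\<lambda>p. exp (-p)"] exp_moment[of "CARD('n) + k"]
  by (simp_all add: exp_tail)

lemma weighted_tail:
  assumes s: "s > 0" and t: "t \<ge> 0"
  shows "(LINT p:{t<..}|lborel. indicator {..<1} p * (s * (1 - p) powr (s - 1)))
       = (if t < 1 then (1 - t) powr s else (0::real))"
proof (cases "t < 1")
  case True
  have "continuous_on {t..1} (\<lambda>p. - ((1 - p) powr s))"
    using s by (intro continuous_on_minus continuous_on_powr' continuous_intros) auto
  then have "((\<lambda>p. s * (1 - p) powr (s - 1)) has_integral (- ((1 - 1) powr s) - (- ((1 - t) powr s)))) {t..1}"
    using True s
    by (intro fundamental_theorem_of_calculus_interior)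
       (auto intro!: derivative_eq_intros
          simp: has_real_derivative_iff_has_vector_derivative[symmetric])
  then have "((\<lambda>p. s * (1 - p) powr (s - 1)) has_integral (1 - t) powr s) {t..1}"
    by simp
  then have "(LINT p:{t..1}|lborel. s * (1 - p) powr (s - 1)) = (1 - t) powr s"
    using s by (intro nonneg_has_integral_lborel) auto
  also have "(LINT p:{t..1}|lborel. s * (1 - p) powr (s - 1))
     = (LINT p:{t<..}|lborel. indicator {..<1} p * (s * (1 - p) powr (s - 1)))"
    unfolding set_lebesgue_integral_def
    by (intro integral_cong_AE) (auto intro!: AE_I[where N="{t,1}"] emeasure_lborel_countable simp: indicator_def split: if_splits)
  finally show ?thesis using True by simp
next
  case False
  then have "indicator {t<..} p *\<^sub>R (indicator {..<1} p * (s * (1 - p) powr (s - 1))) = 0" for p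
    by (auto simp: indicator_def)
  then show ?thesis using False by (simp only: set_lebesgue_integral_def) simp
qed

lemma weighted_moment:
  fixes s :: real
  assumes s: "s > 0"
  shows "set_integrable lborel {0<..} (\<lambda>p. indicator {..<1} p * (s * (1 - p) powr (s - 1)) * p ^ N)"
    and "(LINT p:{0<..}|lborel. indicator {..<1} p * (s * (1 - p) powr (s - 1)) * p ^ N)
      = fact N / pochhammer (s + 1) N"
proof -
  let ?h = "\<lambda>p. indicator {..<1} p * (s * (1 - p) powr (s - 1)) * p ^ N"
  let ?B = "Beta (real (N + 1)) s"
  have "((\<lambda>t. t powr (real (N + 1) - 1) * (1 - t) powr (s - 1)) has_integral ?B) {0..1}"
    by (rule has_integral_Beta_real) (use s in auto)
  then have "((\<lambda>t. s * (t powr (real (N + 1) - 1) * (1 - t) powr (s - 1))) has_integral s * ?B) {0..1}"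
    by (rule has_integral_mult_right)
  then have "((\<lambda>t. s * (t powr (real (N + 1) - 1) * (1 - t) powr (s - 1))) has_integral s * ?B) {0<..<1}"
    by (simp only: has_integral_Icc_iff_Ioo)
  then have hi: "(?h has_integral s * ?B) {0<..<1}"
    by (rule has_integral_eq[rotated]) (auto simp: powr_realpow)
  have "s * ?B = s * (fact N * Gamma s / Gamma (s + real (Suc N)))"
    using Gamma_fact[of N, where 'a = real] by (simp add: Beta_def add.commute add.left_commute)
  also have "\<dots> = fact N / pochhammer (s + 1) N"
  proof -
    have "pochhammer s (Suc N) = Gamma (s + real (Suc N)) / Gamma s"
      using s by (intro pochhammer_Gamma) (auto simp: nonpos_Ints_def)
    moreover have "pochhammer s (Suc N) = s * pochhammer (s + 1) N"
      by (simp add: pochhammer_rec)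
    moreover have "Gamma s > 0" "Gamma (s + real (Suc N)) > 0" "pochhammer (s + 1) N > 0"
      using s by (auto intro!: Gamma_real_pos pochhammer_pos)
    ultimately show ?thesis by (simp add: field_simps)
  qed
  finally have val: "s * ?B = fact N / pochhammer (s + 1) N" .
  have *: "set_integrable lborel {0<..<1} ?h"
     "(LINT p:{0<..<1}|lborel. ?h p) = fact N / pochhammer (s + 1) N"
    using hi unfolding val by (rule nonneg_has_integral_lborel; use s in auto)+
  have eq: "indicator {0<..<1} p *\<^sub>R ?h p
     = indicator {0<..} p *\<^sub>R ?h p" for p :: real
    by (auto simp: indicator_def)
  show "set_integrable lborel {0<..} ?h"
    "(LINT p:{0<..}|lborel. ?h p)
      = fact N / pochhammer (s + 1) N"
    using * unfolding set_integrable_def set_lebesgue_integral_def eq by auto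
qed

lemma weighted_integral_homogeneous:
  fixes h :: "complex ^ 'n \<Rightarrow> complex"
  assumes h: "continuous_on UNIV h" and s: "s > 0"
    and hom: "\<And>r z. r > 0 \<Longrightarrow> h (r *\<^sub>R z) = r ^ (2 * k) *\<^sub>R h z"
  shows "(LINT z:ball 0 1|lborel. (1 - (norm z)\<^sup>2) powr s *\<^sub>R h z)
       = (fact (CARD('n) + k) / pochhammer (s + 1) (CARD('n) + k)) *\<^sub>R (LINT z:ball 0 1|lborel. h z)"
proof -
  let ?psi = "\<lambda>p. indicator {..<1} p * (s * (1 - p) powr (s - 1)) :: real"
  have "(\<integral>z. (LINT p:{(norm z)\<^sup>2<..}|lborel. ?psi p) *\<^sub>R h z \<partial>lborel)
       = (fact (CARD('n) + k) / pochhammer (s + 1) (CARD('n) + k)) *\<^sub>R (LINT z:ball 0 1|lborel. h z)"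
    using radial_integral_homogeneous(2)[OF borel_measurable_continuous_onI[OF h] hom set_integrable_ball_bounded[OF h],
      of ?psi] weighted_moment[OF s, of "CARD('n) + k"] s by simp
  moreover have eq: "(LINT p:{(norm z)\<^sup>2<..}|lborel. ?psi p) *\<^sub>R h z
      = indicator (ball 0 1) z *\<^sub>R (1 - (norm z)\<^sup>2) powr s *\<^sub>R h z" for z
    using s by (subst weighted_tail) (auto simp: indicator_def abs_square_less_1 power_less_one_iff)
  ultimately show ?thesis
    unfolding eq by (simp only: set_lebesgue_integral_def)
qed

section \<open>The Gaussian reproducing formula\<close>

lemma higher_deriv_exp_linear: "(deriv ^^ k) (\<lambda>c :: complex. exp (c * b)) = (\<lambda>c. b ^ k * exp (c * b))"
proof (induction k)
  case (Suc k)
  have "deriv (\<lambda>c. b ^ k * exp (c * b)) = (\<lambda>c. b ^ Suc k * exp (c * b))"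
    by (intro ext DERIV_imp_deriv) (auto intro!: derivative_eq_intros)
  then show ?case by (simp add: Suc)
qed simp

text \<open>
Only the term of degree \<open>k\<close> of the exponential series survives: Cauchy's formula after conjugation.
\<close>

lemma exp_average:
  fixes a :: complex
  shows "(\<integral>\<theta>\<in>{0..2*pi}. cis (real k * \<theta>) * exp (cis (- \<theta>) * a) \<partial>lborel) = 2 * pi * (a ^ k / fact k)"
proof -
  have "(\<integral>\<theta>\<in>{0..2*pi}. cnj (exp (cis \<theta> * cnj a) * cis (- (real k * \<theta>))) \<partial>lborel)
      = cnj (\<integral>\<theta>\<in>{0..2*pi}. exp (cis \<theta> * cnj a) * cis (- (real k * \<theta>)) \<partial>lborel)"
    unfolding set_lebesgue_integral_def Bochner_Integration.integral_cnj[symmetric]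
    by (simp only: complex_cnj_scaleR)
  also have "(\<integral>\<theta>\<in>{0..2*pi}. exp (cis \<theta> * cnj a) * cis (- (real k * \<theta>)) \<partial>lborel)
      = 2 * pi * taylor_coeff k (\<lambda>c. exp (c * cnj a))"
    by (rule taylor_coeff_average) (intro holomorphic_intros)
  finally show ?thesis
    by (simp add: taylor_coeff_def higher_deriv_exp_linear exp_cnj cis_cnj mult.commute)
qed

definition gauss_mass :: "'n::finite itself \<Rightarrow> real" where
  "gauss_mass _ = (\<integral>z. exp (- (norm (z :: complex ^ 'n))\<^sup>2) \<partial>lborel)"

lemma integrable_gaussian: "integrable lborel (\<lambda>z :: complex ^ 'n. exp (- (norm z)\<^sup>2))"
proof -
  have "integrable lborel (\<lambda>z :: complex ^ 'n. Re (exp (- (norm z)\<^sup>2) *\<^sub>R 1))"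
    using gaussian_integral_homogeneous(1)[of "\<lambda>z :: complex ^ 'n. 1" 0] by (intro integrable_Re) simp
  then show ?thesis by simp
qed

lemma gauss_mass_pos: "gauss_mass TYPE('n::finite) > 0"
proof -
  have "complex_of_real (gauss_mass TYPE('n)) = (\<integral>z. exp (- (norm (z :: complex ^ 'n))\<^sup>2) *\<^sub>R 1 \<partial>lborel)"
    unfolding gauss_mass_def by (simp add: scaleR_conv_of_real)
  also have "\<dots> = (fact (CARD('n) + 0) :: real) *\<^sub>R (LINT z:ball (0 :: complex ^ 'n) 1|lborel. 1)"
    by (rule gaussian_integral_homogeneous) auto
  also have "(LINT z:ball (0 :: complex ^ 'n) 1|lborel. 1) = complex_of_real (measure lborel (ball (0 :: complex ^ 'n) 1))"
    by (simp add: set_lebesgue_integral_def scaleR_conv_of_real)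
  also have "measure lborel (ball (0 :: complex ^ 'n) 1) = unit_ball_vol (DIM(complex ^ 'n))"
    using content_ball[of 1 "0 :: complex ^ 'n"] by simp
  finally have "complex_of_real (gauss_mass TYPE('n)) = complex_of_real (fact (CARD('n)) * unit_ball_vol (DIM(complex ^ 'n)))"
    by (simp add: scaleR_conv_of_real)
  then have "gauss_mass TYPE('n) = fact (CARD('n)) * unit_ball_vol (DIM(complex ^ 'n))"
    by (simp only: of_real_eq_iff)
  then show ?thesis by simp
qed

text \<open>
A homogeneous \<open>p\<close> grows like \<open>\<parallel>z\<parallel>\<^sup>k\<close>, and \<open>\<parallel>z\<parallel>\<^sup>k exp (\<parallel>w\<parallel> \<parallel>z\<parallel>)\<close> costs at most a
constant times \<open>exp (\<parallel>z\<parallel>\<^sup>2 / 2)\<close>.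
\<close>

lemma integrable_gaussian_exp:
  fixes p :: "complex ^ 'n \<Rightarrow> complex"
  assumes p: "continuous_on UNIV p" and hom: "\<And>u z. p (u *s z) = u ^ k * p z"
  shows "integrable lborel (\<lambda>z. exp (- (norm z)\<^sup>2) *\<^sub>R (p z * exp (herm w z)))"
proof -
  obtain C where C: "C \<ge> 0" "\<And>z. cmod (p z) \<le> C * norm z ^ k"
  proof -
    have "bounded (p ` sphere 0 1)"
      by (intro compact_imp_bounded compact_continuous_image continuous_on_subset[OF p]) auto
    then obtain C where C: "\<And>z. norm z = 1 \<Longrightarrow> cmod (p z) \<le> C" "C > 0"
      by (force simp: bounded_pos)
    have "cmod (p z) \<le> C * norm z ^ k" if "z \<noteq> 0" for z
    proof -
      have "p z = p (of_real (norm z) *s (of_real (inverse (norm z)) *s z))"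
        using that by (simp add: vec_eq_iff)
      also have "cmod \<dots> = norm z ^ k * cmod (p (of_real (inverse (norm z)) *s z))"
        unfolding hom by (simp add: norm_mult norm_power)
      also have "\<dots> \<le> norm z ^ k * C"
        using that by (intro mult_left_mono C) (auto simp: norm_inverse)
      finally show ?thesis by (simp add: mult.commute)
    qed
    moreover have "cmod (p 0) \<le> C * norm (0 :: complex ^ 'n) ^ k"
    proof (cases "k = 0")
      case True
      obtain e :: "complex ^ 'n" where e: "norm e = 1"
        using vector_choose_size[of 1] by auto
      have "p 0 = p (0 *s e)" by simp
      also have "\<dots> = p e"
        unfolding hom using True by simp
      finally show ?thesis using C(1)[of e] e True by simp
    next
      case False
      have "p 0 = p (0 *s 0)" by simp
      also have "\<dots> = 0" unfolding hom using False by simp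
      finally show ?thesis using C by simp
    qed
    ultimately show ?thesis using that[of C] C(2) by (metis less_imp_le)
  qed
  define a where "a = norm w"
  define M where "M = C * (fact k * exp ((a + 1)\<^sup>2 / 2))"
  have "integrable lborel (\<lambda>z :: complex ^ 'n. exp (- (norm ((1 / sqrt 2) *\<^sub>R z))\<^sup>2))"
    by (subst integral_lborel_scale(2)) (auto intro: integrable_gaussian)
  then have half: "integrable lborel (\<lambda>z :: complex ^ 'n. M * exp (- ((norm z)\<^sup>2 / 2)))"
    by (intro integrable_mult_right) (simp add: power_divide)
  show ?thesis
  proof (rule Bochner_Integration.integrable_bound[OF half])
    show "(\<lambda>z. exp (- (norm z)\<^sup>2) *\<^sub>R (p z * exp (herm w z))) \<in> borel_measurable lborel"
      using borel_measurable_continuous_onI[OF p] by measurable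
    have "norm (exp (- (norm z)\<^sup>2) *\<^sub>R (p z * exp (herm w z))) \<le> norm (M * exp (- ((norm z)\<^sup>2 / 2)))" for z
    proof -
      define x where "x = norm z"
      have x: "x \<ge> 0" by (simp add: x_def)
      have 1: "cmod (exp (herm w z)) \<le> exp (a * x)"
      proof -
        have "Re (herm w z) \<le> a * x"
          unfolding a_def x_def by (rule order_trans[OF complex_Re_le_cmod norm_herm_le])
        then show ?thesis by simp
      qed
      have 2: "x ^ k \<le> fact k * exp x"
      proof -
        have "x ^ k /\<^sub>R fact k \<le> (\<Sum>n. x ^ n /\<^sub>R fact n)"
          using sum_le_suminf[OF summable_exp_generic[of x], of "{k}"] x by simp
        then show ?thesis by (simp add: exp_def field_simps)
      qed
      have 3: "exp (- x\<^sup>2) * exp x * exp (a * x) \<le> exp ((a + 1)\<^sup>2 / 2) * exp (- (x\<^sup>2 / 2))"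
      proof -
        have "0 \<le> (x - (a + 1))\<^sup>2" by simp
        then have "- x\<^sup>2 + x + a * x \<le> (a + 1)\<^sup>2 / 2 + - (x\<^sup>2 / 2)"
          by (simp add: power2_eq_square algebra_simps)
        then show ?thesis by (simp add: exp_add[symmetric])
      qed
      have "norm (exp (- (norm z)\<^sup>2) *\<^sub>R (p z * exp (herm w z))) \<le> exp (- x\<^sup>2) * ((C * x ^ k) * exp (a * x))"
        using C(2)[of z] 1 unfolding norm_scaleR norm_mult x_def[symmetric]
        by (intro mult_mono) (auto intro: order_trans[OF norm_ge_zero])
      also have "\<dots> \<le> exp (- x\<^sup>2) * ((C * (fact k * exp x)) * exp (a * x))"
        using 2 C(1) by (intro mult_left_mono mult_right_mono) auto
      also have "\<dots> = (C * fact k) * (exp (- x\<^sup>2) * exp x * exp (a * x))"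
        by simp
      also have "\<dots> \<le> (C * fact k) * (exp ((a + 1)\<^sup>2 / 2) * exp (- (x\<^sup>2 / 2)))"
        using 3 C(1) by (intro mult_left_mono) auto
      also have "\<dots> = norm (M * exp (- ((norm z)\<^sup>2 / 2)))"
        using C(1) by (simp add: M_def x_def abs_mult)
      finally show ?thesis .
    qed
    then show "AE z in lborel. norm (exp (- (norm z)\<^sup>2) *\<^sub>R (p z * exp (herm w z)))
        \<le> norm (M * exp (- ((norm z)\<^sup>2 / 2)))" by simp
  qed
qed

text \<open>
The integral of \<open>exp (- \<parallel>z\<parallel>\<^sup>2) p(z) exp \<langle>w, z\<rangle>\<close> is evaluated twice. Translation by \<open>w\<close> turns the integrand into
\<open>exp (- \<parallel>z\<parallel>\<^sup>2)\<close> times \<open>p(w + z) exp (- \<langle>z, w\<rangle>)\<close>, holomorphic in \<open>z\<close>, whose circle averages are \<open>p(w)\<close>.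
Averaging over circles without translation keeps only the term of degree \<open>k\<close> of the exponential.
\<close>

lemma fock_reproducing:
  fixes p :: "complex ^ 'n \<Rightarrow> complex"
  assumes p: "slice_holomorphic p UNIV" and hom: "\<And>u z. p (u *s z) = u ^ k * p z"
  shows "(\<integral>z. exp (- (norm z)\<^sup>2) *\<^sub>R (p z * herm w z ^ k) \<partial>lborel) = fact k * gauss_mass TYPE('n) * p w"
proof -
  have cont: "continuous_on UNIV p" using p by (simp add: slice_holomorphic_def)
  let ?q = "\<lambda>z. exp (- (norm z)\<^sup>2) *\<^sub>R (p z * exp (herm w z))"
  let ?g = "\<lambda>z :: complex ^ 'n. exp (- (norm z)\<^sup>2)"
  have int: "integrable lborel ?q"
    by (rule integrable_gaussian_exp[OF cont hom])
  then have [measurable]: "?q \<in> borel_measurable borel" by auto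
  have shift: "?q (w + z) = ?g z *\<^sub>R (p (w + z) * exp (- herm z w))" for z
  proof -
    have "complex_of_real (exp (- (norm (w + z))\<^sup>2)) = exp (- complex_of_real ((norm (w + z))\<^sup>2))"
      by (simp flip: exp_of_real)
    then have "?q (w + z) = exp (- complex_of_real ((norm (w + z))\<^sup>2)) * p (w + z) * exp (herm w (w + z))"
      by (simp add: scaleR_conv_of_real)
    also have "\<dots> = exp (- complex_of_real ((norm (w + z))\<^sup>2) + herm w (w + z)) * p (w + z)"
      by (simp only: exp_add mult_ac)
    \<comment> \<open>completing the square: the antiholomorphic terms cancel\<close>
    also have "- complex_of_real ((norm (w + z))\<^sup>2) + herm w (w + z) = - complex_of_real ((norm z)\<^sup>2) - herm z w"
      unfolding norm_add_sq_herm by (simp add: herm_self)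
    also have "exp (- complex_of_real ((norm z)\<^sup>2) - herm z w) * p (w + z)
        = ?g z *\<^sub>R (p (w + z) * exp (- herm z w))"
      by (simp add: scaleR_conv_of_real exp_diff exp_minus field_simps flip: exp_of_real)
    finally show ?thesis .
  qed
  have "(\<integral>z. ?q z \<partial>lborel) = (\<integral>z. ?q (w + z) \<partial>lborel)"
    by (rule integral_lborel_translate(1)[symmetric]) measurable
  then have "2 * pi * (\<integral>z. ?q z \<partial>lborel) = 2 * pi * (\<integral>z. ?q (w + z) \<partial>lborel)"
    by simp
  also have "\<dots> = (\<integral>z. (\<integral>\<theta>\<in>{0..2*pi}. ?q (w + cis \<theta> *s z) \<partial>lborel) \<partial>lborel)"
    by (rule integral_circle_average[symmetric]) (subst integral_lborel_translate(2); use int in auto)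
  also have "\<dots> = (\<integral>z. ?g z *\<^sub>R (2 * pi * p w) \<partial>lborel)"
  proof (rule Bochner_Integration.integral_cong[OF refl])
    fix z
    let ?h = "\<lambda>c. p (w + c *s z) * exp (- (c * herm z w))"
    have "?h holomorphic_on cball 0 1"
      by (intro holomorphic_intros slice_holomorphicD[OF p]) auto
    from taylor_coeff_average[OF this, of 0]
    have "(\<integral>\<theta>\<in>{0..2*pi}. ?h (cis \<theta>) \<partial>lborel) = 2 * pi * p w"
      by (simp add: taylor_coeff_def)
    moreover have "(\<integral>\<theta>\<in>{0..2*pi}. ?q (w + cis \<theta> *s z) \<partial>lborel)
        = ?g z *\<^sub>R (\<integral>\<theta>\<in>{0..2*pi}. ?h (cis \<theta>) \<partial>lborel)"
      unfolding shift by simp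
    ultimately show "(\<integral>\<theta>\<in>{0..2*pi}. ?q (w + cis \<theta> *s z) \<partial>lborel) = ?g z *\<^sub>R (2 * pi * p w)"
      by simp
  qed
  also have "\<dots> = 2 * pi * (gauss_mass TYPE('n) * p w)"
    using integrable_gaussian[where 'n='n] by (simp add: gauss_mass_def scaleR_conv_of_real)
  finally have 1: "(\<integral>z. ?q z \<partial>lborel) = gauss_mass TYPE('n) * p w" by simp
  have "2 * pi * (\<integral>z. ?q z \<partial>lborel) = (\<integral>z. (\<integral>\<theta>\<in>{0..2*pi}. ?q (cis \<theta> *s z) \<partial>lborel) \<partial>lborel)"
    by (rule integral_circle_average[OF int, symmetric])
  also have "\<dots> = (\<integral>z. (2 * pi / fact k) *  (?g z *\<^sub>R (p z * herm w z ^ k)) \<partial>lborel)"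
  proof (rule Bochner_Integration.integral_cong[OF refl])
    fix z
    have "?q (cis \<theta> *s z) = ?g z *\<^sub>R (p z * (cis (real k * \<theta>) * exp (cis (- \<theta>) * herm w z)))" for \<theta>
      by (simp add: hom Complex.DeMoivre cis_cnj)
    then have "(\<integral>\<theta>\<in>{0..2*pi}. ?q (cis \<theta> *s z) \<partial>lborel)
        = ?g z *\<^sub>R (p z * (\<integral>\<theta>\<in>{0..2*pi}. cis (real k * \<theta>) * exp (cis (- \<theta>) * herm w z) \<partial>lborel))"
      by simp
    then show "(\<integral>\<theta>\<in>{0..2*pi}. ?q (cis \<theta> *s z) \<partial>lborel) = (2 * pi / fact k) *  (?g z *\<^sub>R (p z * herm w z ^ k))"
      unfolding exp_average by (simp add: scaleR_conv_of_real)
  qed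
  also have "\<dots> = (2 * pi / fact k) * (\<integral>z. ?g z *\<^sub>R (p z * herm w z ^ k) \<partial>lborel)"
    by (rule integral_mult_right_zero)
  finally show ?thesis unfolding 1 by (simp add: field_simps)
qed

section \<open>Reproducing formulas on balls\<close>

lemma homogeneous_times_herm:
  fixes p :: "complex ^ 'n \<Rightarrow> complex"
  assumes p: "slice_holomorphic p UNIV" and hom: "\<And>u z. p (u *s z) = u ^ k * p z"
  shows "continuous_on UNIV (\<lambda>z. p z * herm w z ^ k)"
    and "p (r *\<^sub>R z) * herm w (r *\<^sub>R z) ^ k = r ^ (2 * k) *\<^sub>R (p z * herm w z ^ k)"
  using p by (auto simp: slice_holomorphic_def scaleR_eq_cmult_vec hom scaleR_conv_of_real
      power_mult_distrib mult_2 power_add intro!: continuous_intros)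

lemma homogeneous_ball_reproducing:
  fixes p :: "complex ^ 'n \<Rightarrow> complex"
  assumes p: "slice_holomorphic p UNIV" and hom: "\<And>u z. p (u *s z) = u ^ k * p z"
  shows "(LINT z:ball 0 1|lborel. p z * herm w z ^ k)
      = fact k / fact (CARD('n) + k) * gauss_mass TYPE('n) * p w"
proof -
  note cont = homogeneous_times_herm(1)[OF p hom] and h = homogeneous_times_herm(2)[OF p hom]
  show ?thesis
    using gaussian_integral_homogeneous(2)[OF cont h] fock_reproducing[OF p hom]
    by (simp add: scaleR_conv_of_real field_simps)
qed

text \<open>
On circles \<open>\<langle>w, z\<rangle>\<^sup>k\<close> has frequency \<open>-k\<close>, so only the part of \<open>g\<close> of degree \<open>k\<close> contributes.
\<close>

lemma integral_homogeneous_part: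
  fixes g :: "complex ^ 'n \<Rightarrow> complex" and \<rho> :: "complex ^ 'n \<Rightarrow> real"
  assumes g: "slice_holomorphic g (ball 0 R)"
    and rho [measurable]: "\<rho> \<in> borel_measurable borel" and radial: "\<And>\<theta> z. \<rho> (cis \<theta> *s z) = \<rho> z"
    and int: "set_integrable lborel (ball 0 R) (\<lambda>z. \<rho> z *\<^sub>R g z)"
  shows "(LINT z:ball 0 R|lborel. \<rho> z *\<^sub>R (g z * herm w z ^ k))
       = (LINT z:ball 0 R|lborel. \<rho> z *\<^sub>R (homogeneous_part k g z * herm w z ^ k))"
proof -
  let ?p = "\<lambda>z. indicator (ball 0 R) z *\<^sub>R (\<rho> z *\<^sub>R (homogeneous_part k g z * herm w z ^ k))"
  let ?c = "(norm w * \<bar>R\<bar>) ^ k"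
  let ?f = "\<lambda>z. indicator (ball 0 R) z *\<^sub>R (\<rho> z *\<^sub>R g z)"
  let ?q = "\<lambda>z. indicator (ball 0 R) z *\<^sub>R (\<rho> z *\<^sub>R (g z * herm w z ^ k))"
  have intq: "integrable lborel ?q"
  proof (rule Bochner_Integration.integrable_bound)
    show "integrable lborel (\<lambda>z. ?c *\<^sub>R (?f z))"
      using int by (intro integrable_scaleR_right) (simp add: set_integrable_def)
    have "(\<lambda>z. (?f z) * herm w z ^ k) \<in> borel_measurable lborel"
      using int by (intro borel_measurable_times) (auto simp: set_integrable_def)
    then show "?q \<in> borel_measurable lborel" by simp
    have "norm (?q z) \<le> norm (?c *\<^sub>R (?f z))" for z
    proof (cases "z \<in> ball 0 R")
      case True
      have "cmod (herm w z) ^ k \<le> ?c"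
        using True by (intro power_mono order_trans[OF norm_herm_le] mult_left_mono) auto
      then have "cmod (herm w z) ^ k * (\<bar>\<rho> z\<bar> * cmod (g z)) \<le> ?c * (\<bar>\<rho> z\<bar> * cmod (g z))"
        by (intro mult_right_mono) auto
      then show ?thesis using True by (simp add: norm_mult norm_power abs_mult power_abs mult_ac)
    qed simp
    then show "AE z in lborel. norm (?q z) \<le> norm (?c *\<^sub>R (?f z))"
      by simp
  qed
  have "2 * pi * (\<integral>z. ?q z \<partial>lborel) = (\<integral>z. (\<integral>\<theta>\<in>{0..2*pi}. ?q (cis \<theta> *s z) \<partial>lborel) \<partial>lborel)"
    by (rule integral_circle_average[OF intq, symmetric])
  also have "\<dots> = (\<integral>z. 2 * pi * (?p z) \<partial>lborel)"
  proof (rule Bochner_Integration.integral_cong[OF refl])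
    fix z
    have "?q (cis \<theta> *s z) = (indicator (ball 0 R) z * \<rho> z) *\<^sub>R (herm w z ^ k * (g (cis \<theta> *s z) * cis (- (real k * \<theta>))))" for \<theta>
      by (simp add: radial indicator_def power_mult_distrib cis_cnj Complex.DeMoivre)
    then have "(\<integral>\<theta>\<in>{0..2*pi}. ?q (cis \<theta> *s z) \<partial>lborel) = (indicator (ball 0 R) z * \<rho> z) *\<^sub>R
        (herm w z ^ k * (\<integral>\<theta>\<in>{0..2*pi}. g (cis \<theta> *s z) * cis (- (real k * \<theta>)) \<partial>lborel))"
      by simp
    then show "(\<integral>\<theta>\<in>{0..2*pi}. ?q (cis \<theta> *s z) \<partial>lborel)
        = 2 * pi * (?p z)"
      using homogeneous_part_average[OF g, of z k]
      by (cases "z \<in> ball 0 R") (simp_all add: scaleR_conv_of_real mult_ac)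
  qed
  also have "\<dots> = 2 * pi * (\<integral>z. ?p z \<partial>lborel)"
    by (rule integral_mult_right_zero)
  finally show ?thesis by (simp add: set_lebesgue_integral_def)
qed

lemma ball_reproducing:
  fixes g :: "complex ^ 'n \<Rightarrow> complex"
  assumes g: "slice_holomorphic g (ball 0 R)" and R: "R > 0"
    and int: "set_integrable lborel (ball 0 R) g"
  shows "(LINT z:ball 0 R|lborel. g z * herm w z ^ k)
     = R ^ (2 * (CARD('n) + k)) *\<^sub>R (fact k / fact (CARD('n) + k) * gauss_mass TYPE('n) * homogeneous_part k g w)"
proof -
  let ?p = "homogeneous_part k g"
  have p: "slice_holomorphic ?p UNIV" and hom: "?p (u *s z) = u ^ k * ?p z" for u z
    using R by (auto intro!: slice_holomorphic_homogeneous_part[OF g] homogeneous_part_scale[OF g])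
  note cont = homogeneous_times_herm(1)[OF p hom] and h = homogeneous_times_herm(2)[OF p hom]
  have "(LINT z:ball 0 R|lborel. g z * herm w z ^ k) = (LINT z:ball 0 R|lborel. ?p z * herm w z ^ k)"
    using integral_homogeneous_part[OF g, of "\<lambda>_. 1"] int by simp
  also have "\<dots> = R ^ (2 * (CARD('n) + k)) *\<^sub>R (LINT z:ball 0 1|lborel. ?p z * herm w z ^ k)"
    by (rule ball_integral_homogeneous(2)[OF borel_measurable_continuous_onI[OF cont] h
         set_integrable_ball_bounded[OF cont] R])
  finally show ?thesis unfolding homogeneous_ball_reproducing[OF p hom] by simp
qed

lemma weighted_ball_reproducing:
  fixes g :: "complex ^ 'n \<Rightarrow> complex" and s :: real
  assumes g: "slice_holomorphic g (ball 0 1)" and s: "s > 0"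
    and int: "set_integrable lborel (ball 0 1) (\<lambda>z. (1 - (norm z)\<^sup>2) powr s *\<^sub>R g z)"
  shows "(LINT z:ball 0 1|lborel. (1 - (norm z)\<^sup>2) powr s *\<^sub>R (g z * herm w z ^ k))
     = fact k / pochhammer (s + 1) (CARD('n) + k) * gauss_mass TYPE('n) * homogeneous_part k g w"
proof -
  let ?p = "homogeneous_part k g"
  have p: "slice_holomorphic ?p UNIV" and hom: "?p (u *s z) = u ^ k * ?p z" for u z
    by (auto intro!: slice_holomorphic_homogeneous_part[OF g] homogeneous_part_scale[OF g])
  note cont = homogeneous_times_herm(1)[OF p hom] and h = homogeneous_times_herm(2)[OF p hom]
  have "(LINT z:ball 0 1|lborel. (1 - (norm z)\<^sup>2) powr s *\<^sub>R (g z * herm w z ^ k))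
      = (LINT z:ball 0 1|lborel. (1 - (norm z)\<^sup>2) powr s *\<^sub>R (?p z * herm w z ^ k))"
    by (rule integral_homogeneous_part[OF g _ _ int]) auto
  also have "\<dots> = (fact (CARD('n) + k) / pochhammer (s + 1) (CARD('n) + k)) *\<^sub>R (LINT z:ball 0 1|lborel. ?p z * herm w z ^ k)"
    by (rule weighted_integral_homogeneous[OF cont s h])
  finally show ?thesis
    unfolding homogeneous_ball_reproducing[OF p hom] by (simp add: scaleR_conv_of_real)
qed

lemma sums_integral_bounded:
  fixes f :: "'a \<Rightarrow> complex" and u :: "nat \<Rightarrow> 'a \<Rightarrow> complex"
  assumes f: "integrable M f" and u [measurable]: "\<And>k. u k \<in> borel_measurable M"
    and bound: "\<And>k x. f x \<noteq> 0 \<Longrightarrow> cmod (u k x) \<le> c k" and c: "summable c" "\<And>k. c k \<ge> 0"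
    and sums: "\<And>x. f x \<noteq> 0 \<Longrightarrow> (\<lambda>k. u k x) sums U x"
  shows "(\<lambda>k. \<integral>x. f x * u k x \<partial>M) sums (\<integral>x. f x * U x \<partial>M)"
proof -
  have [measurable]: "f \<in> borel_measurable M" using f by auto
  have le: "cmod (f x * u k x) \<le> cmod (c k * f x)" for k x
  proof (cases "f x = 0")
    case False
    from mult_right_mono[OF bound[OF this, of k] norm_ge_zero[of "f x"]] show ?thesis
      using c(2)[of k] by (simp add: norm_mult mult.commute)
  qed simp
  have int: "integrable M (\<lambda>x. f x * u k x)" for k
    by (rule Bochner_Integration.integrable_bound[of _ "\<lambda>x. c k * f x"]) (use f le in auto)
  have "(\<lambda>k. \<integral>x. f x * u k x \<partial>M) sums (\<integral>x. (\<Sum>k. f x * u k x) \<partial>M)"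
  proof (rule sums_integral)
    have "summable (\<lambda>k. cmod (f x * u k x))" for x
    proof (rule summable_comparison_test')
      show "summable (\<lambda>k. c k * cmod (f x))" using c by (intro summable_mult2) auto
      show "norm (cmod (f x * u k x)) \<le> c k * cmod (f x)" if "k \<ge> 0" for k
        using le[of x k] c(2)[of k] by (simp add: norm_mult)
    qed
    then show "AE x in M. summable (\<lambda>k. cmod (f x * u k x))" by simp
    show "summable (\<lambda>k. \<integral>x. cmod (f x * u k x) \<partial>M)"
    proof (rule summable_comparison_test')
      show "summable (\<lambda>k. c k * (\<integral>x. cmod (f x) \<partial>M))" using c by (intro summable_mult2) auto
      show "norm (\<integral>x. cmod (f x * u k x) \<partial>M) \<le> c k * (\<integral>x. cmod (f x) \<partial>M)" if "k \<ge> 0" for k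
      proof -
        have "(\<integral>x. cmod (f x * u k x) \<partial>M) \<le> (\<integral>x. c k * cmod (f x) \<partial>M)"
          using le[of _ k] c(2)[of k] f by (intro integral_mono integrable_norm int) (auto simp: norm_mult)
        then show ?thesis by simp
      qed
    qed
  qed (rule int)
  also have "(\<lambda>x. \<Sum>k. f x * u k x) = (\<lambda>x. f x * U x)"
  proof
    fix x
    show "(\<Sum>k. f x * u k x) = f x * U x"
      using sums_mult[OF sums[of x], of "f x"] by (cases "f x = 0") (auto simp: sums_iff)
  qed
  finally show ?thesis .
qed

lemma negative_binomial_series:
  fixes x :: complex and b :: real
  assumes "cmod x < 1"
  shows "(\<lambda>j. pochhammer b j / fact j * x ^ j) sums (1 - x) powr (- of_real b)"
proof -
  have "(\<lambda>j. (of_real (- b) gchoose j) * (- x) ^ j) sums (1 + (- x)) powr (of_real (- b))"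
    by (rule gen_binomial_complex) (use assms in simp)
  also have "(\<lambda>j. (of_real (- b) gchoose j) * (- x) ^ j) = (\<lambda>j. pochhammer b j / fact j * x ^ j)"
  proof
    fix j
    have "(complex_of_real (- b) gchoose j) = (-1) ^ j * of_real (pochhammer b j) / fact j"
      by (simp add: gbinomial_pochhammer flip: pochhammer_of_real)
    moreover have "(- x) ^ j = (-1) ^ j * x ^ j" by (rule power_minus)
    moreover have "(-1) ^ j * (-1) ^ j = (1 :: complex)"
      by (simp flip: power_mult_distrib)
    ultimately show "(of_real (- b) gchoose j) * (- x) ^ j = of_real (pochhammer b j / fact j) * x ^ j"
      by (simp add: mult_ac)
  qed
  finally show ?thesis by simp
qed

lemma summable_negative_binomial:
  fixes r b :: real
  assumes "0 \<le> r" "r < 1"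
  shows "summable (\<lambda>j. pochhammer b j / fact j * r ^ j)"
proof -
  have "summable (\<lambda>j. Re (pochhammer b j / fact j * (complex_of_real r) ^ j))"
    using negative_binomial_series[of "complex_of_real r" b] assms
    by (intro summable_Re) (auto simp: sums_iff)
  then show ?thesis
    by (simp only: of_real_power[symmetric] of_real_mult[symmetric] Re_complex_of_real)
qed

lemma borel_measurable_complex_powr [measurable (raw)]:
  assumes [measurable]: "f \<in> borel_measurable M"
  shows "(\<lambda>x. f x powr (a :: complex)) \<in> borel_measurable M"
  unfolding powr_def by measurable

text \<open>
The binomial series of the kernel is integrated term by term: the factor
\<open>pochhammer (n + 1 + s) j / j!\<close> exactly cancels the constants of \<open>weighted_ball_reproducing\<close> up to one that is
independent of \<open>j\<close>, and the homogeneous parts of \<open>g\<close> sum to \<open>g w\<close>.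
\<close>

lemma weighted_bergman_reproducing:
  fixes g :: "complex ^ 'n \<Rightarrow> complex" and s :: real
  assumes g: "slice_holomorphic g (ball 0 1)" and s: "s > 0"
    and int: "set_integrable lborel (ball 0 1) (\<lambda>z. (1 - (norm z)\<^sup>2) powr s *\<^sub>R g z)"
    and w: "norm w < 1"
  shows "(LINT z:ball 0 1|lborel. (1 - (norm z)\<^sup>2) powr s *\<^sub>R (g z * (1 - herm w z) powr (- of_real (CARD('n) + 1 + s))))
     = gauss_mass TYPE('n) / pochhammer (s + 1) CARD('n) * g w"
proof -
  define b :: real where "b = CARD('n) + 1 + s"
  let ?f = "\<lambda>z. indicator (ball 0 1) z *\<^sub>R ((1 - (norm z)\<^sup>2) powr s *\<^sub>R g z)"
  have fnz: "norm z < 1" if "?f z \<noteq> 0" for z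
    using that by (auto simp: indicator_def split: if_splits)
  have poch: "pochhammer b j > 0" for j
    using s by (intro pochhammer_pos) (auto simp: b_def)
  have le: "cmod (herm w z) \<le> norm w" if "norm z < 1" for z
  proof -
    have "norm w * norm z \<le> norm w * 1" using that by (intro mult_left_mono) auto
    then show ?thesis using norm_herm_le[of w z] by simp
  qed
  have "(\<lambda>j. \<integral>z. ?f z * (pochhammer b j / fact j * herm w z ^ j) \<partial>lborel)
      sums (\<integral>z. ?f z * (1 - herm w z) powr (- of_real b) \<partial>lborel)"
  proof (rule sums_integral_bounded)
    show "integrable lborel ?f" using int by (simp add: set_integrable_def)
    show "summable (\<lambda>j. pochhammer b j / fact j * norm w ^ j)"
      using w by (intro summable_negative_binomial) auto
    show "pochhammer b j / fact j * norm w ^ j \<ge> 0" for j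
      using poch[of j] by simp
    show "cmod (of_real (pochhammer b j / fact j) * herm w z ^ j) \<le> pochhammer b j / fact j * norm w ^ j"
      if "?f z \<noteq> 0" for j z
    proof -
      have "cmod (herm w z) ^ j \<le> norm w ^ j"
        using le[OF fnz[OF that]] by (intro power_mono) auto
      then have "pochhammer b j / fact j * cmod (herm w z) ^ j \<le> pochhammer b j / fact j * norm w ^ j"
        using poch[of j] by (intro mult_left_mono) auto
      then show ?thesis using poch[of j] by (simp add: norm_mult norm_power norm_divide)
    qed
    show "(\<lambda>j. of_real (pochhammer b j / fact j) * herm w z ^ j) sums (1 - herm w z) powr (- of_real b)"
      if "?f z \<noteq> 0" for z
      using le[OF fnz[OF that]] w by (intro negative_binomial_series) auto
  qed measurable
  moreover have "(\<integral>z. ?f z * (pochhammer b j / fact j * herm w z ^ j) \<partial>lborel)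
     = gauss_mass TYPE('n) / pochhammer (s + 1) CARD('n) * homogeneous_part j g w" for j
  proof -
    have "(\<integral>z. ?f z * (pochhammer b j / fact j * herm w z ^ j) \<partial>lborel)
        = (\<integral>z. (pochhammer b j / fact j) * (indicator (ball 0 1) z *\<^sub>R ((1 - (norm z)\<^sup>2) powr s *\<^sub>R (g z * herm w z ^ j))) \<partial>lborel)"
      by (intro Bochner_Integration.integral_cong refl) (simp add: scaleR_conv_of_real)
    also have "\<dots> = (pochhammer b j / fact j) *
        (LINT z:ball 0 1|lborel. (1 - (norm z)\<^sup>2) powr s *\<^sub>R (g z * herm w z ^ j))"
      unfolding set_lebesgue_integral_def by (rule integral_mult_right_zero)
    also have "\<dots> = (pochhammer b j / fact j) * (fact j / pochhammer (s + 1) (CARD('n) + j) * gauss_mass TYPE('n) * homogeneous_part j g w)"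
      by (simp only: weighted_ball_reproducing[OF g s int])
    also have "pochhammer (s + 1) (CARD('n) + j) = pochhammer (s + 1) CARD('n) * pochhammer b j"
      using pochhammer_product'[of "s + 1" "CARD('n)" j] by (simp add: b_def add_ac)
    finally show ?thesis using poch[of j] by (simp add: field_simps)
  qed
  ultimately have "(\<lambda>j. gauss_mass TYPE('n) / pochhammer (s + 1) CARD('n) * homogeneous_part j g w)
      sums (\<integral>z. ?f z * (1 - herm w z) powr (- of_real b) \<partial>lborel)" by simp
  moreover have "(\<lambda>j. gauss_mass TYPE('n) / pochhammer (s + 1) CARD('n) * homogeneous_part j g w)
      sums (gauss_mass TYPE('n) / pochhammer (s + 1) CARD('n) * g w)"
    by (intro sums_mult homogeneous_part_sums[OF g]) (rule w)
  ultimately have "(\<integral>z. ?f z * (1 - herm w z) powr (- of_real b) \<partial>lborel) = gauss_mass TYPE('n) / pochhammer (s + 1) CARD('n) * g w"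
    by (rule sums_unique2)
  then show ?thesis
    by (simp add: set_lebesgue_integral_def b_def)
qed

section \<open>The Hartogs domain and its kernel series\<close>

definition hartogs_pairs :: "real \<Rightarrow> ((complex ^ 'n) \<times> (complex ^ 'm)) set" where
  "hartogs_pairs \<mu> = {(z, Z). norm z < 1 \<and> (norm Z)\<^sup>2 < (1 - (norm z)\<^sup>2) powr \<mu>}"

lemma one_minus_norm_sq_pos: "norm z < 1 \<Longrightarrow> 0 < 1 - (norm z)\<^sup>2"
  by (simp add: abs_square_less_1)

lemma fibre_ball:
  assumes "norm z < 1"
  shows "(norm Z)\<^sup>2 < (1 - (norm z)\<^sup>2) powr \<mu> \<longleftrightarrow> norm Z < (1 - (norm z)\<^sup>2) powr (\<mu> / 2)"
proof -
  have "(1 - (norm z)\<^sup>2) powr \<mu> = ((1 - (norm z)\<^sup>2) powr (\<mu> / 2))\<^sup>2"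
    using one_minus_norm_sq_pos[OF assms] by (simp add: powr_power)
  then show ?thesis
    by (metis norm_ge_zero powr_ge_zero power2_less_imp_less power_strict_mono pos2)
qed

lemma open_hartogs_pairs: "open (hartogs_pairs \<mu> :: ((complex ^ 'n) \<times> (complex ^ 'm)) set)"
proof -
  let ?B = "{v :: (complex ^ 'n) \<times> (complex ^ 'm). norm (fst v) < 1}"
  let ?f = "\<lambda>v :: (complex ^ 'n) \<times> (complex ^ 'm). (norm (snd v))\<^sup>2 - (1 - (norm (fst v))\<^sup>2) powr \<mu>"
  have "open ?B" by (intro open_Collect_less continuous_intros)
  moreover have "continuous_on ?B ?f"
    by (intro continuous_intros) (use one_minus_norm_sq_pos in fastforce)
  ultimately have "open (?B \<inter> ?f -` {..<0})"
    by (intro continuous_open_preimage) auto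
  also have "?B \<inter> ?f -` {..<0} = hartogs_pairs \<mu>"
    by (auto simp: hartogs_pairs_def)
  finally show ?thesis .
qed

text \<open>
The decisive estimate is \<open>(1 - \<parallel>z\<parallel>\<^sup>2) (1 - \<parallel>w\<parallel>\<^sup>2) \<le> \<bar>1 - \<langle>w, z\<rangle>\<bar>\<^sup>2\<close>: it keeps the variable of the kernel
series in a disc of radius less than 1, uniformly in \<open>(z, Z)\<close> for fixed \<open>(w, W)\<close>. Consequently the kernel
is bounded in one variable, and the series converges uniformly.
\<close>

lemma hartogs_pairs_bounds:
  assumes zZ: "(z, Z) \<in> hartogs_pairs \<mu>" and wW: "(w, W) \<in> hartogs_pairs \<mu>" and \<mu>: "\<mu> > 0"
  shows "cmod (herm w z) < 1"
    and "norm Z < 1"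
    and "1 - norm w \<le> cmod (1 - herm w z)"
    and "cmod (herm W Z) * cmod (1 - herm w z) powr (- \<mu>) \<le> norm W * (1 - (norm w)\<^sup>2) powr (- (\<mu> / 2))"
    and "norm W * (1 - (norm w)\<^sup>2) powr (- (\<mu> / 2)) < 1"
proof -
  have z: "norm z < 1" "norm Z < (1 - (norm z)\<^sup>2) powr (\<mu> / 2)"
    using zZ fibre_ball by (auto simp: hartogs_pairs_def)
  have w: "norm w < 1" "norm W < (1 - (norm w)\<^sup>2) powr (\<mu> / 2)"
    using wW fibre_ball by (auto simp: hartogs_pairs_def)
  have pz: "0 < 1 - (norm z)\<^sup>2" and pw: "0 < 1 - (norm w)\<^sup>2"
    using one_minus_norm_sq_pos z(1) w(1) by blast+
  have prod: "norm w * norm z \<le> norm w" 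
    using z(1) mult_left_mono[of "norm z" 1 "norm w"] by simp
  then show x1: "cmod (herm w z) < 1"
    using norm_herm_le[of w z] w(1) by linarith
  have "(1 - (norm z)\<^sup>2) powr (\<mu> / 2) \<le> 1 powr (\<mu> / 2)"
    using pz \<mu> by (intro powr_mono2) auto
  then show "norm Z < 1" using z(2) by simp
  have low: "1 - norm w * norm z \<le> cmod (1 - herm w z)"
    using norm_triangle_ineq2[of 1 "herm w z"] norm_herm_le[of w z] by simp
  then show "1 - norm w \<le> cmod (1 - herm w z)"
    using prod by linarith
  have "norm w * norm z < 1" using prod w(1) by linarith
  have "(1 - (norm z)\<^sup>2) * (1 - (norm w)\<^sup>2) \<le> (1 - norm w * norm z)\<^sup>2"
  proof -
    have "0 \<le> (norm z - norm w)\<^sup>2" by simp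
    then show ?thesis by (simp add: power2_eq_square algebra_simps)
  qed
  also have "\<dots> \<le> (cmod (1 - herm w z))\<^sup>2"
    using low \<open>norm w * norm z < 1\<close> by (intro power_mono) auto
  finally have "((1 - (norm z)\<^sup>2) * (1 - (norm w)\<^sup>2)) powr (\<mu> / 2) \<le> ((cmod (1 - herm w z))\<^sup>2) powr (\<mu> / 2)"
    using pz pw \<mu> by (intro powr_mono2) auto
  also have "((cmod (1 - herm w z))\<^sup>2) powr (\<mu> / 2) = cmod (1 - herm w z) powr \<mu>"
  proof -
    have "cmod (1 - herm w z) > 0" using low \<open>norm w * norm z < 1\<close> by linarith
    then show ?thesis by (simp add: powr_powr flip: powr_numeral)
  qed
  finally have pw_le: "(1 - (norm z)\<^sup>2) powr (\<mu> / 2) * (1 - (norm w)\<^sup>2) powr (\<mu> / 2) \<le> cmod (1 - herm w z) powr \<mu>"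
    using pz pw by (simp add: powr_mult)
  have cpos: "cmod (1 - herm w z) > 0" using low \<open>norm w * norm z < 1\<close> by linarith
  have "cmod (herm W Z) * (1 - (norm w)\<^sup>2) powr (\<mu> / 2) \<le> norm W * norm Z * (1 - (norm w)\<^sup>2) powr (\<mu> / 2)"
    by (intro mult_right_mono norm_herm_le) auto
  also have "\<dots> \<le> norm W * (1 - (norm z)\<^sup>2) powr (\<mu> / 2) * (1 - (norm w)\<^sup>2) powr (\<mu> / 2)"
    using z(2) by (intro mult_right_mono mult_left_mono) auto
  also have "\<dots> \<le> norm W * cmod (1 - herm w z) powr \<mu>"
    using mult_left_mono[OF pw_le, of "norm W"] by (simp add: mult.assoc)
  finally show "cmod (herm W Z) * cmod (1 - herm w z) powr (- \<mu>) \<le> norm W * (1 - (norm w)\<^sup>2) powr (- (\<mu> / 2))"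
    using cpos pw by (simp add: powr_minus field_simps)
  show "norm W * (1 - (norm w)\<^sup>2) powr (- (\<mu> / 2)) < 1"
    using w(2) pw by (simp add: powr_minus field_simps)
qed

lemma norm_powr_of_real: "z \<noteq> 0 \<Longrightarrow> cmod (z powr of_real a) = cmod z powr a"
  by (simp add: powr_def)

text \<open>
The reciprocal of the product of the constants of the fibre and base reproducing formulas in degree \<open>k\<close>.
\<close>

definition kernel_coeff :: "'n::finite itself \<Rightarrow> 'm::finite itself \<Rightarrow> real \<Rightarrow> nat \<Rightarrow> real" where
  "kernel_coeff _ _ \<mu> k = pochhammer (\<mu> * real (CARD('m) + k) + 1) CARD('n) * fact (CARD('m) + k) / fact k
     / (gauss_mass TYPE('n) * gauss_mass TYPE('m))"

definition kernel_term :: "'n::finite itself \<Rightarrow> 'm::finite itself \<Rightarrow> real \<Rightarrow> nat \<Rightarrow> complex \<Rightarrow> complex \<Rightarrow> complex" where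
  "kernel_term N M \<mu> k x y = of_real (kernel_coeff N M \<mu> k) *
     ((1 - x) powr (- complex_of_real (CARD('n) + 1 + \<mu> * real (CARD('m) + k))) * y ^ k)"

lemma kernel_coeff_pos: "\<mu> > 0 \<Longrightarrow> kernel_coeff N M \<mu> k > 0"
  unfolding kernel_coeff_def
  by (intro divide_pos_pos mult_pos_pos pochhammer_pos gauss_mass_pos add_nonneg_pos) auto

text \<open>
Fubini: for fixed \<open>z\<close> the fibre integral produces the part of degree \<open>k\<close> of \<open>F (z, \<sqdot>)\<close> at \<open>W\<close>, times
the weight \<open>(1 - \<parallel>z\<parallel>\<^sup>2) powr s\<close>; as a function of \<open>z\<close> it is holomorphic, and the remaining base integral
reproduces it at \<open>w\<close>.
\<close>

lemma kernel_term_integral: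
  fixes F :: "(complex ^ 'n) \<times> (complex ^ 'm) \<Rightarrow> complex"
  assumes \<mu>: "\<mu> > 0" and cont: "continuous_on (hartogs_pairs \<mu>) F"
    and hol: "\<And>a b A B. (\<lambda>c. F (a + c *s b, A + c *s B)) holomorphic_on {c. (a + c *s b, A + c *s B) \<in> hartogs_pairs \<mu>}"
    and int: "set_integrable lborel (hartogs_pairs \<mu>) F"
    and wW: "(w, W) \<in> hartogs_pairs \<mu>"
  shows "(\<integral>v. (indicator (hartogs_pairs \<mu>) v *\<^sub>R F v) * kernel_term TYPE('n) TYPE('m) \<mu> k (herm w (fst v)) (herm W (snd v)) \<partial>lborel)
      = taylor_coeff k (\<lambda>u. F (w, u *s W))"
proof -
  let ?H = "hartogs_pairs \<mu> :: ((complex ^ 'n) \<times> (complex ^ 'm)) set"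
  define s where "s = \<mu> * real (CARD('m) + k)"
  define \<rho> where "\<rho> z = (1 - (norm z)\<^sup>2) powr (\<mu> / 2)" for z :: "complex ^ 'n"
  define e where "e = - complex_of_real (CARD('n) + 1 + s)"
  define d where "d = fact k / fact (CARD('m) + k) * gauss_mass TYPE('m)"
  define \<Phi> where "\<Phi> z = homogeneous_part k (\<lambda>Z. F (z, Z)) W" for z
  let ?g = "\<lambda>z. indicator (ball 0 1) z *\<^sub>R ((1 - (norm z)\<^sup>2) powr s *\<^sub>R \<Phi> z)"
  let ?kc = "kernel_coeff TYPE('n) TYPE('m) \<mu> k"
  let ?b = "(1 - norm w) powr (- (CARD('n) + 1 + s))"
  let ?F = "\<lambda>v. indicator (hartogs_pairs \<mu>) v *\<^sub>R F v"
  have s: "s > 0" using \<mu> by (simp add: s_def add_pos_nonneg)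
  have d: "d > 0" using gauss_mass_pos[where 'n = 'm] by (simp add: d_def)
  have w: "norm w < 1" using wW by (simp add: hartogs_pairs_def)
  have H_iff: "(z, Z) \<in> ?H \<longleftrightarrow> z \<in> ball 0 1 \<and> Z \<in> ball 0 (\<rho> z)" for z Z
    using fibre_ball[of z Z \<mu>] by (auto simp: hartogs_pairs_def \<rho>_def)
  have \<rho>_pos: "\<rho> z > 0" if "norm z < 1" for z
    using one_minus_norm_sq_pos[OF that] by (simp add: \<rho>_def)
  have \<rho>_power: "\<rho> z ^ (2 * (CARD('m) + k)) = (1 - (norm z)\<^sup>2) powr s" if "norm z < 1" for z
  proof -
    have "\<rho> z ^ (2 * (CARD('m) + k)) = (1 - (norm z)\<^sup>2) powr (real (2 * (CARD('m) + k)) * (\<mu> / 2))"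
      unfolding \<rho>_def by (rule powr_power) (use one_minus_norm_sq_pos[OF that] in simp)
    also have "real (2 * (CARD('m) + k)) * (\<mu> / 2) = s" by (simp add: s_def)
    finally show ?thesis .
  qed
  have slice_Z: "slice_holomorphic (\<lambda>Z. F (z, Z)) (ball 0 (\<rho> z))" if "norm z < 1" for z
    unfolding slice_holomorphic_def
  proof (intro conjI allI)
    show "continuous_on (ball 0 (\<rho> z)) (\<lambda>Z. F (z, Z))"
      by (rule continuous_on_compose2[OF cont]) (use that in \<open>auto simp: H_iff intro!: continuous_intros\<close>)
    show "(\<lambda>c. F (z, a + c *s b)) holomorphic_on {c. a + c *s b \<in> ball 0 (\<rho> z)}" for a b
      using hol[of z 0 a b] that by (simp add: H_iff)
  qed
  have slice_\<Phi>: "slice_holomorphic \<Phi> (ball 0 1)"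
  proof -
    let ?O = "{(z, u). (z, u *s W) \<in> ?H}"
    have "open ?O"
      unfolding case_prod_beta
      by (rule open_vimage[OF open_hartogs_pairs[of \<mu>], unfolded vimage_def]) (auto intro!: continuous_intros)
    moreover have "continuous_on ?O (\<lambda>(z, u). F (z, u *s W))"
      unfolding case_prod_beta
      by (rule continuous_on_compose2[OF cont]) (auto intro!: continuous_intros)
    moreover have "(\<lambda>c. F (a + c *s b, u *s W)) holomorphic_on {c. (a + c *s b, u) \<in> ?O}" for u a b
      using hol[of a b "u *s W" 0] by simp
    moreover have "(\<lambda>u. F (z, u *s W)) holomorphic_on {u. (z, u) \<in> ?O}" for z
      using hol[of z 0 0 W] by simp
    ultimately have "slice_holomorphic (\<lambda>z. taylor_coeff k (\<lambda>u. F (z, u *s W))) {z. (z, 0) \<in> ?O}"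
      by (rule taylor_coeff_slice_holomorphic)
    moreover have "{z. (z, 0) \<in> ?O} = ball 0 1"
      using \<rho>_pos by (auto simp: H_iff)
    ultimately show ?thesis
      by (simp add: \<Phi>_def[abs_def] homogeneous_part_def)
  qed
  let ?G = "\<lambda>z Z. (indicator ?H (z, Z) *\<^sub>R F (z, Z)) * herm W Z ^ k"
  have G_int: "integrable (lborel \<Otimes>\<^sub>M lborel) (\<lambda>(z, Z). ?G z Z)"
    unfolding lborel_prod case_prod_beta prod.collapse
  proof (rule Bochner_Integration.integrable_bound)
    show "integrable lborel (\<lambda>v. norm W ^ k *\<^sub>R (?F v))"
      using int by (intro integrable_scaleR_right) (simp add: set_integrable_def)
    have [measurable]: "(\<lambda>v :: (complex ^ 'n) \<times> (complex ^ 'm). herm W (snd v)) \<in> borel_measurable borel"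
      by (intro borel_measurable_continuous_onI continuous_intros)
    have [measurable]: "(\<lambda>v. ?F v) \<in> borel_measurable lborel"
      using int by (auto simp: set_integrable_def)
    show "(\<lambda>v. (?F v) * herm W (snd v) ^ k) \<in> borel_measurable lborel"
      by measurable
    have "norm ((?F v) * herm W (snd v) ^ k) \<le> norm (norm W ^ k *\<^sub>R (?F v))" for v
    proof (cases "v \<in> ?H")
      case True
      then obtain z Z where v: "v = (z, Z)" "(z, Z) \<in> ?H" by (cases v) auto
      have "cmod (herm W Z) \<le> norm W * 1"
        using hartogs_pairs_bounds(2)[OF v(2) wW \<mu>]
        by (intro order_trans[OF norm_herm_le] mult_left_mono) auto
      then have "cmod (herm W Z) ^ k \<le> norm W ^ k" by (intro power_mono) auto
      from mult_right_mono[OF this norm_ge_zero[of "F v"]] show ?thesis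
        using v by (simp add: norm_mult norm_power mult_ac)
    qed simp
    then show "AE v in lborel. norm ((?F v) * herm W (snd v) ^ k) \<le> norm (norm W ^ k *\<^sub>R (?F v))"
      by simp
  qed
  have inner: "(\<integral>Z. ?G z Z \<partial>lborel) = d *\<^sub>R (?g z)"
    if F_int: "integrable lborel (\<lambda>Z. indicator ?H (z, Z) *\<^sub>R F (z, Z))" for z
  proof (cases "norm z < 1")
    case True
    have ind: "indicator ?H (z, Z) = (indicator (ball 0 (\<rho> z)) Z :: real)" for Z
      using True by (auto simp: indicator_def H_iff)
    have "(\<integral>Z. ?G z Z \<partial>lborel) = (LINT Z:ball 0 (\<rho> z)|lborel. F (z, Z) * herm W Z ^ k)"
      by (simp add: ind set_lebesgue_integral_def)
    also have "\<dots> = \<rho> z ^ (2 * (CARD('m) + k)) *\<^sub>R (d * \<Phi> z)"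
      unfolding d_def \<Phi>_def using F_int
      by (intro ball_reproducing slice_Z \<rho>_pos True) (simp add: set_integrable_def ind)
    finally show ?thesis
      unfolding \<rho>_power[OF True] using True by (simp add: scaleR_conv_of_real mult.left_commute)
  next
    case False
    then have "indicator ?H (z, Z) = (0 :: real)" for Z by (simp add: H_iff indicator_def)
    then show ?thesis using False by simp
  qed
  have F_int: "AE z in lborel. integrable lborel (\<lambda>Z. indicator ?H (z, Z) *\<^sub>R F (z, Z))"
  proof -
    have "integrable (lborel \<Otimes>\<^sub>M lborel) (\<lambda>(z, Z). indicator ?H (z, Z) *\<^sub>R F (z, Z))"
      using int unfolding lborel_prod case_prod_beta prod.collapse set_integrable_def .
    from lborel_pair.AE_integrable_fst'[OF this] show ?thesis by simp
  qed
  have AE: "AE z in lborel. (\<integral>Z. ?G z Z \<partial>lborel) = d *\<^sub>R (?g z)"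
    using F_int by (rule eventually_mono) (rule inner)
  have \<Phi>_meas [measurable]: "(\<lambda>z. indicator (ball 0 1) z *\<^sub>R \<Phi> z) \<in> borel_measurable borel"
    using slice_\<Phi> by (intro borel_measurable_continuous_on_indicator) (auto simp: slice_holomorphic_def)
  have \<Phi>_meas' [measurable]: "(\<lambda>z. ?g z) \<in> borel_measurable borel"
  proof -
    have "(\<lambda>z. (1 - (norm z)\<^sup>2) powr s *\<^sub>R (indicator (ball 0 1) z *\<^sub>R \<Phi> z)) \<in> borel_measurable borel"
      by measurable
    then show ?thesis by (simp add: mult.commute)
  qed
  have "integrable lborel (\<lambda>z. d *\<^sub>R (?g z))"
  proof (rule integrable_cong_AE_imp[OF _ _ AE])
    show "integrable lborel (\<lambda>z. \<integral>Z. ?G z Z \<partial>lborel)"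
      using lborel_pair.integrable_fst'[OF G_int] by simp
    show "(\<lambda>z. d *\<^sub>R (?g z)) \<in> borel_measurable lborel"
      unfolding measurable_lborel2 by (rule borel_measurable_scaleR[OF borel_measurable_const \<Phi>_meas'])
  qed
  then have "integrable lborel (\<lambda>z. inverse d *\<^sub>R (d *\<^sub>R (?g z)))"
    by (rule integrable_scaleR_right)
  moreover have "inverse d *\<^sub>R (d *\<^sub>R x) = x" for x :: complex
    using d by simp
  ultimately have \<Phi>_int: "set_integrable lborel (ball 0 1) (\<lambda>z. (1 - (norm z)\<^sup>2) powr s *\<^sub>R \<Phi> z)"
    by (simp only: set_integrable_def)
  let ?E = "\<lambda>z. (1 - herm w z) powr e"
  have GE_int: "integrable (lborel \<Otimes>\<^sub>M lborel) (\<lambda>(z, Z). ?E z * ?G z Z)"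
  proof (rule Bochner_Integration.integrable_bound)
    show "integrable (lborel \<Otimes>\<^sub>M lborel) (\<lambda>v. ?b *\<^sub>R (case v of (z, Z) \<Rightarrow> ?G z Z))"
      by (intro integrable_scaleR_right G_int)
    have [measurable]: "(\<lambda>(z, Z). ?G z Z) \<in> borel_measurable (lborel \<Otimes>\<^sub>M lborel)"
      using G_int by auto
    have "(\<lambda>v. ?E (fst v) * (case v of (z, Z) \<Rightarrow> ?G z Z)) \<in> borel_measurable (lborel \<Otimes>\<^sub>M lborel)"
      by measurable
    then show "(\<lambda>(z, Z). ?E z * ?G z Z) \<in> borel_measurable (lborel \<Otimes>\<^sub>M lborel)"
      by (simp only: case_prod_unfold)
    have "norm (?E z * ?G z Z) \<le> norm (?b *\<^sub>R ?G z Z)" for z Z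
    proof (cases "(z, Z) \<in> ?H")
      case True
      note b = hartogs_pairs_bounds[OF True wW \<mu>]
      have nz: "1 - herm w z \<noteq> 0" using b(1) by auto
      have "cmod (?E z) = cmod (1 - herm w z) powr (- (CARD('n) + 1 + s))"
        using norm_powr_of_real[OF nz, of "- (CARD('n) + 1 + s)"] by (simp add: e_def)
      also have "\<dots> \<le> ?b"
        using b(3) w s by (intro powr_mono2') auto
      finally show ?thesis
        unfolding norm_mult norm_scaleR by (intro mult_right_mono) auto
    qed simp
    then show "AE v in lborel \<Otimes>\<^sub>M lborel. norm (case v of (z, Z) \<Rightarrow> ?E z * ?G z Z)
       \<le> norm (?b *\<^sub>R (case v of (z, Z) \<Rightarrow> ?G z Z))"
      by (intro AE_I2) (simp only: case_prod_unfold)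
  qed
  have "(\<integral>v. (?F v) * kernel_term TYPE('n) TYPE('m) \<mu> k (herm w (fst v)) (herm W (snd v)) \<partial>lborel)
     = (\<integral>v. ?kc * (case v of (z, Z) \<Rightarrow> ?E z * ?G z Z) \<partial>(lborel \<Otimes>\<^sub>M lborel))"
    unfolding lborel_prod
    by (intro Bochner_Integration.integral_cong refl)
       (simp add: kernel_term_def e_def s_def case_prod_beta mult_ac)
  also have "\<dots> = ?kc * (\<integral>v. (case v of (z, Z) \<Rightarrow> ?E z * ?G z Z) \<partial>(lborel \<Otimes>\<^sub>M lborel))"
    by (rule integral_mult_right_zero)
  also have "(\<integral>v. (case v of (z, Z) \<Rightarrow> ?E z * ?G z Z) \<partial>(lborel \<Otimes>\<^sub>M lborel)) = (\<integral>z. (\<integral>Z. ?E z * ?G z Z \<partial>lborel) \<partial>lborel)"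
    using lborel_pair.integral_fst'[OF GE_int] by simp
  also have "\<dots> = (\<integral>z. ?E z * (\<integral>Z. ?G z Z \<partial>lborel) \<partial>lborel)"
    by (simp only: integral_mult_right_zero)
  also have "\<dots> = (\<integral>z. d * (indicator (ball 0 1) z *\<^sub>R ((1 - (norm z)\<^sup>2) powr s *\<^sub>R (\<Phi> z * ?E z))) \<partial>lborel)"
  proof (rule integral_cong_AE)
    show "(\<lambda>z. ?E z * (\<integral>Z. ?G z Z \<partial>lborel)) \<in> borel_measurable lborel"
      by (rule borel_measurable_times[OF _ borel_measurable_integrable[OF
            lborel_pair.integrable_fst'[OF G_int], unfolded prod.case]]) measurable
    have "(\<lambda>z. d * ((?g z) * ?E z)) \<in> borel_measurable lborel"
      unfolding measurable_lborel2
      by (rule borel_measurable_times[OF borel_measurable_const borel_measurable_times[OF \<Phi>_meas']]) measurable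
    then show "(\<lambda>z. d * (indicator (ball 0 1) z *\<^sub>R ((1 - (norm z)\<^sup>2) powr s *\<^sub>R (\<Phi> z * ?E z)))) \<in> borel_measurable lborel"
      by simp
    show "AE z in lborel. ?E z * (\<integral>Z. ?G z Z \<partial>lborel) = d * (indicator (ball 0 1) z *\<^sub>R ((1 - (norm z)\<^sup>2) powr s *\<^sub>R (\<Phi> z * ?E z)))"
      using AE by (rule eventually_mono) (simp add: scaleR_conv_of_real mult_ac)
  qed
  also have "\<dots> = d * (LINT z:ball 0 1|lborel. (1 - (norm z)\<^sup>2) powr s *\<^sub>R (\<Phi> z * ?E z))"
    unfolding set_lebesgue_integral_def by (rule integral_mult_right_zero)
  also have "(LINT z:ball 0 1|lborel. (1 - (norm z)\<^sup>2) powr s *\<^sub>R (\<Phi> z * ?E z))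
      = gauss_mass TYPE('n) / pochhammer (s + 1) CARD('n) * \<Phi> w"
    unfolding e_def by (rule weighted_bergman_reproducing[OF slice_\<Phi> s \<Phi>_int w])
  also have "complex_of_real (?kc) * (d * (gauss_mass TYPE('n) / pochhammer (s + 1) CARD('n) * \<Phi> w)) = \<Phi> w"
  proof -
    have "pochhammer (s + 1) CARD('n) > 0" using s by (intro pochhammer_pos) auto
    moreover have "gauss_mass TYPE('n) > 0" "gauss_mass TYPE('m) > 0" by (rule gauss_mass_pos)+
    ultimately have "?kc * (d * (gauss_mass TYPE('n) / pochhammer (s + 1) CARD('n))) = 1"
      by (simp add: kernel_coeff_def d_def s_def field_simps)
    then have "complex_of_real (?kc * (d * (gauss_mass TYPE('n) / pochhammer (s + 1) CARD('n)))) * \<Phi> w = \<Phi> w"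
      by (simp only: of_real_1 mult_1_left)
    then show ?thesis by (simp only: of_real_mult mult.assoc)
  qed
  finally show ?thesis by (simp add: \<Phi>_def homogeneous_part_def)
qed

section \<open>Closed form of the kernel series\<close>

text \<open>
The coefficients of \<open>(\<mu> s + 1) (\<mu> s + 2) (\<mu> s + 3) (\<mu> s + 4)\<close> in the basis of rising factorials of \<open>s + 1\<close>.
In this basis each term sums to a single power of \<open>1 / (1 - t)\<close>.
\<close>

definition rising_coeff :: "real \<Rightarrow> nat \<Rightarrow> real" where
  "rising_coeff \<mu> j = [(1 - \<mu>) * (2 - \<mu>) * (3 - \<mu>) * (4 - \<mu>), 5 * (1 - \<mu>) * (5 - 3*\<mu>) * (2 - \<mu>) * \<mu>,
     5 * (1 - \<mu>) * (7 - 5*\<mu>) * \<mu>^2, 10 * (1 - \<mu>) * \<mu>^3, \<mu>^4] ! j"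

text \<open>
The polynomial \<open>P_poly\<close> at complex arguments.
\<close>

definition P_complex :: "nat \<Rightarrow> real \<Rightarrow> complex \<Rightarrow> complex" where
  "P_complex m \<mu> \<eta> = (\<Sum>j\<le>4. of_real (rising_coeff \<mu> j * pochhammer (real m + 1) j) * \<eta> ^ j)"

lemma pochhammer_4_rising:
  "pochhammer (\<mu> * s + 1) 4 = (\<Sum>j\<le>4. rising_coeff \<mu> j * pochhammer (s + 1) j)"
  by (simp add: rising_coeff_def eval_nat_numeral pochhammer_Suc) algebra

lemma fact_rising: "fact (a + j) = fact a * pochhammer (real a + 1) j"
  by (simp add: pochhammer_fact pochhammer_product'[of 1 a j] add.commute)

lemma negative_binomial_series_nat:
  fixes t :: complex
  assumes "cmod t < 1"
  shows "(\<lambda>k. of_real (pochhammer (real a + 1) k / fact k) * t ^ k) sums (1 / (1 - t)) ^ (a + 1)"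
proof -
  have "(1 - t) powr (- of_real (real (a + 1))) = (1 / (1 - t)) ^ (a + 1)"
    using assms by (subst powr_minus) (auto simp: powr_nat' divide_inverse power_inverse simp del: of_nat_Suc of_nat_add)
  then show ?thesis
    using negative_binomial_series[OF assms, of "real (a + 1)"] by (simp add: add.commute)
qed

lemma kernel_series:
  fixes t :: complex
  assumes "cmod t < 1"
  shows "(\<lambda>k. of_real (pochhammer (\<mu> * real (m + k) + 1) 4 * fact (m + k) / fact k) * t ^ k) sums
      (fact m * (1 / (1 - t)) ^ (m + 1) * P_complex m \<mu> (1 / (1 - t)))"
proof -
  let ?A = "\<lambda>j. of_real (rising_coeff \<mu> j * fact (m + j))"
  let ?T = "\<lambda>j k. ?A j * (of_real (pochhammer (real (m + j) + 1) k / fact k) * t ^ k)"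
  let ?C = "\<lambda>k. pochhammer (\<mu> * real (m + k) + 1) 4 * fact (m + k) / fact k"
  have "(\<lambda>k. \<Sum>j\<le>4. ?T j k) sums
      (\<Sum>j\<le>4. ?A j * (1 / (1 - t)) ^ (m + j + 1))"
    by (intro sums_sum sums_mult negative_binomial_series_nat assms)
  also have "(\<lambda>k. \<Sum>j\<le>4. ?T j k)
      = (\<lambda>k. of_real (?C k) * t ^ k)"
  proof
    fix k
    have eq: "rising_coeff \<mu> j * fact (m + j) * (pochhammer (real (m + j) + 1) k / fact k)
        = rising_coeff \<mu> j * pochhammer (real (m + k) + 1) j * fact (m + k) / fact k" for j
      using fact_rising[of "m + j" k] fact_rising[of "m + k" j] by (simp add: add_ac mult_ac)
    then have "(\<Sum>j\<le>4. rising_coeff \<mu> j * fact (m + j) * (pochhammer (real (m + j) + 1) k / fact k))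
        = ?C k"
      unfolding pochhammer_4_rising sum_distrib_right sum_divide_distrib by (intro sum.cong refl eq)
    then have "complex_of_real (\<Sum>j\<le>4. rising_coeff \<mu> j * fact (m + j) * (pochhammer (real (m + j) + 1) k / fact k)) * t ^ k
        = of_real (?C k) * t ^ k"
      by simp
    then show "(\<Sum>j\<le>4. ?T j k)
      = of_real (?C k) * t ^ k"
      by (simp only: of_real_sum of_real_mult sum_distrib_right mult.assoc)
  qed
  also have "(\<Sum>j\<le>4. ?A j * (1 / (1 - t)) ^ (m + j + 1))
      = fact m * (1 / (1 - t)) ^ (m + 1) * P_complex m \<mu> (1 / (1 - t))"
    unfolding P_complex_def sum_distrib_left
    by (intro sum.cong refl) (simp add: fact_rising power_add mult_ac)
  finally show ?thesis .
qed

definition kernel_scale :: "'m::finite itself \<Rightarrow> real" where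
  "kernel_scale _ = gauss_mass TYPE(4) * gauss_mass TYPE('m)"

text \<open>
The sum of the kernel series as a function of the single variable \<open>t\<close>.
\<close>

definition kernel_profile :: "'m::finite itself \<Rightarrow> real \<Rightarrow> complex \<Rightarrow> complex" where
  "kernel_profile M \<mu> t = fact CARD('m) * (1 / (1 - t)) ^ (CARD('m) + 1) * P_complex CARD('m) \<mu> (1 / (1 - t)) / of_real (kernel_scale M)"

lemma kernel_profile_sums:
  assumes "cmod t < 1"
  shows "(\<lambda>k. of_real (kernel_coeff TYPE(4) TYPE('m::finite) \<mu> k) * t ^ k) sums kernel_profile TYPE('m) \<mu> t"
proof -
  have "(\<lambda>k. of_real (pochhammer (\<mu> * real (CARD('m) + k) + 1) 4 * fact (CARD('m) + k) / fact k) * t ^ k / of_real (kernel_scale TYPE('m)))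
      sums kernel_profile TYPE('m) \<mu> t"
    unfolding kernel_profile_def by (intro sums_divide kernel_series assms)
  then show ?thesis
    by (simp add: kernel_coeff_def kernel_scale_def)
qed

lemma summable_kernel_coeff:
  assumes "0 \<le> q" "q < 1"
  shows "summable (\<lambda>k. kernel_coeff TYPE(4) TYPE('m::finite) \<mu> k * q ^ k)"
proof -
  have "summable (\<lambda>k. Re (of_real (kernel_coeff TYPE(4) TYPE('m) \<mu> k) * complex_of_real q ^ k))"
    using kernel_profile_sums[of "complex_of_real q" \<mu>, where 'm = 'm] assms
    by (intro summable_Re) (auto simp: sums_iff)
  then show ?thesis
    by (simp only: of_real_power[symmetric] of_real_mult[symmetric] Re_complex_of_real)
qed

lemma holomorphic_kernel_profile: "kernel_profile TYPE('m::finite) \<mu> holomorphic_on ball 0 1"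
  by (rule power_series_holomorphic[where a = "\<lambda>k. of_real (kernel_coeff TYPE(4) TYPE('m) \<mu> k)"])
     (use kernel_profile_sums in simp)

definition kernel_value :: "'m::finite itself \<Rightarrow> real \<Rightarrow> complex \<Rightarrow> complex \<Rightarrow> complex" where
  "kernel_value M \<mu> x y = (1 - x) powr (- of_real (5 + \<mu> * real CARD('m))) * kernel_profile M \<mu> (y * (1 - x) powr (- of_real \<mu>))"

lemma kernel_term_eq:
  "kernel_term TYPE(4) TYPE('m::finite) \<mu> k x y = (1 - x) powr (- of_real (5 + \<mu> * real CARD('m))) *
     (of_real (kernel_coeff TYPE(4) TYPE('m) \<mu> k) * (y * (1 - x) powr (- of_real \<mu>)) ^ k)"
proof (cases "1 - x = 0")
  case False
  have "(1 - x) powr (- of_real (CARD(4) + 1 + \<mu> * real (CARD('m) + k)))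
      = (1 - x) powr (- of_real (5 + \<mu> * real CARD('m))) * ((1 - x) powr (- of_real \<mu>)) ^ k"
    using False by (simp add: powr_def exp_add[symmetric] exp_of_nat_mult[symmetric] algebra_simps)
  then show ?thesis by (simp add: kernel_term_def power_mult_distrib mult_ac)
qed (simp add: kernel_term_def)

lemma kernel_term_sums:
  fixes z w :: "complex ^ 4" and Z W :: "complex ^ 'm"
  assumes zZ: "(z, Z) \<in> hartogs_pairs \<mu>" and wW: "(w, W) \<in> hartogs_pairs \<mu>" and \<mu>: "\<mu> > 0"
  shows "cmod (herm W Z * (1 - herm w z) powr (- of_real \<mu>)) \<le> norm W * (1 - (norm w)\<^sup>2) powr (- (\<mu> / 2))"
    and "cmod (herm W Z * (1 - herm w z) powr (- of_real \<mu>)) < 1"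
    and "(\<lambda>k. kernel_term TYPE(4) TYPE('m) \<mu> k (herm w z) (herm W Z)) sums kernel_value TYPE('m) \<mu> (herm w z) (herm W Z)"
    and "cmod (kernel_term TYPE(4) TYPE('m) \<mu> k (herm w z) (herm W Z)) \<le>
       (1 - norm w) powr (- (5 + \<mu> * real CARD('m))) *
       (kernel_coeff TYPE(4) TYPE('m) \<mu> k * (norm W * (1 - (norm w)\<^sup>2) powr (- (\<mu> / 2))) ^ k)"
proof -
  let ?q = "norm W * (1 - (norm w)\<^sup>2) powr (- (\<mu> / 2))"
  let ?e = "5 + \<mu> * real CARD('m)"
  let ?c = "kernel_coeff TYPE(4) TYPE('m) \<mu> k"
  note b = hartogs_pairs_bounds[OF zZ wW \<mu>]
  have nz: "1 - herm w z \<noteq> 0" using b(1) by auto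
  have w: "norm w < 1" using wW by (simp add: hartogs_pairs_def)
  show t: "cmod (herm W Z * (1 - herm w z) powr (- of_real \<mu>)) \<le> ?q"
    using b(4) norm_powr_of_real[OF nz, of "- \<mu>"] by (simp add: norm_mult)
  then show t1: "cmod (herm W Z * (1 - herm w z) powr (- of_real \<mu>)) < 1"
    using b(5) by linarith
  show "(\<lambda>k. kernel_term TYPE(4) TYPE('m) \<mu> k (herm w z) (herm W Z)) sums kernel_value TYPE('m) \<mu> (herm w z) (herm W Z)"
    unfolding kernel_term_eq kernel_value_def by (intro sums_mult kernel_profile_sums t1)
  have nn: "- ?e \<le> 0"
    using mult_nonneg_nonneg[of \<mu> "real CARD('m)"] \<mu> by linarith
  have "cmod ((1 - herm w z) powr (- of_real ?e)) = cmod (1 - herm w z) powr (- ?e)"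
    using norm_powr_of_real[OF nz, of "- ?e"] by simp
  also have "\<dots> \<le> (1 - norm w) powr (- ?e)"
    using b(3) w by (intro powr_mono2' nn) auto
  finally have 1: "cmod ((1 - herm w z) powr (- of_real ?e)) \<le> (1 - norm w) powr (- ?e)" .
  show "cmod (kernel_term TYPE(4) TYPE('m) \<mu> k (herm w z) (herm W Z)) \<le>
       (1 - norm w) powr (- ?e) *
       (?c * (?q) ^ k)"
  proof -
    define T where "T = herm W Z * (1 - herm w z) powr (- of_real \<mu>)"
    have "cmod (kernel_term TYPE(4) TYPE('m) \<mu> k (herm w z) (herm W Z)) =
        cmod ((1 - herm w z) powr (- of_real ?e)) * (?c * cmod T ^ k)"
      unfolding kernel_term_eq T_def[symmetric] norm_mult norm_power norm_of_real
      using kernel_coeff_pos[OF \<mu>, of "TYPE(4)" "TYPE('m)" k] by simp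
    also have "\<dots> \<le> (1 - norm w) powr (- ?e) *
       (?c * (?q) ^ k)"
      using kernel_coeff_pos[OF \<mu>, of "TYPE(4)" "TYPE('m)" k] t unfolding T_def[symmetric]
      by (intro mult_mono[OF 1] mult_left_mono power_mono) auto
    finally show ?thesis .
  qed
qed

lemma kernel_value_bounded:
  fixes w :: "complex ^ 4" and W :: "complex ^ 'm"
  assumes wW: "(w, W) \<in> hartogs_pairs \<mu>" and \<mu>: "\<mu> > 0"
  obtains C where "\<And>z Z. (z, Z) \<in> hartogs_pairs \<mu> \<Longrightarrow> cmod (kernel_value TYPE('m) \<mu> (herm w z) (herm W Z)) \<le> C"
proof -
  let ?c = "\<lambda>k. (1 - norm w) powr (- (5 + \<mu> * real CARD('m))) *
       (kernel_coeff TYPE(4) TYPE('m) \<mu> k * (norm W * (1 - (norm w)\<^sup>2) powr (- (\<mu> / 2))) ^ k)"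
  have "summable ?c"
    using hartogs_pairs_bounds(5)[OF wW wW \<mu>] by (intro summable_mult summable_kernel_coeff) auto
  then have "cmod (kernel_value TYPE('m) \<mu> (herm w z) (herm W Z)) \<le> (\<Sum>k. ?c k)"
    if "(z, Z) \<in> hartogs_pairs \<mu>" for z Z
  proof -
    assume "summable ?c"
    then have "cmod (\<Sum>k. kernel_term TYPE(4) TYPE('m) \<mu> k (herm w z) (herm W Z)) \<le> (\<Sum>k. ?c k)"
      by (intro norm_suminf_le kernel_term_sums(4)[OF that wW \<mu>])
    then show ?thesis
      by (simp only: sums_unique[OF kernel_term_sums(3)[OF that wW \<mu>], symmetric])
  qed
  then show ?thesis by (rule that)
qed

lemma kernel_value_reproducing:
  fixes F :: "(complex ^ 4) \<times> (complex ^ 'm) \<Rightarrow> complex"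
  assumes \<mu>: "\<mu> > 0" and cont: "continuous_on (hartogs_pairs \<mu>) F"
    and hol: "\<And>a b A B. (\<lambda>c. F (a + c *s b, A + c *s B)) holomorphic_on {c. (a + c *s b, A + c *s B) \<in> hartogs_pairs \<mu>}"
    and int: "set_integrable lborel (hartogs_pairs \<mu>) F"
    and wW: "(w, W) \<in> hartogs_pairs \<mu>"
  shows "(LINT v:hartogs_pairs \<mu>|lborel. F v * kernel_value TYPE('m) \<mu> (herm w (fst v)) (herm W (snd v))) = F (w, W)"
proof -
  let ?K = "\<lambda>v. kernel_value TYPE('m) \<mu> (herm w (fst v)) (herm W (snd v))"
  let ?T = "\<lambda>k v. kernel_term TYPE(4) TYPE('m) \<mu> k (herm w (fst v)) (herm W (snd v))"
  let ?R = "(1 - (norm w)\<^sup>2) powr (\<mu> / 2)"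
  let ?H = "hartogs_pairs \<mu> :: ((complex ^ 4) \<times> (complex ^ 'm)) set"
  let ?f = "\<lambda>v. indicator ?H v *\<^sub>R F v"
  let ?c = "\<lambda>k. (1 - norm w) powr (- (5 + \<mu> * real CARD('m))) *
       (kernel_coeff TYPE(4) TYPE('m) \<mu> k * (norm W * (1 - (norm w)\<^sup>2) powr (- (\<mu> / 2))) ^ k)"
  have fH: "(fst v, snd v) \<in> ?H" if "?f v \<noteq> 0" for v
    using that by (auto simp: indicator_def split: if_splits)
  have "(\<lambda>k. \<integral>v. ?f v * ?T k v \<partial>lborel) sums
     (\<integral>v. ?f v * ?K v \<partial>lborel)"
  proof (rule sums_integral_bounded[where c = ?c])
    show "integrable lborel ?f" using int by (simp add: set_integrable_def)
    have [measurable]: "(\<lambda>v :: (complex ^ 4) \<times> (complex ^ 'm). herm w (fst v)) \<in> borel_measurable borel"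
      "(\<lambda>v :: (complex ^ 4) \<times> (complex ^ 'm). herm W (snd v)) \<in> borel_measurable borel"
      by (intro borel_measurable_continuous_onI continuous_intros)+
    show "(\<lambda>v. ?T k v) \<in> borel_measurable lborel" for k
      unfolding kernel_term_def by measurable
    show "summable ?c"
      using hartogs_pairs_bounds(5)[OF wW wW \<mu>] by (intro summable_mult summable_kernel_coeff) auto
    show "0 \<le> ?c k" for k
      using kernel_coeff_pos[OF \<mu>, of "TYPE(4)" "TYPE('m)" k] by simp
    show "cmod (?T k v) \<le> ?c k" if "?f v \<noteq> 0" for k v
      by (rule kernel_term_sums(4)[OF fH[OF that] wW \<mu>])
    show "(\<lambda>k. ?T k v)
        sums ?K v" if "?f v \<noteq> 0" for v
      by (rule kernel_term_sums(3)[OF fH[OF that] wW \<mu>])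
  qed
  then have "(\<lambda>k. taylor_coeff k (\<lambda>u. F (w, u *s W))) sums
     (\<integral>v. ?f v * ?K v \<partial>lborel)"
    unfolding kernel_term_integral[OF \<mu> cont hol int wW] .
  moreover have "(\<lambda>k. homogeneous_part k (\<lambda>Z. F (w, Z)) W) sums F (w, W)"
  proof (rule homogeneous_part_sums[where R = ?R])
    have w: "norm w < 1" using wW by (simp add: hartogs_pairs_def)
    have iff: "(w, Z) \<in> ?H \<longleftrightarrow> Z \<in> ball 0 ?R" for Z
      using w fibre_ball[OF w, of Z \<mu>] by (simp add: hartogs_pairs_def)
    show "norm W < (1 - (norm w)\<^sup>2) powr (\<mu> / 2)" using wW iff by simp
    show "slice_holomorphic (\<lambda>Z. F (w, Z)) (ball 0 ?R)"
      unfolding slice_holomorphic_def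
    proof (intro conjI allI)
      show "continuous_on (ball 0 ?R) (\<lambda>Z. F (w, Z))"
        by (rule continuous_on_compose2[OF cont]) (auto simp only: iff image_subset_iff intro!: continuous_intros)
      show "(\<lambda>c. F (w, a + c *s b)) holomorphic_on {c. a + c *s b \<in> ball 0 ?R}" for a b
        using hol[of w 0 a b] by (simp only: vector_smult_rzero add_0_right iff)
    qed
  qed
  ultimately show ?thesis
    unfolding homogeneous_part_def set_lebesgue_integral_def mult_scaleR_left[symmetric]
    by (rule sums_unique2)
qed

section \<open>The domain in joined coordinates\<close>

definition vec_left :: "'a ^ ('k::finite + 'm::finite) \<Rightarrow> 'a ^ 'k" where
  "vec_left v = (\<chi> j. v $ Inl j)"

definition vec_right :: "'a ^ ('k::finite + 'm::finite) \<Rightarrow> 'a ^ 'm" where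
  "vec_right v = (\<chi> j. v $ Inr j)"

lemma vec_left_join [simp]: "vec_left (vec_join z Z) = z"
  and vec_right_join [simp]: "vec_right (vec_join z Z) = Z"
  by (simp_all add: vec_left_def vec_right_def vec_join_def)

lemma vec_join_left_right [simp]: "vec_join (vec_left v) (vec_right v) = v"
  by (auto simp: vec_left_def vec_right_def vec_join_def vec_eq_iff split: sum.splits)

lemma vec_join_add: "vec_join (z + z') (Z + Z') = vec_join z Z + vec_join z' Z'"
  and vec_join_scaleR: "vec_join (r *\<^sub>R x) (r *\<^sub>R y) = r *\<^sub>R vec_join x y"
  and vec_join_cmult: "vec_join (c *s z) (c *s Z) = c *s vec_join z Z"
  by (auto simp: vec_join_def vec_eq_iff split: sum.splits)

lemma norm_vec_join: "(norm (vec_join z Z))\<^sup>2 = (norm z)\<^sup>2 + (norm Z)\<^sup>2"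
proof -
  have "(norm (vec_join z Z))\<^sup>2 = (\<Sum>i\<in>UNIV <+> UNIV. (norm (vec_join z Z $ i))\<^sup>2)"
    by (simp add: norm_vec_def L2_set_def sum_nonneg)
  also have "\<dots> = (\<Sum>i\<in>UNIV. (norm (z $ i))\<^sup>2) + (\<Sum>i\<in>UNIV. (norm (Z $ i))\<^sup>2)"
    by (subst sum.Plus) (simp_all add: vec_join_def o_def)
  also have "\<dots> = (norm z)\<^sup>2 + (norm Z)\<^sup>2"
    by (simp add: norm_vec_def L2_set_def sum_nonneg)
  finally show ?thesis .
qed

lemma norm_vec_left_right_le: "norm (vec_left v) \<le> norm v" "norm (vec_right v) \<le> norm v"
proof -
  have "(norm v)\<^sup>2 = (norm (vec_left v))\<^sup>2 + (norm (vec_right v))\<^sup>2"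
    using norm_vec_join[of "vec_left v" "vec_right v"] by simp
  then have "(norm (vec_left v))\<^sup>2 \<le> (norm v)\<^sup>2" "(norm (vec_right v))\<^sup>2 \<le> (norm v)\<^sup>2" by simp_all
  then show "norm (vec_left v) \<le> norm v" "norm (vec_right v) \<le> norm v"
    by (auto intro: power2_le_imp_le)
qed

lemma bounded_linear_vec_left: "bounded_linear (vec_left :: 'a::real_normed_vector ^ ('k::finite + 'm::finite) \<Rightarrow> 'a ^ 'k)"
  by (rule bounded_linear_intro[where K = 1]) (simp_all add: norm_vec_left_right_le, simp_all add: vec_left_def vec_eq_iff)

lemma bounded_linear_vec_right: "bounded_linear (vec_right :: 'a::real_normed_vector ^ ('k::finite + 'm::finite) \<Rightarrow> 'a ^ 'm)"
  by (rule bounded_linear_intro[where K = 1]) (simp_all add: norm_vec_left_right_le, simp_all add: vec_right_def vec_eq_iff)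

lemma vec_left_right_cmult: "vec_left (c *s v) = c *s vec_left v" "vec_right (c *s v) = c *s vec_right v"
  by (simp_all add: vec_left_def vec_right_def vec_eq_iff)

abbreviation join_pair :: "('a ^ 'k) \<times> ('a ^ 'm) \<Rightarrow> 'a ^ ('k::finite + 'm::finite)" where
  "join_pair v \<equiv> vec_join (fst v) (snd v)"

lemma linear_join_pair: "linear (join_pair :: (complex ^ 'k) \<times> (complex ^ 'm) \<Rightarrow> complex ^ ('k::finite + 'm::finite))"
  by (rule linearI) (simp_all add: vec_join_add vec_join_scaleR)

lemma lborel_join_pair:
  "distr lborel borel (join_pair :: (complex ^ 'k) \<times> (complex ^ 'm) \<Rightarrow> complex ^ ('k::finite + 'm::finite)) = lborel"
proof (rule lborel_distr_isometry[OF linear_join_pair])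
  show "norm (join_pair v) = norm v" for v :: "(complex ^ 'k) \<times> (complex ^ 'm)"
  proof -
    have "norm v = sqrt ((norm (fst v))\<^sup>2 + (norm (snd v))\<^sup>2)" by (cases v) (simp add: norm_Pair)
    then show ?thesis by (metis norm_vec_join norm_ge_zero real_sqrt_unique)
  qed
  show "surj (join_pair :: (complex ^ 'k) \<times> (complex ^ 'm) \<Rightarrow> complex ^ ('k + 'm))"
    by (rule surjI[where f = "\<lambda>v. (vec_left v, vec_right v)"]) simp
qed (simp add: algebra_simps)

lemma continuous_on_join_pair: "continuous_on S (join_pair :: (complex ^ 'k) \<times> (complex ^ 'm) \<Rightarrow> complex ^ ('k::finite + 'm::finite))"
  by (intro linear_continuous_on linear_conv_bounded_linear[THEN iffD1] linear_join_pair)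

lemma mem_hartogs_ball: "v \<in> hartogs_ball \<mu> \<longleftrightarrow> (vec_left v, vec_right v) \<in> hartogs_pairs \<mu>"
  unfolding hartogs_ball_def hartogs_pairs_def by (force intro: exI[of _ "vec_left v"] simp flip: vec_join_left_right)

lemma join_mem_hartogs_ball: "vec_join z Z \<in> hartogs_ball \<mu> \<longleftrightarrow> (z, Z) \<in> hartogs_pairs \<mu>"
  by (simp add: mem_hartogs_ball)

lemma open_hartogs_ball: "open (hartogs_ball \<mu> :: (complex ^ (4 + 'm::finite)) set)"
proof -
  have "hartogs_ball \<mu> = (\<lambda>v :: complex ^ (4 + 'm). (vec_left v, vec_right v)) -` hartogs_pairs \<mu>"
    by (auto simp: mem_hartogs_ball)
  also have "open \<dots>"
    by (intro open_vimage open_hartogs_pairs continuous_intros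
        linear_continuous_on bounded_linear_vec_left bounded_linear_vec_right)
  finally show ?thesis .
qed

lemma zero_mem_hartogs_ball: "0 \<in> (hartogs_ball \<mu> :: (complex ^ (4 + 'm::finite)) set)"
  by (simp add: mem_hartogs_ball hartogs_pairs_def vec_left_def vec_right_def zero_vec_def[symmetric])

lemma connected_hartogs_ball:
  assumes \<mu>: "\<mu> > 0"
  shows "connected (hartogs_ball \<mu> :: (complex ^ (4 + 'm::finite)) set)"
proof (rule starlike_imp_connected, unfold starlike_def, intro bexI[OF _ zero_mem_hartogs_ball] ballI subsetI)
  fix v x :: "complex ^ (4 + 'm)"
  assume v: "v \<in> hartogs_ball \<mu>" and "x \<in> closed_segment 0 v"
  then obtain u where u: "0 \<le> u" "u \<le> 1" "x = u *\<^sub>R v"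
    by (auto simp: closed_segment_def)
  define z where "z = vec_left v"
  define Z where "Z = vec_right v"
  have zZ: "norm z < 1" "(norm Z)\<^sup>2 < (1 - (norm z)\<^sup>2) powr \<mu>"
    using v by (simp_all add: mem_hartogs_ball hartogs_pairs_def z_def Z_def)
  have x: "vec_left x = u *\<^sub>R z" "vec_right x = u *\<^sub>R Z"
    by (simp_all add: u z_def Z_def linear_scale bounded_linear.linear bounded_linear_vec_left bounded_linear_vec_right)
  have le: "norm (u *\<^sub>R y) \<le> norm y" for y :: "complex ^ 'k"
    using u mult_right_mono[of u 1 "norm y"] by simp
  have "(norm (u *\<^sub>R Z))\<^sup>2 \<le> (norm Z)\<^sup>2" by (intro power_mono le) auto
  also have "\<dots> < (1 - (norm z)\<^sup>2) powr \<mu>" by (rule zZ)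
  also have "\<dots> \<le> (1 - (norm (u *\<^sub>R z))\<^sup>2) powr \<mu>"
    using \<mu> one_minus_norm_sq_pos[OF zZ(1)] power_mono[OF le norm_ge_zero, of z 2] by (intro powr_mono2) auto
  finally show "x \<in> hartogs_ball \<mu>"
    using le_less_trans[OF le zZ(1)] by (simp add: mem_hartogs_ball hartogs_pairs_def x)
qed

section \<open>The Bergman kernel\<close>

definition complex_diff :: "(complex ^ 'n \<Rightarrow> complex) \<Rightarrow> complex ^ 'n \<Rightarrow> bool" where
  "complex_diff f z \<longleftrightarrow> (\<exists>f'. (f has_derivative f') (at z) \<and> (\<forall>c v. f' (c *s v) = c * f' v))"

lemma complex_diff_mult:
  assumes "complex_diff f z" "complex_diff g z"
  shows "complex_diff (\<lambda>v. f v * g v) z"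
proof -
  obtain f' g' where "(f has_derivative f') (at z)" "(g has_derivative g') (at z)"
    "\<forall>c v. f' (c *s v) = c * f' v" "\<forall>c v. g' (c *s v) = c * g' v"
    using assms by (auto simp: complex_diff_def)
  then show ?thesis
    unfolding complex_diff_def
    by (intro exI[of _ "\<lambda>v. f z * g' v + f' v * g z"] conjI has_derivative_mult) (auto simp: algebra_simps)
qed

lemma complex_diff_compose:
  assumes "complex_diff f z" "g field_differentiable at (f z)"
  shows "complex_diff (\<lambda>v. g (f v)) z"
proof -
  obtain f' where f: "(f has_derivative f') (at z)" "\<forall>c v. f' (c *s v) = c * f' v"
    using assms by (auto simp: complex_diff_def)
  obtain d where "(g has_field_derivative d) (at (f z))"
    using assms by (auto simp: field_differentiable_def)
  then have "(g has_derivative (*) d) (at (f z))"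
    by (simp add: has_field_derivative_def)
  from has_derivative_compose[OF f(1) this] f(2) show ?thesis
    unfolding complex_diff_def by (intro exI[of _ "\<lambda>v. d * f' v"]) auto
qed

lemma complex_diff_linear:
  assumes "bounded_linear f" "\<And>c v. f (c *s v) = c * f v"
  shows "complex_diff f z"
  unfolding complex_diff_def using assms bounded_linear_imp_has_derivative by blast

lemma holomorphic_several_continuous_on:
  assumes "holomorphic_several f U"
  shows "continuous_on U f"
proof (rule continuous_at_imp_continuous_on, rule ballI)
  fix z assume "z \<in> U"
  then obtain f' where "(f has_derivative f') (at z)"
    using assms unfolding holomorphic_several_def by blast
  then show "isCont f z" by (rule has_derivative_continuous)
qed

lemma holomorphic_several_line:
  assumes "holomorphic_several f U"
  shows "(\<lambda>c. f (p + c *s q)) holomorphic_on {c. p + c *s q \<in> U}"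
  unfolding holomorphic_on_def
proof (rule ballI, rule field_differentiable_at_within)
  fix c assume "c \<in> {c. p + c *s q \<in> U}"
  then obtain f' where f: "(f has_derivative f') (at (p + c *s q))" "\<forall>c v. f' (c *s v) = c * f' v"
    using assms unfolding holomorphic_several_def by blast
  have "((\<lambda>c. p + c *s q) has_derivative (\<lambda>h. 0 + h *s q)) (at c)"
    by (intro has_derivative_add has_derivative_const bounded_linear_imp_has_derivative bounded_linear_cmult_vec_left)
  then have "((\<lambda>c. p + c *s q) has_derivative (\<lambda>h. h *s q)) (at c)"
    by (simp only: add_0_left)
  from has_derivative_compose[OF this f(1)]
  have "((\<lambda>c. f (p + c *s q)) has_derivative (\<lambda>h. f' (h *s q))) (at c)" .
  also have "(\<lambda>h. f' (h *s q)) = (*) (f' q)"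
    by (rule ext) (simp only: f(2)[rule_format] mult.commute)
  finally have "((\<lambda>c. f (p + c *s q)) has_derivative (*) (f' q)) (at c)" .
  then show "(\<lambda>c. f (p + c *s q)) field_differentiable at c"
    by (auto simp: field_differentiable_def has_field_derivative_def)
qed

definition hartogs_kernel :: "real \<Rightarrow> complex ^ (4 + 'm::finite) \<Rightarrow> complex ^ (4 + 'm) \<Rightarrow> complex" where
  "hartogs_kernel \<mu> v w = kernel_value TYPE('m) \<mu> (herm (vec_left v) (vec_left w)) (herm (vec_right v) (vec_right w))"

lemma cnj_kernel_profile: "cnj (kernel_profile M \<mu> t) = kernel_profile M \<mu> (cnj t)"
  by (simp add: kernel_profile_def P_complex_def)

lemma cnj_hartogs_kernel:
  fixes v w :: "complex ^ (4 + 'm::finite)"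
  assumes v: "v \<in> hartogs_ball \<mu>" and w: "w \<in> hartogs_ball \<mu>" and \<mu>: "\<mu> > 0"
  shows "cnj (hartogs_kernel \<mu> v w) = hartogs_kernel \<mu> w v"
proof -
  let ?x = "herm (vec_left v) (vec_left w)"
  have "cmod ?x < 1"
    by (rule hartogs_pairs_bounds(1)[OF w[unfolded mem_hartogs_ball] v[unfolded mem_hartogs_ball] \<mu>])
  then have "Re ?x < 1" using complex_Re_le_cmod[of ?x] by linarith
  then have "cnj ((1 - ?x) powr a) = (1 - herm (vec_left w) (vec_left v)) powr cnj a" for a
    by (subst cnj_powr) (simp_all add: cnj_herm)
  then show ?thesis
    by (simp add: hartogs_kernel_def kernel_value_def cnj_kernel_profile cnj_herm)
qed

lemma complex_diff_hartogs_kernel: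
  fixes v w :: "complex ^ (4 + 'm::finite)"
  assumes v: "v \<in> hartogs_ball \<mu>" and w: "w \<in> hartogs_ball \<mu>" and \<mu>: "\<mu> > 0"
  shows "complex_diff (\<lambda>v. hartogs_kernel \<mu> v w) v"
proof -
  note vw = v[unfolded mem_hartogs_ball] w[unfolded mem_hartogs_ball]
  let ?x = "\<lambda>v. herm (vec_left v) (vec_left w)" and ?y = "\<lambda>v. herm (vec_right v) (vec_right w)"
  have x: "complex_diff ?x v" and y: "complex_diff ?y v"
    by (intro complex_diff_linear bounded_linear_compose[OF bounded_linear_herm] bounded_linear_vec_left
        bounded_linear_vec_right; simp add: vec_left_right_cmult)+
  have "cmod (?x v) < 1" by (rule hartogs_pairs_bounds(1)[OF vw(2,1) \<mu>])
  then have "Re (?x v) < 1" using complex_Re_le_cmod[of "?x v"] by linarith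
  then have pos: "1 - ?x v \<notin> \<real>\<^sub>\<le>\<^sub>0" by (simp add: complex_nonpos_Reals_iff)
  have powr: "complex_diff (\<lambda>v. (1 - ?x v) powr a) v" for a
  proof (rule complex_diff_compose[OF x])
    show "(\<lambda>x. (1 - x) powr a) field_differentiable at (?x v)"
      unfolding field_differentiable_def using pos by (auto intro!: exI derivative_eq_intros)
  qed
  have "cmod (?y v * (1 - ?x v) powr (- of_real \<mu>)) < 1"
    by (rule kernel_term_sums(2)[OF vw(2,1) \<mu>])
  then have "kernel_profile TYPE('m) \<mu> field_differentiable at (?y v * (1 - ?x v) powr (- of_real \<mu>))"
    by (intro holomorphic_on_imp_differentiable_at[OF holomorphic_kernel_profile]) auto
  then show ?thesis
    unfolding hartogs_kernel_def kernel_value_def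
    by (intro complex_diff_mult powr complex_diff_compose[where g = "kernel_profile TYPE('m) \<mu>"] y)
qed

lemma finite_measure_hartogs_ball:
  "integrable lborel (indicator (hartogs_ball \<mu> :: (complex ^ (4 + 'm::finite)) set) :: _ \<Rightarrow> real)" if "\<mu> > 0"
proof -
  have "hartogs_ball \<mu> \<subseteq> (ball 0 2 :: (complex ^ (4 + 'm)) set)"
  proof
    fix v :: "complex ^ (4 + 'm)" assume v: "v \<in> hartogs_ball \<mu>"
    then have "norm (vec_left v) < 1" "norm (vec_right v) < 1"
      using hartogs_pairs_bounds(2)[of "vec_left v" "vec_right v" \<mu>] that
      by (auto simp: mem_hartogs_ball hartogs_pairs_def)
    moreover have "(norm v)\<^sup>2 = (norm (vec_left v))\<^sup>2 + (norm (vec_right v))\<^sup>2"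
      using norm_vec_join[of "vec_left v" "vec_right v"] by simp
    ultimately have "(norm v)\<^sup>2 < 2\<^sup>2"
      using abs_square_less_1[of "norm (vec_left v)"] abs_square_less_1[of "norm (vec_right v)"] by simp
    then show "v \<in> ball 0 2" using power2_less_imp_less[of "norm v" 2] by simp
  qed
  then have "emeasure lborel (hartogs_ball \<mu> :: (complex ^ (4 + 'm)) set) \<le> emeasure lborel (ball (0 :: complex ^ (4 + 'm)) 2)"
    by (intro emeasure_mono) auto
  also have "\<dots> < \<infinity>" by (simp add: emeasure_ball)
  finally show ?thesis
    using open_hartogs_ball[of \<mu>, where 'm = 'm] by (intro integrable_real_indicator) auto
qed

lemma hartogs_kernel_in_bergman_space:
  fixes w :: "complex ^ (4 + 'm::finite)"
  assumes w: "w \<in> hartogs_ball \<mu>" and \<mu>: "\<mu> > 0"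
  shows "(\<lambda>v. hartogs_kernel \<mu> v w) \<in> bergman_space (hartogs_ball \<mu>)"
proof -
  let ?K = "\<lambda>v. hartogs_kernel \<mu> v w"
  let ?U = "hartogs_ball \<mu> :: (complex ^ (4 + 'm)) set"
  have hol: "holomorphic_several ?K ?U"
    unfolding holomorphic_several_def complex_diff_def[symmetric]
    using complex_diff_hartogs_kernel[OF _ w \<mu>] by blast
  obtain C where C': "\<And>z Z. (z, Z) \<in> hartogs_pairs \<mu> \<Longrightarrow>
      cmod (kernel_value TYPE('m) \<mu> (herm (vec_left w) z) (herm (vec_right w) Z)) \<le> C"
    using kernel_value_bounded[OF w[unfolded mem_hartogs_ball] \<mu>] by blast
  have C: "cmod (?K v) \<le> C" if "v \<in> ?U" for v
  proof -
    have "cmod (?K v) = cmod (cnj (?K v))" by simp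
    also have "\<dots> = cmod (hartogs_kernel \<mu> w v)" by (simp only: cnj_hartogs_kernel[OF that w \<mu>])
    also have "\<dots> \<le> C" using C'[OF that[unfolded mem_hartogs_ball]] by (simp add: hartogs_kernel_def)
    finally show ?thesis .
  qed
  have "set_integrable lborel ?U (\<lambda>v. (cmod (?K v))\<^sup>2)"
    unfolding set_integrable_def
  proof (rule Bochner_Integration.integrable_bound)
    show "integrable lborel (\<lambda>v. C\<^sup>2 * indicator ?U v)"
      by (intro integrable_mult_right finite_measure_hartogs_ball \<mu>)
    show "(\<lambda>v. indicator ?U v *\<^sub>R (cmod (?K v))\<^sup>2) \<in> borel_measurable lborel"
      unfolding measurable_lborel2
      by (intro borel_measurable_continuous_on_indicator borel_open open_hartogs_ball continuous_intros
          holomorphic_several_continuous_on hol)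
    have "norm (indicator ?U v *\<^sub>R (cmod (?K v))\<^sup>2) \<le> norm (C\<^sup>2 * indicator ?U v)" for v
      using power_mono[OF C, of v 2] by (cases "v \<in> ?U") auto
    then show "AE v in lborel. norm (indicator ?U v *\<^sub>R (cmod (?K v))\<^sup>2) \<le> norm (C\<^sup>2 * indicator ?U v)"
      by simp
  qed
  with hol show ?thesis by (simp add: bergman_space_def)
qed

text \<open>
Bergman functions are integrable because the domain has finite volume, so the formula on pairs applies after
transport along the isometry \<open>join_pair\<close>.
\<close>

lemma hartogs_kernel_reproducing:
  fixes w :: "complex ^ (4 + 'm::finite)"
  assumes f: "f \<in> bergman_space (hartogs_ball \<mu>)" and w: "w \<in> hartogs_ball \<mu>" and \<mu>: "\<mu> > 0"
  shows "(LINT v:hartogs_ball \<mu>|lborel. f v * cnj (hartogs_kernel \<mu> v w)) = f w"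
proof -
  let ?U = "hartogs_ball \<mu> :: (complex ^ (4 + 'm)) set"
  let ?H = "hartogs_pairs \<mu> :: ((complex ^ 4) \<times> (complex ^ 'm)) set"
  let ?J = "join_pair :: (complex ^ 4) \<times> (complex ^ 'm) \<Rightarrow> complex ^ (4 + 'm)"
  have [measurable]: "?J \<in> borel_measurable borel"
    by (intro borel_measurable_continuous_onI continuous_on_join_pair)
  have [measurable]: "?U \<in> sets borel" by (intro borel_open open_hartogs_ball)
  have hol: "holomorphic_several f ?U" and sq: "set_integrable lborel ?U (\<lambda>z. (cmod (f z))\<^sup>2)"
    using f by (auto simp: bergman_space_def)
  have contf: "continuous_on ?U f" by (rule holomorphic_several_continuous_on[OF hol])
  have meas: "(\<lambda>v. indicator ?U v *\<^sub>R f v) \<in> borel_measurable borel"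
    by (intro borel_measurable_continuous_on_indicator contf) measurable
  have "integrable lborel (\<lambda>v. indicator ?U v *\<^sub>R f v)"
  proof (rule Bochner_Integration.integrable_bound)
    show "integrable lborel (\<lambda>v. indicator ?U v + indicator ?U v *\<^sub>R (cmod (f v))\<^sup>2)"
      using sq by (intro Bochner_Integration.integrable_add finite_measure_hartogs_ball \<mu>) (simp add: set_integrable_def)
    have "cmod (f v) \<le> 1 + (cmod (f v))\<^sup>2" for v
      using sum_power2_ge_zero[of "cmod (f v) - 1" 0] by (simp add: power2_eq_square algebra_simps) (smt (verit) norm_ge_zero)
    then show "AE v in lborel. norm (indicator ?U v *\<^sub>R f v) \<le> norm (indicator ?U v + indicator ?U v *\<^sub>R (cmod (f v))\<^sup>2)"
      by (auto simp: indicator_def)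
  qed (use meas in simp)
  then have "integrable (distr lborel borel ?J) (\<lambda>v. indicator ?U v *\<^sub>R f v)"
    by (simp add: lborel_join_pair)
  then have "integrable lborel (\<lambda>v. indicator ?U (?J v) *\<^sub>R f (?J v))"
    by (subst (asm) integrable_distr_eq) (use meas in auto)
  moreover have ind: "indicator ?U (?J v) = (indicator ?H v :: real)" for v
    by (simp add: indicator_def join_mem_hartogs_ball)
  ultimately have int: "set_integrable lborel ?H (\<lambda>v. f (?J v))"
    by (simp only: set_integrable_def)
  have cont: "continuous_on ?H (\<lambda>v. f (?J v))"
    by (rule continuous_on_compose2[OF contf continuous_on_join_pair]) (auto simp: join_mem_hartogs_ball)
  have line: "(\<lambda>c. f (?J (a + c *s b, A + c *s B))) holomorphic_on {c. (a + c *s b, A + c *s B) \<in> ?H}" for a b A B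
    using holomorphic_several_line[OF hol, of "vec_join a A" "vec_join b B"]
    by (simp add: vec_join_add vec_join_cmult join_mem_hartogs_ball flip: vec_join_add vec_join_cmult)
  have eq: "indicator ?U v *\<^sub>R (f v * cnj (hartogs_kernel \<mu> v w)) = indicator ?U v *\<^sub>R (f v * hartogs_kernel \<mu> w v)" for v
    by (cases "v \<in> ?U") (simp_all add: cnj_hartogs_kernel[OF _ w \<mu>])
  have "(\<lambda>v. hartogs_kernel \<mu> v w) \<in> bergman_space ?U"
    by (rule hartogs_kernel_in_bergman_space[OF w \<mu>])
  then have "continuous_on ?U (\<lambda>v. f v * cnj (hartogs_kernel \<mu> v w))"
    by (intro continuous_intros contf holomorphic_several_continuous_on) (simp add: bergman_space_def)
  then have meas2: "(\<lambda>v. indicator ?U v *\<^sub>R (f v * cnj (hartogs_kernel \<mu> v w))) \<in> borel_measurable borel"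
    by (intro borel_measurable_continuous_on_indicator) measurable
  have "(LINT v:?U|lborel. f v * cnj (hartogs_kernel \<mu> v w))
      = (\<integral>v. indicator ?U v *\<^sub>R (f v * hartogs_kernel \<mu> w v) \<partial>distr lborel borel ?J)"
    unfolding set_lebesgue_integral_def lborel_join_pair eq ..
  also have "\<dots> = (\<integral>v. indicator ?U (?J v) *\<^sub>R (f (?J v) * hartogs_kernel \<mu> w (?J v)) \<partial>lborel)"
    by (rule integral_distr[OF _ meas2[unfolded eq]]) measurable
  also have "\<dots> = (LINT v:?H|lborel. f (?J v) * kernel_value TYPE('m) \<mu> (herm (vec_left w) (fst v)) (herm (vec_right w) (snd v)))"
    unfolding ind set_lebesgue_integral_def by (simp add: hartogs_kernel_def)
  also have "\<dots> = f (?J (vec_left w, vec_right w))"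
    by (rule kernel_value_reproducing[OF \<mu> cont line int w[unfolded mem_hartogs_ball]])
  finally show ?thesis by simp
qed

text \<open>
For uniqueness, testing two reproducing functions \<open>k\<close> (at \<open>w\<close>) and
\<open>K(\<sqdot>, z)\<close> (at \<open>z\<close>) against each other gives \<open>k z = cnj (K(w, z))\<close>.
\<close>

theorem bergman_kernel_hartogs_ball:
  fixes z w :: "complex ^ (4 + 'm::finite)"
  assumes z: "z \<in> hartogs_ball \<mu>" and w: "w \<in> hartogs_ball \<mu>" and \<mu>: "\<mu> > 0"
  shows "bergman_kernel (hartogs_ball \<mu>) z w = hartogs_kernel \<mu> z w"
  unfolding bergman_kernel_def
proof (rule the_equality)
  let ?U = "hartogs_ball \<mu> :: (complex ^ (4 + 'm)) set"
  show "\<exists>k\<in>bergman_space ?U. (\<forall>f\<in>bergman_space ?U. f w = (LINT x:?U|lborel. f x * cnj (k x))) \<and> hartogs_kernel \<mu> z w = k z"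
    using hartogs_kernel_in_bergman_space[OF w \<mu>] hartogs_kernel_reproducing[OF _ w \<mu>]
    by (intro bexI[of _ "\<lambda>v. hartogs_kernel \<mu> v w"]) auto
  fix c assume "\<exists>k\<in>bergman_space ?U. (\<forall>f\<in>bergman_space ?U. f w = (LINT x:?U|lborel. f x * cnj (k x))) \<and> c = k z"
  then obtain k where k: "k \<in> bergman_space ?U"
    and rep: "\<And>f. f \<in> bergman_space ?U \<Longrightarrow> f w = (LINT x:?U|lborel. f x * cnj (k x))" and c: "c = k z"
    by blast
  have "hartogs_kernel \<mu> w z = (LINT x:?U|lborel. hartogs_kernel \<mu> x z * cnj (k x))"
    by (rule rep[OF hartogs_kernel_in_bergman_space[OF z \<mu>]])
  also have "\<dots> = (LINT x:?U|lborel. cnj (k x * cnj (hartogs_kernel \<mu> x z)))"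
    by (simp add: mult.commute)
  also have "\<dots> = cnj (LINT x:?U|lborel. k x * cnj (hartogs_kernel \<mu> x z))"
    unfolding set_lebesgue_integral_def Bochner_Integration.integral_cnj[symmetric] complex_cnj_scaleR ..
  also have "\<dots> = cnj (k z)"
    by (simp only: hartogs_kernel_reproducing[OF k z \<mu>])
  finally have "k z = cnj (hartogs_kernel \<mu> w z)" by simp
  then show "c = hartogs_kernel \<mu> z w"
    by (simp add: c cnj_hartogs_kernel[OF w z \<mu>])
qed

text \<open>
Every \<open>t\<close> in the unit disc occurs already over the centre \<open>z = w = 0\<close> of the base, where \<open>t = \<langle>Z, W\<rangle>\<close>; and
\<open>\<bar>t\<bar> < 1\<close> means \<open>\<bar>\<eta> - 1\<bar> < \<bar>\<eta>\<bar>\<close> for \<open>\<eta> = 1 / (1 - t)\<close>.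
\<close>

theorem lu_qikeng_hartogs_ball_iff:
  assumes \<mu>: "\<mu> > 0"
  shows "lu_qikeng_domain (hartogs_ball \<mu> :: (complex ^ (4 + 'm::finite)) set) \<longleftrightarrow>
     (\<forall>\<eta>. Re \<eta> > 1/2 \<longrightarrow> P_complex CARD('m) \<mu> \<eta> \<noteq> 0)"
proof -
  let ?U = "hartogs_ball \<mu> :: (complex ^ (4 + 'm)) set"
  have zero: "kernel_profile TYPE('m) \<mu> t = 0 \<longleftrightarrow> P_complex CARD('m) \<mu> (1 / (1 - t)) = 0" if "cmod t < 1" for t
  proof -
    have "kernel_scale TYPE('m) > 0"
      unfolding kernel_scale_def by (intro mult_pos_pos gauss_mass_pos)
    then show ?thesis using that by (auto simp: kernel_profile_def)
  qed
  have "(\<forall>z\<in>?U. \<forall>w\<in>?U. bergman_kernel ?U z w \<noteq> 0) \<longleftrightarrow> (\<forall>t. cmod t < 1 \<longrightarrow> kernel_profile TYPE('m) \<mu> t \<noteq> 0)"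
  proof (intro iffI allI impI ballI)
    fix z w assume nz: "\<forall>t. cmod t < 1 \<longrightarrow> kernel_profile TYPE('m) \<mu> t \<noteq> 0" and zw: "z \<in> ?U" "w \<in> ?U"
    note p = zw[unfolded mem_hartogs_ball]
    have "1 - herm (vec_left z) (vec_left w) \<noteq> 0"
      using hartogs_pairs_bounds(1)[OF p(2,1) \<mu>] by auto
    then show "bergman_kernel ?U z w \<noteq> 0"
      using nz kernel_term_sums(2)[OF p(2,1) \<mu>]
      by (simp add: bergman_kernel_hartogs_ball[OF zw \<mu>] hartogs_kernel_def kernel_value_def)
  next
    fix t :: complex assume nz: "\<forall>z\<in>?U. \<forall>w\<in>?U. bergman_kernel ?U z w \<noteq> 0" and t: "cmod t < 1"
    obtain e :: "complex ^ 'm" where e: "norm e = 1" using vector_choose_size[of 1] by auto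
    define r where "r = sqrt (cmod t)"
    \<comment> \<open>Both \<open>Z = \<sigma> e\<close> and \<open>W = r e\<close> have norm at most \<open>sqrt \<bar>t\<bar>\<close>, and \<open>\<langle>Z, W\<rangle> = t\<close>.\<close>
    define \<sigma> where "\<sigma> = (if t = 0 then 0 else t / of_real r)"
    have r: "0 \<le> r" "r < 1" "r * r = cmod t" using t by (auto simp: r_def real_sqrt_lt_1_iff)
    have \<sigma>: "\<sigma> * of_real r = t" by (auto simp: \<sigma>_def r_def)
    have "cmod \<sigma> \<le> r" using r(1) by (auto simp: \<sigma>_def norm_divide r(3)[symmetric])
    then have "cmod \<sigma> < 1" using r by linarith
    then have "vec_join 0 (\<sigma> *s e) \<in> ?U" "vec_join 0 (of_real r *s e) \<in> ?U"
      using e r by (auto simp: join_mem_hartogs_ball hartogs_pairs_def abs_square_less_1)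
    with nz have "hartogs_kernel \<mu> (vec_join 0 (\<sigma> *s e) :: complex ^ (4 + 'm)) (vec_join 0 (of_real r *s e)) \<noteq> 0"
      using bergman_kernel_hartogs_ball[OF _ _ \<mu>] by metis
    then show "kernel_profile TYPE('m) \<mu> t \<noteq> 0"
      using e \<sigma> by (simp add: hartogs_kernel_def kernel_value_def herm_self mult.commute mult.left_commute)
  qed
  also have "\<dots> \<longleftrightarrow> (\<forall>t. cmod t < 1 \<longrightarrow> P_complex CARD('m) \<mu> (1 / (1 - t)) \<noteq> 0)"
    using zero by blast
  also have "\<dots> \<longleftrightarrow> (\<forall>\<eta>. Re \<eta> > 1/2 \<longrightarrow> P_complex CARD('m) \<mu> \<eta> \<noteq> 0)"
  proof (intro iffI allI impI)
    have half_plane: "cmod t < 1 \<longleftrightarrow> Re \<eta> > 1/2" if "\<eta> * (1 - t) = 1" for t \<eta> :: complex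
    proof -
      have nz: "\<eta> \<noteq> 0" using that by auto
      have "t = (\<eta> - 1) / \<eta>" using that nz by (simp add: field_simps)
      then have "cmod t < 1 \<longleftrightarrow> cmod (\<eta> - 1) < cmod \<eta>" using nz by (simp add: norm_divide)
      also have "\<dots> \<longleftrightarrow> (cmod (\<eta> - 1))\<^sup>2 < (cmod \<eta>)\<^sup>2"
        by (metis norm_ge_zero power2_less_imp_less power_strict_mono pos2)
      also have "\<dots> \<longleftrightarrow> Re \<eta> > 1/2"
        by (simp add: cmod_power2) (simp add: power2_eq_square algebra_simps)
      finally show ?thesis .
    qed
    show "P_complex CARD('m) \<mu> \<eta> \<noteq> 0"
      if *: "\<forall>t. cmod t < 1 \<longrightarrow> P_complex CARD('m) \<mu> (1 / (1 - t)) \<noteq> 0" and \<eta>: "Re \<eta> > 1/2" for \<eta>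
    proof -
      have "\<eta> \<noteq> 0" using \<eta> by auto
      then have "cmod (1 - 1 / \<eta>) < 1" using half_plane[of \<eta> "1 - 1 / \<eta>"] \<eta> by simp
      with * have "P_complex CARD('m) \<mu> (1 / (1 - (1 - 1 / \<eta>))) \<noteq> 0" by blast
      then show ?thesis by simp
    qed
    show "P_complex CARD('m) \<mu> (1 / (1 - t)) \<noteq> 0"
      if *: "\<forall>\<eta>. Re \<eta> > 1/2 \<longrightarrow> P_complex CARD('m) \<mu> \<eta> \<noteq> 0" and t: "cmod t < 1" for t
    proof -
      have "t \<noteq> 1" using t by auto
      then show ?thesis using half_plane[of "1 / (1 - t)" t] t * by simp
    qed
  qed
  finally show ?thesis
    using open_hartogs_ball[of \<mu>, where 'm = 'm] connected_hartogs_ball[OF \<mu>, where 'm = 'm]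
      zero_mem_hartogs_ball[of \<mu>, where 'm = 'm] unfolding lu_qikeng_domain_def by blast
qed

section \<open>Quartics without zeros in the right half plane\<close>

lemma Re_inverse_pos: "Re (inverse y) > 0" if "Re y > 0"
proof -
  have "y \<noteq> 0" using that by auto
  then have "(Re y)\<^sup>2 + (Im y)\<^sup>2 > 0" by (simp add: complex_neq_0)
  then show ?thesis using that by simp
qed

text \<open>
Stieltjes' form of the Routh-Hurwitz criterion. The quotients in the continued fraction of the even and
odd parts have nonnegative coefficients under the hypotheses, so its partial values \<open>y\<close> and \<open>z\<close> have positive real
part at \<open>\<xi>\<close>. The quartic is \<open>\<xi> y (z r + 1)\<close> with \<open>Re r > 0\<close>, and \<open>z r = -1\<close> is impossible since
\<open>- 1 / z\<close> has negative real part. Nonstrict bounds on \<open>b0\<close> and on the third minor admit the boundary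
case of a root on the imaginary axis.
\<close>

lemma quartic_no_root_right_half_plane:
  fixes b0 b1 b2 b3 b4 :: real and \<xi> :: complex
  assumes b0: "b0 \<ge> 0" and b3: "b3 > 0" and b4: "b4 \<ge> 0"
    and minor2: "b2 * b3 - b1 * b4 > 0"
    and minor3: "b1 * (b2 * b3 - b1 * b4) - b0 * b3\<^sup>2 \<ge> 0"
    and \<xi>: "Re \<xi> > 0"
  shows "b0 + b1 * \<xi> + b2 * \<xi>^2 + b3 * \<xi>^3 + b4 * \<xi>^4 \<noteq> 0"
proof -
  define c where "c = (b2 * b3 - b1 * b4) / b3"
  \<comment> \<open>the coefficients left after two division steps of the continued fraction\<close>
  define d where "d = (b1 * (b2 * b3 - b1 * b4) - b0 * b3\<^sup>2) / (b2 * b3 - b1 * b4)"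
  have c: "c > 0" and d: "d \<ge> 0"
    using b3 minor2 minor3 by (auto simp: c_def d_def)
  define \<xi>' where "\<xi>' = inverse \<xi>"
  define y where "y = of_real c * \<xi> + of_real b0 * \<xi>'"
  define y' where "y' = inverse y"
  define z where "z = of_real (b3 / c) * \<xi> + of_real d * y'"
  define r where "r = 1 + of_real (b4 / b3) * \<xi>"
  have nz: "\<xi> \<noteq> 0" using \<xi> by auto
  have y: "Re y > 0"
    using c b0 \<xi> less_imp_le[OF Re_inverse_pos[OF \<xi>]] unfolding y_def \<xi>'_def[symmetric] by (simp add: add_pos_nonneg)
  have z: "Re z > 0"
    using c b3 d \<xi> less_imp_le[OF Re_inverse_pos[OF y]] unfolding z_def y'_def[symmetric] by (simp add: add_pos_nonneg)
  have r: "Re r > 0"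
    using b3 b4 \<xi> unfolding r_def by (simp add: add_pos_nonneg)
  have ynz: "y \<noteq> 0" using y by auto
  have b1: "b1 = d + b3 * b0 / c" and b2: "b2 = c + b4 * b1 / b3"
  proof -
    have "b1 = (b1 * N - b0 * b3\<^sup>2) / N + b3 * b0 / (N / b3)" if "N > 0" for N
      using b3 that by (simp add: field_simps power2_eq_square)
    from this[OF minor2] show "b1 = d + b3 * b0 / c" unfolding c_def d_def .
    show "b2 = c + b4 * b1 / b3" using b3 by (simp add: c_def field_simps)
  qed
  have "\<xi> * y * (z * r + 1) = b0 + b1 * \<xi> + b2 * \<xi>^2 + b3 * \<xi>^3 + b4 * \<xi>^4"
  proof -
    have 1: "\<xi> * y = of_real c * \<xi>\<^sup>2 + of_real b0"
      using nz by (simp add: y_def \<xi>'_def field_simps power2_eq_square)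
    have 2: "y * z = of_real b3 * \<xi>\<^sup>2 + of_real (b3 * b0 / c) + of_real d"
    proof -
      have "y * \<xi> = of_real c * \<xi>\<^sup>2 + of_real b0" using 1 by (simp add: mult.commute)
      moreover have "y * y' = 1" using ynz by (simp add: y'_def)
      ultimately have "y * z = of_real (b3 / c) * (of_real c * \<xi>\<^sup>2 + of_real b0) + of_real d"
        unfolding z_def by (simp only: distrib_left mult.left_commute[of y] mult_1_right)
      then show ?thesis using c by (simp add: field_simps)
    qed
    have "\<xi> * y * (z * r + 1) = \<xi> * (y * z) * r + \<xi> * y" by (simp add: algebra_simps)
    also have "\<dots> = b0 + (d + b3 * b0 / c) * \<xi> + (c + b4 * (d + b3 * b0 / c) / b3) * \<xi>^2 + b3 * \<xi>^3 + b4 * \<xi>^4"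
      unfolding 1 2 r_def using b3 c by (simp add: field_simps power2_eq_square power3_eq_cube power4_eq_xxxx)
    finally show ?thesis using b1 b2 by simp
  qed
  moreover have "z * r + 1 \<noteq> 0"
  proof
    assume "z * r + 1 = 0"
    then have "z * r = - 1" by (simp add: add_eq_0_iff2)
    moreover have "z \<noteq> 0" using z by auto
    ultimately have "r = - inverse z" by (simp add: field_simps)
    then show False using r Re_inverse_pos[OF z] by simp
  qed
  ultimately show ?thesis using nz ynz by (metis mult_eq_0_iff)
qed

text \<open>
The logarithmic derivative is the sum of the \<open>1 / (x - a)\<close>, each with positive real part.
\<close>

lemma log_derivative_roots:
  fixes A :: "complex multiset" and x :: real
  assumes "\<And>a. a \<in># A \<Longrightarrow> Re a \<le> 0" and x: "x > 0"
  shows "poly (\<Prod>a\<in>#A. [:- a, 1:]) (of_real x) \<noteq> 0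
    \<and> Re (poly (pderiv (\<Prod>a\<in>#A. [:- a, 1:])) (of_real x) / poly (\<Prod>a\<in>#A. [:- a, 1:]) (of_real x)) \<ge> 0"
  using assms(1)
proof (induction A)
  case (add a A)
  let ?Q = "\<Prod>a\<in>#A. [:- a, 1:]"
  have IH: "poly ?Q x \<noteq> 0" "Re (poly (pderiv ?Q) x / poly ?Q x) \<ge> 0"
    using add by auto
  have re: "Re (of_real x - a) > 0" using add.prems[of a] x by simp
  then have nz: "of_real x - a \<noteq> 0" by auto
  have "poly (pderiv ([:- a, 1:] * ?Q)) x / poly ([:- a, 1:] * ?Q) x
      = inverse (of_real x - a) + poly (pderiv ?Q) x / poly ?Q x"
    unfolding pderiv_mult poly_mult poly_add using IH(1) nz by (simp add: pderiv_pCons field_simps)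
  then show ?case
    using IH nz less_imp_le[OF Re_inverse_pos[OF re]] by simp
qed (simp)

text \<open>
Under the hypothesis \<open>p' / p \<ge> 0\<close> on the positive axis, where \<open>p\<close> has no zero and hence the sign of its
leading coefficient. So \<open>p\<close> and \<open>p'\<close> are nonnegative there, and by continuity at 0.
\<close>

lemma quartic_stable_coeffs_nonneg:
  fixes b0 b1 b2 b3 b4 :: real
  assumes b4: "b4 > 0"
    and stable: "\<And>\<xi> :: complex. Re \<xi> > 0 \<Longrightarrow> b0 + b1 * \<xi> + b2 * \<xi>^2 + b3 * \<xi>^3 + b4 * \<xi>^4 \<noteq> 0"
  shows "b0 \<ge> 0" "b1 \<ge> 0"
proof -
  define p where "p = [:b0, b1, b2, b3, b4:]"
  define q where "q = [:complex_of_real b0, of_real b1, of_real b2, of_real b3, of_real b4:]"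
  have eval: "poly q \<xi> = b0 + b1 * \<xi> + b2 * \<xi>^2 + b3 * \<xi>^3 + b4 * \<xi>^4" for \<xi> :: complex
    by (simp add: q_def algebra_simps power2_eq_square power3_eq_cube power4_eq_xxxx)
  have qp: "poly q (of_real x) = of_real (poly p x)" "poly (pderiv q) (of_real x) = of_real (poly (pderiv p) x)" for x
    by (simp_all add: p_def q_def pderiv_pCons)
  have "q \<noteq> 0" using b4 by (simp add: q_def)
  then obtain A where A: "q = smult (lead_coeff q) (\<Prod>x\<in>#A. [:- x, 1:])"
    using alg_closed_imp_factorization[of q] by metis
  have "Re a \<le> 0" if "a \<in># A" for a
  proof -
    have "poly (\<Prod>x\<in>#A. [:- x, 1:]) a = 0"
      using that by (auto simp: poly_prod_mset prod_mset_zero_iff image_iff)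
    then have "poly q a = 0" by (subst A) simp
    then show ?thesis using stable[of a] eval[of a] by force
  qed
  note roots = log_derivative_roots[OF this]
  have lq: "lead_coeff q \<noteq> 0" using \<open>q \<noteq> 0\<close> by simp
  have quot: "poly p x \<noteq> 0 \<and> poly (pderiv p) x / poly p x \<ge> 0" if x: "x > 0" for x
  proof -
    have "poly q x \<noteq> 0" "Re (poly (pderiv q) x / poly q x) \<ge> 0"
      using roots[OF _ x] lq by (subst A, simp, subst (1 2) A, simp add: pderiv_smult)
    then show ?thesis unfolding qp by (simp add: of_real_divide[symmetric] del: of_real_divide)
  qed
  have lead: "lead_coeff p = b4" using b4 by (simp add: p_def)
  obtain n where n: "\<And>x. x \<ge> n \<Longrightarrow> poly p x \<ge> b4"
    using poly_pinfty_gt_lc[of p] b4 lead by auto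
  have pos: "poly p x > 0" if x: "x > 0" for x
  proof (rule ccontr)
    assume "\<not> poly p x > 0"
    then have "poly p x < 0" using quot[OF x] by auto
    moreover have "poly p (max n (x + 1)) > 0" using n[of "max n (x + 1)"] b4 by auto
    moreover have "x < max n (x + 1)" by auto
    ultimately obtain t where "x < t" "poly p t = 0" using poly_IVT_pos by blast
    then show False using quot[of t] x by simp
  qed
  have dpos: "poly (pderiv p) x \<ge> 0" if x: "x > 0" for x
    using quot[OF x] pos[OF x] by (simp add: zero_le_divide_iff)
  have lim: "poly r 0 \<ge> 0" if "\<And>x. x > 0 \<Longrightarrow> poly r x \<ge> 0" for r :: "real poly"
  proof (rule tendsto_lowerbound)
    show "(poly r \<longlongrightarrow> poly r 0) (at_right 0)"
      by (intro tendsto_intros) 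
    show "\<forall>\<^sub>F x in at_right 0. 0 \<le> poly r x"
      using eventually_at_right_less[of "0 :: real"] by eventually_elim (use that in auto)
  qed simp
  show "b0 \<ge> 0" using lim[of p] less_imp_le[OF pos] by (simp add: p_def)
  show "b1 \<ge> 0" using lim[of "pderiv p"] dpos by (simp add: p_def pderiv_pCons)
qed

section \<open>The quartic of the kernel\<close>

text \<open>
The nontrivial factors of the coefficients of degree 1, 2 and 3 of the quartic in \<open>\<xi> = \<eta> - 1/2\<close>.
\<close>

definition "shift_factor1 M \<mu> = 50 + 35 * (M - 1) * \<mu> + (15/2 * M^2 - 45/2 * M - 5) * \<mu>^2
    + (1/2 * M^3 - 3 * M^2 + 1/2 * M + 2) * \<mu>^3" for M \<mu> :: real
definition "shift_factor2 M \<mu> = 35 + 15 * (M - 1) * \<mu> + (3/2 * M^2 - 9/2 * M - 2) * \<mu>^2" for M \<mu> :: real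
definition "shift_factor3 M \<mu> = 10 + 2 * (M - 1) * \<mu>" for M \<mu> :: real

text \<open>
The Hurwitz minors \<open>b2 b3 - b1 b4\<close> and \<open>b1 (b2 b3 - b1 b4) - b0 b3\<^sup>2\<close> without the positive factors
\<open>\<mu>\<^sup>5 C\<close> and \<open>\<mu>\<^sup>6 C\<close>, where \<open>C = (M + 1)\<^sup>2 (M + 2) (M + 3)\<close>.
\<close>

definition "minor_factor2 M \<mu> = (M + 2) * shift_factor2 M \<mu> * shift_factor3 M \<mu> - (M + 4) * shift_factor1 M \<mu>"
definition "minor_factor3 M \<mu> q = (M + 1) * shift_factor1 M \<mu> * minor_factor2 M \<mu> - q * (M + 2) * (M + 3) * (shift_factor3 M \<mu>)^2"

lemma P_complex_shift:
  fixes m :: nat and \<mu> :: real and \<xi> :: complex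
  defines "M \<equiv> real m"
  shows "P_complex m \<mu> (1/2 + \<xi>) = of_real (q_poly m \<mu>) + of_real (\<mu> * (M + 1) * shift_factor1 M \<mu>) * \<xi>
     + of_real (\<mu>^2 * (M + 1) * (M + 2) * shift_factor2 M \<mu>) * \<xi>^2
     + of_real (\<mu>^3 * (M + 1) * (M + 2) * (M + 3) * shift_factor3 M \<mu>) * \<xi>^3
     + of_real (\<mu>^4 * (M + 1) * (M + 2) * (M + 3) * (M + 4)) * \<xi>^4"
proof -
  have half: "(1/2 + \<xi>)^2 = 1/4 + \<xi> + \<xi>^2" "(1/2 + \<xi>)^3 = 1/8 + 3/4 * \<xi> + 3/2 * \<xi>^2 + \<xi>^3"
    "(1/2 + \<xi>)^4 = 1/16 + 1/2 * \<xi> + 3/2 * \<xi>^2 + 2 * \<xi>^3 + \<xi>^4"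
    by (simp_all add: power2_eq_square power3_eq_cube power4_eq_xxxx field_simps)
  define a where "a j = rising_coeff \<mu> j * pochhammer (M + 1) j" for j
  have coeff: "q_poly m \<mu> = a 0 + a 1 / 2 + a 2 / 4 + a 3 / 8 + a 4 / 16"
    "\<mu> * (M + 1) * shift_factor1 M \<mu> = a 1 + a 2 + 3/4 * a 3 + a 4 / 2"
    "\<mu>^2 * (M + 1) * (M + 2) * shift_factor2 M \<mu> = a 2 + 3/2 * a 3 + 3/2 * a 4"
    "\<mu>^3 * (M + 1) * (M + 2) * (M + 3) * shift_factor3 M \<mu> = a 3 + 2 * a 4"
    "\<mu>^4 * (M + 1) * (M + 2) * (M + 3) * (M + 4) = a 4"
    unfolding q_poly_def a_def rising_coeff_def shift_factor1_def shift_factor2_def shift_factor3_def M_def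
    by (simp_all add: eval_nat_numeral pochhammer_Suc) (simp_all add: field_simps)
  have "P_complex m \<mu> (1/2 + \<xi>) = of_real (a 0) + of_real (a 1) * (1/2 + \<xi>) + of_real (a 2) * (1/2 + \<xi>)^2
      + of_real (a 3) * (1/2 + \<xi>)^3 + of_real (a 4) * (1/2 + \<xi>)^4"
    unfolding P_complex_def a_def M_def by (simp add: eval_nat_numeral)
  also have "\<dots> = of_real (a 0 + a 1 / 2 + a 2 / 4 + a 3 / 8 + a 4 / 16) + of_real (a 1 + a 2 + 3/4 * a 3 + a 4 / 2) * \<xi>
     + of_real (a 2 + 3/2 * a 3 + 3/2 * a 4) * \<xi>^2 + of_real (a 3 + 2 * a 4) * \<xi>^3 + of_real (a 4) * \<xi>^4"
    unfolding half by (simp add: field_simps)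
  finally show ?thesis unfolding coeff .
qed

lemma P_complex_nonzero:
  fixes m :: nat
  assumes m: "m \<ge> 1" and \<mu>: "\<mu> > 0" and q: "q_poly m \<mu> \<ge> 0"
    and minor2: "minor_factor2 m \<mu> > 0" and minor3: "minor_factor3 m \<mu> (q_poly m \<mu>) \<ge> 0"
    and \<eta>: "Re \<eta> > 1/2"
  shows "P_complex m \<mu> \<eta> \<noteq> 0"
proof -
  define M where "M = real m"
  define C where "C = (M + 1)^2 * (M + 2) * (M + 3)"
  have M: "M \<ge> 1" using m by (simp add: M_def)
  have C: "C > 0" using M by (simp add: C_def)
  have f3: "shift_factor3 M \<mu> > 0" using M \<mu> by (simp add: shift_factor3_def add_pos_nonneg)
  let ?b1 = "\<mu> * (M + 1) * shift_factor1 M \<mu>"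
  let ?b2 = "\<mu>^2 * (M + 1) * (M + 2) * shift_factor2 M \<mu>"
  let ?b3 = "\<mu>^3 * (M + 1) * (M + 2) * (M + 3) * shift_factor3 M \<mu>"
  let ?b4 = "\<mu>^4 * (M + 1) * (M + 2) * (M + 3) * (M + 4)"
  have 2: "?b2 * ?b3 - ?b1 * ?b4 = \<mu>^5 * C * minor_factor2 M \<mu>"
    unfolding minor_factor2_def C_def by algebra
  have 3: "?b1 * (?b2 * ?b3 - ?b1 * ?b4) - q_poly m \<mu> * ?b3\<^sup>2 = \<mu>^6 * C * minor_factor3 M \<mu> (q_poly m \<mu>)"
    unfolding 2 minor_factor3_def C_def by algebra
  have "of_real (q_poly m \<mu>) + of_real ?b1 * (\<eta> - 1/2) + of_real ?b2 * (\<eta> - 1/2)^2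
      + of_real ?b3 * (\<eta> - 1/2)^3 + of_real ?b4 * (\<eta> - 1/2)^4 \<noteq> 0"
  proof (rule quartic_no_root_right_half_plane[OF q])
    show "?b3 > 0" using M \<mu> f3 by simp
    show "?b4 \<ge> 0" using M \<mu> by simp
    show "?b2 * ?b3 - ?b1 * ?b4 > 0" unfolding 2 using \<mu> C minor2 by (simp add: M_def)
    show "?b1 * (?b2 * ?b3 - ?b1 * ?b4) - q_poly m \<mu> * ?b3\<^sup>2 \<ge> 0"
      unfolding 3 using \<mu> C minor3 by (simp add: M_def)
  qed (use \<eta> in simp)
  then show ?thesis using P_complex_shift[of m \<mu> "\<eta> - 1/2"] by (simp add: M_def)
qed

lemma P_complex_zero:
  fixes m :: nat
  assumes \<mu>: "\<mu> > 0" and neg: "q_poly m \<mu> < 0 \<or> shift_factor1 m \<mu> < 0"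
  shows "\<exists>\<eta>. Re \<eta> > 1/2 \<and> P_complex m \<mu> \<eta> = 0"
proof (rule ccontr)
  assume no: "\<not> ?thesis"
  define M where "M = real m"
  have M: "M \<ge> 0" by (simp add: M_def)
  have stable: "of_real (q_poly m \<mu>) + of_real (\<mu> * (M + 1) * shift_factor1 M \<mu>) * \<xi>
     + of_real (\<mu>^2 * (M + 1) * (M + 2) * shift_factor2 M \<mu>) * \<xi>^2
     + of_real (\<mu>^3 * (M + 1) * (M + 2) * (M + 3) * shift_factor3 M \<mu>) * \<xi>^3
     + of_real (\<mu>^4 * (M + 1) * (M + 2) * (M + 3) * (M + 4)) * \<xi>^4 \<noteq> 0" if "Re \<xi> > 0" for \<xi> :: complex
  proof -
    have "P_complex m \<mu> (1/2 + \<xi>) \<noteq> 0" using no that by auto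
    then show ?thesis unfolding P_complex_shift M_def .
  qed
  have "\<mu>^4 * (M + 1) * (M + 2) * (M + 3) * (M + 4) > 0" using \<mu> M by simp
  note nonneg = quartic_stable_coeffs_nonneg[OF this stable]
  have "\<mu> * (M + 1) * shift_factor1 M \<mu> < 0" if "shift_factor1 m \<mu> < 0"
    using that \<mu> M by (simp add: M_def mult_pos_neg)
  then show False using nonneg neg by fastforce
qed

text \<open>
Substituting \<open>m = 8 + x\<close> makes every coefficient of these polynomials in \<open>x\<close> and \<open>\<mu>\<close> positive.
\<close>

lemma minor_factors_large:
  fixes \<mu> :: real and m :: nat
  assumes "m \<ge> 8" "\<mu> > 0"
  shows "q_poly m \<mu> > 0" "minor_factor2 m \<mu> > 0" "minor_factor3 m \<mu> (q_poly m \<mu>) > 0"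
proof -
  define x where "x = real m - 8"
  have x: "x \<ge> 0" and m: "real m = 8 + x" using assms by (auto simp: x_def)
  have q: "q_poly m \<mu> = (4 + (8 + x) * \<mu>) * (6 + 127/4 * \<mu> + 19/4 * x * \<mu> +
      24 * \<mu>^2 + 11 * x * \<mu>^2 + x^2 * \<mu>^2 + 1/8 * \<mu>^3 + 47/16 * x * \<mu>^3 +
      7/8 * x^2 * \<mu>^3 + 1/16 * x^3 * \<mu>^3)"
    unfolding q_poly_def m by (simp add: field_simps power2_eq_square power3_eq_cube)
  show "q_poly m \<mu> > 0"
    unfolding q using x assms(2) by (intro mult_pos_pos add_pos_nonneg) auto
  have 2: "minor_factor2 m \<mu> = 2900 + 300 * x + 12460 * \<mu> + 3075 * x * \<mu> +
      185 * x^2 * \<mu> + 16960 * \<mu>^2 + 6735 * x * \<mu>^2 + 1755/2 * x^2 * \<mu>^2 +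
      75/2 * x^3 * \<mu>^2 + 7280 * \<mu>^3 + 4050 * x * \<mu>^3 + 1665/2 * x^2 * \<mu>^3 +
      75 * x^3 * \<mu>^3 + 5/2 * x^4 * \<mu>^3"
    unfolding minor_factor2_def shift_factor1_def shift_factor2_def shift_factor3_def m
    by (simp add: field_simps power2_eq_square power3_eq_cube power4_eq_xxxx)
  show "minor_factor2 m \<mu> > 0"
    unfolding 2 using x assms(2) by (intro add_pos_nonneg) auto
  have 3: "minor_factor3 m \<mu> (q_poly m \<mu>) = 1041000 + 229600 * x + 12600 * x^2 +
      9337300 * \<mu> + 3403030 * x * \<mu> + 409620 * x^2 * \<mu> + 16290 * x^3 * \<mu> +
      33048360 * \<mu>^2 + 17031601 * x * \<mu>^2 + 3261287 * x^2 * \<mu>^2 + 275115 * x^3 * \<mu>^2 +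
      8629 * x^4 * \<mu>^2 + 58910600 * \<mu>^3 + 39761800 * x * \<mu>^3 + 10625750 * x^2 * \<mu>^3 +
      1406400 * x^3 * \<mu>^3 + 92250 * x^4 * \<mu>^3 + 2400 * x^5 * \<mu>^3 + 55445000 * \<mu>^4 +
      46920890 * x * \<mu>^4 + 16339500 * x^2 * \<mu>^4 + 3000870 * x^3 * \<mu>^4 +
      306870 * x^4 * \<mu>^4 + 16580 * x^5 * \<mu>^4 + 370 * x^6 * \<mu>^4 + 25832100 * \<mu>^5 +
      26737730 * x * \<mu>^5 + 11664910 * x^2 * \<mu>^5 + 2786950 * x^3 * \<mu>^5 +
      394500 * x^4 * \<mu>^5 + 33130 * x^5 * \<mu>^5 + 1530 * x^6 * \<mu>^5 + 30 * x^7 * \<mu>^5 +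
      4564840 * \<mu>^6 + 5719189 * x * \<mu>^6 + 3059725 * x^2 * \<mu>^6 + 916955 * x^3 * \<mu>^6 +
      168891 * x^4 * \<mu>^6 + 19623 * x^5 * \<mu>^6 + 1407 * x^6 * \<mu>^6 + 57 * x^7 * \<mu>^6 +
      x^8 * \<mu>^6"
    unfolding minor_factor3_def m 2[unfolded m] shift_factor1_def shift_factor3_def q[unfolded m] by algebra
  show "minor_factor3 m \<mu> (q_poly m \<mu>) > 0"
    unfolding 3 using x assms(2) by (intro add_pos_nonneg) auto
qed

section \<open>Up to and beyond the first root\<close>

definition horner :: "real list \<Rightarrow> real \<Rightarrow> real" where
  "horner cs x = foldr (\<lambda>c r. c + x * r) cs 0"

text \<open>
Replacing \<open>x\<close> by \<open>U\<close> where the inner Horner value is negative, and by 0 where it is positive, bounds the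
polynomial below on the whole interval by a number.
\<close>

lemma horner_ge:
  assumes "0 \<le> x" "x \<le> U"
  shows "foldr (\<lambda>c r. c + U * min r 0) cs 0 \<le> horner cs x"
  unfolding horner_def
proof (induction cs)
  case (Cons c cs)
  define l where "l = foldr (\<lambda>c r. c + U * min r 0) cs 0"
  define r where "r = foldr (\<lambda>c r. c + x * r) cs 0"
  have lr: "min l 0 \<le> r \<or> 0 \<le> r" "min l 0 \<le> 0" using Cons.IH by (auto simp: l_def r_def)
  have "U * min l 0 \<le> x * min l 0" using assms lr(2) by (intro mult_right_mono_neg) auto
  also have "\<dots> \<le> x * r"
    using lr assms(1) by (intro mult_left_mono) auto
  finally show ?case by (simp add: l_def r_def)
qed simp

lemmas minor_factor_defs = minor_factor2_def minor_factor3_def shift_factor1_def shift_factor2_def shift_factor3_def q_poly_def horner_def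

text \<open>
Numbers at which \<open>q\<^sub>m\<close> is already negative; the smallest positive root lies below them. The entry for
\<open>m = 0\<close> is a placeholder.
\<close>

definition first_root_bound :: "nat \<Rightarrow> real" where
  "first_root_bound m = [0, 3/2, 3/2, 2, 5/2, 3, 9/2, 9] ! m"

lemma minor_factors_small:
  fixes m :: nat
  assumes m: "1 \<le> m" "m \<le> 7" and \<mu>: "0 \<le> \<mu>" "\<mu> \<le> first_root_bound m"
  shows "minor_factor2 m \<mu> > 0 \<and> minor_factor3 m \<mu> (q_poly m \<mu>) \<ge> 0"
proof -
  have *: ?thesis
    if "minor_factor2 m \<mu> = horner as \<mu>" "minor_factor3 m \<mu> (q_poly m \<mu>) = horner bs \<mu>"
      "foldr (\<lambda>c r. c + first_root_bound m * min r 0) as 0 > 0" "foldr (\<lambda>c r. c + first_root_bound m * min r 0) bs 0 \<ge> 0" for as bs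
    using horner_ge[OF \<mu>, of as] horner_ge[OF \<mu>, of bs] that by linarith
  consider "m = 1" | "m = 2" | "m = 3" | "m = 4" | "m = 5" | "m = 6" | "m = 7"
    using m by linarith
  then show ?thesis
  proof cases
    case 1
    show ?thesis
    proof (rule *)
      show "minor_factor2 m \<mu> = horner [800, 0, -50] \<mu>"
        unfolding 1 minor_factor_defs by (simp add: algebra_simps power2_eq_square power3_eq_cube)
      show "minor_factor3 m \<mu> (q_poly m \<mu>) = horner [51200, 0, -16000, 0, 800] \<mu>"
        unfolding 1 minor_factor_defs by simp algebra
    qed (simp_all add: 1 first_root_bound_def eval_nat_numeral)
  next
    case 2
    show ?thesis
    proof (rule *)
      show "minor_factor2 m \<mu> = horner [1100, 670, 40, -10] \<mu>"
        unfolding 2 minor_factor_defs by (simp add: algebra_simps power2_eq_square power3_eq_cube)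
      show "minor_factor3 m \<mu> (q_poly m \<mu>) = horner [117000, 146800, 23430, -22000, -6100, 0, 70] \<mu>"
        unfolding 2 minor_factor_defs by simp algebra
    qed (simp_all add: 2 first_root_bound_def eval_nat_numeral)
  next
    case 3
    show ?thesis
    proof (rule *)
      show "minor_factor2 m \<mu> = horner [1400, 1710, 535, 30] \<mu>"
        unfolding 3 minor_factor_defs by (simp add: algebra_simps power2_eq_square power3_eq_cube)
      show "minor_factor3 m \<mu> (q_poly m \<mu>) = horner [208000, 526400, 426280, 101600, -18200, -8800, -480] \<mu>"
        unfolding 3 minor_factor_defs by simp algebra
    qed (simp_all add: 3 first_root_bound_def eval_nat_numeral)
  next
    case 4
    show ?thesis
    proof (rule *)
      show "minor_factor2 m \<mu> = horner [1700, 3120, 1660, 240] \<mu>"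
        unfolding 4 minor_factor_defs by (simp add: algebra_simps power2_eq_square power3_eq_cube)
      show "minor_factor3 m \<mu> (q_poly m \<mu>) = horner [324200, 1236540, 1704212, 1024200, 234080, -2820, -4572] \<mu>"
        unfolding 4 minor_factor_defs by simp algebra
    qed (simp_all add: 4 first_root_bound_def eval_nat_numeral)
  next
    case 5
    show ?thesis
    proof (rule *)
      show "minor_factor2 m \<mu> = horner [2000, 4900, 3640, 800] \<mu>"
        unfolding 5 minor_factor_defs by (simp add: algebra_simps power2_eq_square power3_eq_cube)
      show "minor_factor3 m \<mu> (q_poly m \<mu>) = horner [465600, 2374960, 4575984, 4173200, 1811600, 309120, 6400] \<mu>"
        unfolding 5 minor_factor_defs by simp algebra
    qed (simp_all add: 5 first_root_bound_def eval_nat_numeral)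
  next
    case 6
    show ?thesis
    proof (rule *)
      show "minor_factor2 m \<mu> = horner [2300, 7050, 6700, 1950] \<mu>"
        unfolding 6 minor_factor_defs by (simp add: algebra_simps power2_eq_square power3_eq_cube)
      show "minor_factor3 m \<mu> (q_poly m \<mu>) = horner [632200, 4039400, 9967450, 12038000, 7357300, 2066600, 187050] \<mu>"
        unfolding 6 minor_factor_defs by simp algebra
    qed (simp_all add: 6 first_root_bound_def eval_nat_numeral)
  next
    case 7
    show ?thesis
    proof (rule *)
      show "minor_factor2 m \<mu> = horner [2600, 9570, 11065, 3990] \<mu>"
        unfolding 7 minor_factor_defs by (simp add: algebra_simps power2_eq_square power3_eq_cube)
      show "minor_factor3 m \<mu> (q_poly m \<mu>) = horner [824000, 6327600, 19011560, 28458000, 22153400, 8335200, 1139040] \<mu>"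
        unfolding 7 minor_factor_defs by simp algebra
    qed (simp_all add: 7 first_root_bound_def eval_nat_numeral)
  qed
qed

lemma q_poly_first_root_bound:
  assumes "1 \<le> m" "m \<le> 7"
  shows "q_poly m (first_root_bound m) \<le> 0" "first_root_bound m > 0"
proof -
  have "m = 1 \<or> m = 2 \<or> m = 3 \<or> m = 4 \<or> m = 5 \<or> m = 6 \<or> m = 7" using assms by linarith
  then show "q_poly m (first_root_bound m) \<le> 0" "first_root_bound m > 0"
    by (elim disjE; simp add: q_poly_def first_root_bound_def eval_nat_numeral)+
qed

lemma q_poly_zero_between:
  assumes "0 < \<mu>" "q_poly m \<mu> \<le> 0"
  shows "\<exists>x>0. x \<le> \<mu> \<and> q_poly m x = 0"
proof -
  have "\<exists>x\<ge>0. x \<le> \<mu> \<and> q_poly m x = 0"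
    by (rule IVT2') (use assms in \<open>auto simp: q_poly_def intro!: continuous_intros\<close>)
  moreover have "q_poly m 0 \<noteq> 0" by (simp add: q_poly_def)
  ultimately show ?thesis by (metis order_le_less)
qed

lemma q_poly_nonneg_up_to_root:
  assumes m: "1 \<le> m" "m \<le> 7" and \<mu>: "0 < \<mu>" "\<mu> \<le> smallest_positive_root m"
  shows "q_poly m \<mu> \<ge> 0"
proof (rule ccontr)
  assume neg: "\<not> q_poly m \<mu> \<ge> 0"
  then obtain x where x: "x > 0" "x \<le> \<mu>" "q_poly m x = 0"
    using q_poly_zero_between[of \<mu> m] \<mu> by auto
  then have "smallest_positive_root m \<le> x" using smallest_positive_root(3)[OF m] by blast
  then have "x = \<mu>" using x \<mu> by linarith
  then show False using x neg by simp
qed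

lemma smallest_positive_root_le_bound:
  assumes m: "1 \<le> m" "m \<le> 7"
  shows "smallest_positive_root m \<le> first_root_bound m"
  using q_poly_zero_between[OF q_poly_first_root_bound(2)[OF m] q_poly_first_root_bound(1)[OF m]]
    smallest_positive_root(3)[OF m] by fastforce

text \<open>
The expression in \<open>pos\<close> is \<open>- x y\<close> times the difference quotient of the cubic divided by its argument,
which is therefore smaller at \<open>y\<close> than at \<open>x\<close>.
\<close>

lemma cubic_neg_after_root:
  fixes x y \<alpha> \<beta> \<kappa> :: real
  assumes xy: "0 < x" "x < y" and root: "6 + \<alpha> * x + \<beta> * x^2 + \<kappa> * x^3 = 0"
    and pos: "6 - \<beta> * (x * y) - \<kappa> * (x * y) * (x + y) > 0"
  shows "6 + \<alpha> * y + \<beta> * y^2 + \<kappa> * y^3 < 0"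
proof -
  have "(y - x) * (6 - \<beta> * (x * y) - \<kappa> * (x * y) * (x + y)) =
      y * (6 + \<alpha> * x + \<beta> * x^2 + \<kappa> * x^3) - x * (6 + \<alpha> * y + \<beta> * y^2 + \<kappa> * y^3)"
    by algebra
  moreover have "(y - x) * (6 - \<beta> * (x * y) - \<kappa> * (x * y) * (x + y)) > 0"
    using xy pos by (intro mult_pos_pos) auto
  ultimately have "x * (6 + \<alpha> * y + \<beta> * y^2 + \<kappa> * y^3) < 0" using root by simp
  then show ?thesis using xy by (simp add: mult_less_0_iff)
qed

text \<open>
For \<open>\<beta> > 0\<close> division by the argument is not enough; the cubic divided by the third power of its argument
decreases.
\<close>

lemma cubic_neg_after_root':
  fixes x y \<alpha> \<beta> \<kappa> :: real
  assumes xy: "0 < x" "x < y" and root: "6 + \<alpha> * x + \<beta> * x^2 +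
      \<kappa> * x^3 = 0" and nonneg: "\<alpha> \<ge> 0" "\<beta> \<ge> 0"
  shows "6 + \<alpha> * y + \<beta> * y^2 + \<kappa> * y^3 < 0"
proof -
  have "(y - x) * (6 * (x^2 + x * y + y^2) + \<alpha> * (x * y) * (x + y) + \<beta> * (x * y)^2) =
      y^3 * (6 + \<alpha> * x + \<beta> * x^2 + \<kappa> * x^3) - x^3 * (6 + \<alpha> * y + \<beta> * y^2 + \<kappa> * y^3)"
    by algebra
  moreover have "(y - x) * (6 * (x^2 + x * y + y^2) + \<alpha> * (x * y) * (x + y) + \<beta> * (x * y)^2) > 0"
    using xy nonneg by (intro mult_pos_pos add_pos_nonneg) auto
  ultimately have "x^3 * (6 + \<alpha> * y + \<beta> * y^2 + \<kappa> * y^3) < 0" using root by simp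
  then show ?thesis using xy by (simp add: mult_less_0_iff)
qed

text \<open>
For \<open>m \<ge> 3\<close> the cubic factor of \<open>q\<^sub>m\<close> stays negative after its first root. For \<open>m = 1, 2\<close> its leading coefficient
is positive and \<open>q\<^sub>m\<close> becomes positive again, but before that happens the linear coefficient of the shifted quartic
has become negative.
\<close>

lemma unstable_after_root:
  assumes m: "1 \<le> m" "m \<le> 7" and \<mu>: "smallest_positive_root m < \<mu>"
  shows "q_poly m \<mu> < 0 \<or> shift_factor1 m \<mu> < 0"
proof -
  define r where "r = smallest_positive_root m"
  define \<alpha> where "\<alpha> = 1/4 * (19 * real m - 25)"
  define \<beta> where "\<beta> = real m * (real m - 5)"
  define \<kappa> where "\<kappa> = 1/16 * (real m ^ 3 - 10 * real m ^ 2 + 15 * real m + 10)"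
  let ?d = "6 - \<beta> * (r * \<mu>) - \<kappa> * (r * \<mu>) * (r + \<mu>)"
  have q: "q_poly m x = (4 + real m * x) * (6 + \<alpha> * x + \<beta> * x^2 + \<kappa> * x^3)" for x
    by (simp add: q_poly_def \<alpha>_def \<beta>_def \<kappa>_def)
  have r: "r > 0" "q_poly m r = 0" using smallest_positive_root[OF m] by (auto simp: r_def)
  have pos: "4 + real m * x > 0" if "x > 0" for x using that by (simp add: add_pos_nonneg)
  have root: "6 + \<alpha> * r + \<beta> * r^2 + \<kappa> * r^3 = 0" using r pos[of r] unfolding q by simp
  have r\<mu>: "r < \<mu>" using \<mu> by (simp add: r_def)
  have \<mu>0: "\<mu> > 0" using r r\<mu> by linarith
  have qneg: "q_poly m \<mu> < 0" if "6 + \<alpha> * \<mu> + \<beta> * \<mu>^2 + \<kappa> * \<mu>^3 < 0"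
    unfolding q using that pos[OF \<mu>0] by (intro mult_pos_neg)
  have neg1: "q_poly m \<mu> < 0" if "?d > 0"
    using qneg cubic_neg_after_root[OF r(1) r\<mu> root that] by blast
  have r\<mu>0: "r * \<mu> > 0" using r \<mu>0 by simp
  consider "m = 1" | "m = 2" | "3 \<le> m" "m \<le> 5" | "6 \<le> m" "m \<le> 7" using m by linarith
  then show ?thesis
  proof cases
    case 1
    show ?thesis
    proof (cases "\<mu> \<le> 2")
      case True
      have "?d = 6 + (r * \<mu>) * (4 - (r + \<mu>))"
        by (simp add: 1 \<beta>_def \<kappa>_def algebra_simps)
      also have "\<dots> > 0" using r\<mu>0 True r\<mu> r(1) \<mu>0 by (intro add_pos_nonneg mult_nonneg_nonneg) auto
      finally show ?thesis using neg1 by blast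
    next
      case False
      have "2 * 2 < \<mu> * \<mu>" using False by (intro mult_strict_mono) auto
      then have "shift_factor1 m \<mu> < 0" by (simp add: 1 shift_factor1_def power2_eq_square)
      then show ?thesis by blast
    qed
  next
    case 2
    show ?thesis
    proof (cases "\<mu> \<le> 4")
      case True
      have "?d = 6 + (r * \<mu>) * (6 - (r + \<mu>) / 2)"
        by (simp add: 2 \<beta>_def \<kappa>_def algebra_simps)
      also have "\<dots> > 0" using r\<mu>0 True r\<mu> r(1) \<mu>0 by (intro add_pos_nonneg mult_nonneg_nonneg) auto
      finally show ?thesis using neg1 by blast
    next
      case False
      have "\<mu> * 4 < \<mu> * \<mu>" using False by (intro mult_strict_left_mono) auto
      moreover have "\<mu>^3 \<ge> 0" using \<mu>0 by simp
      ultimately have "50 + 35 * \<mu> - 20 * \<mu>^2 - 5 * \<mu>^3 < 0"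
        using False unfolding power2_eq_square by linarith
      moreover have "shift_factor1 m \<mu> = 50 + 35 * \<mu> - 20 * \<mu>^2 - 5 * \<mu>^3"
        by (simp add: 2 shift_factor1_def)
      ultimately show ?thesis by simp
    qed
  next
    case 3
    have "\<beta> \<le> 0" using 3 by (simp add: \<beta>_def mult_nonneg_nonpos)
    moreover have "\<kappa> \<le> 0"
    proof -
      have "m = 3 \<or> m = 4 \<or> m = 5" using 3 by linarith
      then show ?thesis by (elim disjE) (simp_all add: \<kappa>_def)
    qed
    ultimately have "- \<beta> * (r * \<mu>) \<ge> 0" "- \<kappa> * (r * \<mu>) * (r + \<mu>) \<ge> 0"
      using r\<mu>0 r \<mu>0 by (intro mult_nonneg_nonneg; simp)+
    then show ?thesis using neg1 by simp
  next
    case 4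
    have "\<alpha> \<ge> 0" "\<beta> \<ge> 0" using 4 by (simp_all add: \<alpha>_def \<beta>_def)
    then show ?thesis using qneg cubic_neg_after_root'[OF r(1) r\<mu> root] by blast
  qed
qed

theorem mainTheorem6:
  shows "(CARD('m::finite) \<ge> 8 \<longrightarrow>
            (\<forall>\<mu>>0. lu_qikeng_domain (hartogs_ball \<mu> :: (complex ^ (4 + 'm)) set))) \<and>
         (1 \<le> CARD('m) \<and> CARD('m) \<le> 7 \<longrightarrow>
            (\<forall>\<mu>>0. lu_qikeng_domain (hartogs_ball \<mu> :: (complex ^ (4 + 'm)) set)
               \<longleftrightarrow> 0 < \<mu> \<and> \<mu> \<le> smallest_positive_root CARD('m)))"
proof (intro conjI impI allI)
  fix \<mu> :: real
  assume "CARD('m) \<ge> 8" "0 < \<mu>"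
  then show "lu_qikeng_domain (hartogs_ball \<mu> :: (complex ^ (4 + 'm)) set)"
    using P_complex_nonzero[of "CARD('m)" \<mu>] minor_factors_large[of "CARD('m)" \<mu>]
    by (simp add: lu_qikeng_hartogs_ball_iff less_imp_le)
next
  fix \<mu> :: real
  assume m: "1 \<le> CARD('m) \<and> CARD('m) \<le> 7" and \<mu>: "0 < \<mu>"
  show "lu_qikeng_domain (hartogs_ball \<mu> :: (complex ^ (4 + 'm)) set)
      \<longleftrightarrow> 0 < \<mu> \<and> \<mu> \<le> smallest_positive_root CARD('m)"
  proof (cases "\<mu> \<le> smallest_positive_root CARD('m)")
    case True
    have "\<mu> \<le> first_root_bound CARD('m)"
      using True smallest_positive_root_le_bound[of "CARD('m)"] m by linarith
    then have "P_complex CARD('m) \<mu> \<eta> \<noteq> 0" if "Re \<eta> > 1/2" for \<eta>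
      using minor_factors_small[of "CARD('m)" \<mu>] q_poly_nonneg_up_to_root[of "CARD('m)" \<mu>] m \<mu> True that
      by (intro P_complex_nonzero) auto
    then show ?thesis using True \<mu> by (simp add: lu_qikeng_hartogs_ball_iff)
  next
    case False
    then have "\<exists>\<eta>. Re \<eta> > 1/2 \<and> P_complex CARD('m) \<mu> \<eta> = 0"
      using unstable_after_root[of "CARD('m)" \<mu>] m \<mu> by (intro P_complex_zero) auto
    then show ?thesis using False \<mu> by (auto simp: lu_qikeng_hartogs_ball_iff)
  qed
qed

end
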